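(* Let $d\ge2$, $k\ge0$, $0<\nu\le1$, $f\in L^2(\Omega;\mathbb R^d)$. Consider the stress-hybridized method (H): find $(u_h,\lambda_h,p_h)\in\mathring{\mathbb V}_h^{\operatorname{div}}\times\Lambda_h^t\times\mathring{\mathcal Q}_h$ such that $$\nu(\operatorname{dev}\varepsilon_w(u_h,\lambda_h),\operatorname{dev}\varepsilon_w(v_h,\mu_h))+(u_h,v_h)+(\operatorname{div}v_h,p_h)=(f,v_h),\qquad(\operatorname{div}u_h,q_h)=0$$ for all $(v_h,\mu_h,q_h)\in\mathring{\mathbb V}_h^{\operatorname{div}}\times\Lambda_h^t\times\mathring{\mathcal Q}_h$; and the mixed method (D): find $(\sigma_h,u_h,p_h)\in\Sigma_h^{tn}\times\mathring{\mathbb V}_h^{\operatorname{div}}\times\mathring{\mathcal Q}_h$ such that $$\nu^{-1}(\sigma_h,\tau_h)+b_h(\tau_h,q_h;u_h)=0,\qquad b_h(\sigma_h,p_h;v_h)-(u_h,v_h)=-(f,v_h)$$ for all $(\tau_h,q_h,v_h)\in\Sigma_h^{tn}\times\mathring{\mathcal Q}_h\times\mathring{\mathbb V}_h^{\operatorname{div}}$. Then (H) is well posed and algebraically equivalent to (D). If $(u_h,\lambda_h,p_h)$ solves (H), then $\sigma_h:=\nu\operatorname{dev}\varepsilon_w(u_h,\lambda_h)$ together with $(u_h,p_h)$ solves (D).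
   Context: Algebra. $\mathbb S,\mathbb K,\mathbb T$ are the symmetric, skew-symmetric and traceless matrices in $\mathbb R^{d\times d}$; $\operatorname{dev}\tau=\tau-\frac1d(\operatorname{tr}\tau)I$; $a\otimes b=ab^{\intercal}$; matrix divergence is row-wise. $(\cdot,\cdot)_D$: $L^2(D)$ inner product ($D$ omitted if $D=\Omega$). $\mathbb P_m(D;\mathbb X)$: $\mathbb X$-valued polynomials of total degree $\le m$. Mesh. $\Omega\subset\mathbb R^d$ is a bounded connected polytope, $\mathcal T_h$ a simplicial mesh of $\Omega$ (from a shape-regular family). $\mathcal F_h,\mathring{\mathcal F}_h,\mathcal F_h^\partial$: all, interior, boundary facets; $\mathcal F(T)$: facets of $T$; $n=n_{\partial T}$: outward unit normal of $T$. Each facet $F$ has a fixed unit normal $n_F$ (outward to $\Omega$ on boundary facets; outward to $T^+$ on $F=T^+\cap T^-\in\mathring{\mathcal F}_h$); $[\![w]\!]=w^+-w^-$ across interior facets. $\Pi_Fw=(I-n_Fn_F^{\intercal})w|_F$. The tangent space of $F$ is identified with $\mathbb R^{d-1}$ through a fixed orthonormal basis. Local stress space. For a simplex $T$ with vertices $\mathtt v_0,\dots,\mathtt v_d$ and barycentric coordinates $\lambda_i$, let $F_\ell$ be the facet opposite $\mathtt v_\ell$, $t_{j,\ell}=\mathtt v_\ell-\mathtt v_j$. $\mathbb B_m^{tn}(T;\mathbb T)=\{\tau\in\mathbb P_m(T;\mathbb T):\Pi_F(\tau n)=0\ \forall F\in\mathcal F(T)\}$ ($m\ge1$). For $k\ge1$: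 $\Sigma_k^+(T;\mathbb S\cap\mathbb T)=\{\tau\in\mathbb P_k(T;\mathbb T)+\mathbb B_{k+1}^{tn}(T;\mathbb T):(\tau,q)_T=0\ \forall q\in\mathbb P_k(T;\mathbb K)\}$. For $k=0$: for a facet $F$ with barycenter $x_F^c$ let $x_F=\Pi_F(x-x_F^c)$ (also its affine extension to $T$), $\mathbb K_F=\{A\in\mathbb K:An_F=0\}$; for each $\ell=0,\dots,d$ fix $j_\ell\ne\ell$, $I_\ell=\{0,\dots,d\}\setminus\{\ell,j_\ell\}$, and for $A\in\mathbb K_{F_\ell}$ put $E_{\ell,A}=\sum_{i\in I_\ell}(t_{i,j_\ell}^{\intercal}Ax_{F_\ell})\operatorname{dev}(\nabla\lambda_i\otimes t_{i,\ell})$; $\mathbb P_0^+(T;\mathbb T)=\mathbb P_0(T;\mathbb T)+\operatorname{span}\{E_{\ell,A}:A\in\mathbb K_{F_\ell},\ \ell=0,\dots,d\}$ and $\Sigma_0^+(T;\mathbb S\cap\mathbb T)=\{\tau\in\mathbb P_0^+(T;\mathbb T)\oplus\mathbb B_1^{tn}(T;\mathbb T):(\tau,q)_T=0\ \forall q\in\mathbb P_0(T;\mathbb K)\}$. Facet spaces. $\mathcal R_k^t(F)=\mathbb P_k(F;\mathbb R^{d-1})$ if $k\ge1$; $\mathcal R_0^t(F)=\mathbb P_0(F;\mathbb R^{d-1})\oplus\{Ax_F:A\in\mathbb K_F\}$. $\Lambda_h^t$: functions $\lambda_h\in L^2(\mathcal F_h;\mathbb R^{d-1})$ (tangential on each facet)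 with $\lambda_h|_F\in\mathcal R_k^t(F)$ for $F\in\mathring{\mathcal F}_h$ and $\lambda_h|_F=0$ for $F\in\mathcal F_h^\partial$. Global spaces. $\Sigma_h^{-1}=\prod_{T}\Sigma_k^+(T;\mathbb S\cap\mathbb T)$; $\Sigma_h^{tn}=\{\tau_h\in\Sigma_h^{-1}:[\![\Pi_F\tau_hn_F]\!]=0\ \forall F\in\mathring{\mathcal F}_h\}$; $\mathring{\mathbb V}_h^{\operatorname{div}}=\{v_h\in H_0(\operatorname{div},\Omega):v_h|_T\in\mathbb P_{k+1}(T;\mathbb R^d)\ \forall T\}$, with $H_0(\operatorname{div},\Omega)$ the $L^2$ vector fields with $L^2$ divergence and zero normal trace on $\partial\Omega$; $\mathring{\mathcal Q}_h=\{q_h\in L^2(\Omega):\int_\Omega q_h=0,\ q_h|_T\in\mathbb P_k(T)\ \forall T\}$. Forms. $b_h(\tau,q;v)=\sum_T[(\operatorname{div}\tau,v)_T-(n^{\intercal}\tau n,v\cdot n)_{\partial T}]-(\operatorname{div}v,q)$. For piecewise $H^1$ vector fields $v_h$ and $\lambda_h\in\Lambda_h^t$, $\operatorname{dev}\varepsilon_w(v_h,\lambda_h)\in\Sigma_h^{-1}$ is the element uniquely determined by $$(\operatorname{dev}\varepsilon_w(v_h,\lambda_h),\tau_h)=\sum_T\Bigl[-(v_h,\operatorname{div}\tau_h)_T+(v_h\cdot n,n^{\intercal}\tau_hn)_{\partial T}+\sum_{F\in\mathcal F(T)}(\lambda_h,\Pi_F\tau_hn_{\partial T})_F\Bigr]\quad\forall\tau_h\in\Sigma_h^{-1}.$$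 *)

theory Defs
  imports "HOL-Analysis.Analysis"
begin

section \<open>Algebra and calculus\<close>

definition skew_matrices :: "(real^'n^'n) set" where
  "skew_matrices = {A. transpose A = - A}"

definition traceless_matrices :: "(real^'n^'n) set" where
  "traceless_matrices = {A. trace A = 0}"

definition dev :: "real^'n^'n \<Rightarrow> real^'n^'n" where
  "dev A = A - (trace A / real CARD('n)) *\<^sub>R mat 1"

definition outer :: "real^'n \<Rightarrow> real^'n \<Rightarrow> real^'n^'n" where
  "outer a b = (\<chi> i j. a $ i * b $ j)"

definition tproj :: "real^'n \<Rightarrow> real^'n \<Rightarrow> real^'n" where
  "tproj \<nu> w = (mat 1 - outer \<nu> \<nu>) *v w"

definition grad :: "(real^'n \<Rightarrow> real) \<Rightarrow> real^'n \<Rightarrow> real^'n" where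
  "grad f x = (\<chi> i. frechet_derivative f (at x) (axis i 1))"

definition vdiv :: "(real^'n \<Rightarrow> real^'n) \<Rightarrow> real^'n \<Rightarrow> real" where
  "vdiv v x = (\<Sum>i\<in>UNIV. frechet_derivative v (at x) (axis i 1) $ i)"

text \<open>Row-wise divergence; \<open>\<tau> y $ i\<close> is the \<open>i\<close>-th row of \<open>\<tau> y\<close>.\<close>
definition mdiv :: "(real^'n \<Rightarrow> real^'n^'n) \<Rightarrow> real^'n \<Rightarrow> real^'n" where
  "mdiv \<tau> x = (\<chi> i. vdiv (\<lambda>y. \<tau> y $ i) x)"

text \<open>Polynomials of total degree at most \<open>m\<close> with coefficients in \<open>X\<close>. A polynomial on a
  simplex with nonempty interior is identified with the polynomial function on the whole space.\<close>
definition Poly :: "nat \<Rightarrow> 'b::real_vector set \<Rightarrow> (real^'n \<Rightarrow> 'b) set" where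
  "Poly m X = {p. \<exists>c. (\<forall>\<alpha>. c \<alpha> \<in> X) \<and>
     p = (\<lambda>x. \<Sum>\<alpha> | (\<Sum>i\<in>UNIV. \<alpha> i) \<le> m. (\<Prod>i\<in>UNIV. x $ i ^ \<alpha> i) *\<^sub>R c \<alpha>)}"

definition fplus :: "('a \<Rightarrow> 'b::real_vector) set \<Rightarrow> ('a \<Rightarrow> 'b) set \<Rightarrow> ('a \<Rightarrow> 'b) set" where
  "fplus A B = {\<lambda>x. a x + b x | a b. a \<in> A \<and> b \<in> B}"

definition fspan :: "('a \<Rightarrow> 'b::real_vector) set \<Rightarrow> ('a \<Rightarrow> 'b) set" where
  "fspan G = {\<lambda>x. \<Sum>g\<in>S. c g *\<^sub>R g x | S c. finite S \<and> S \<subseteq> G}"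

definition frestrict :: "'a set \<Rightarrow> ('a \<Rightarrow> 'b::zero) \<Rightarrow> 'a \<Rightarrow> 'b" where
  "frestrict F p = (\<lambda>x. if x \<in> F then p x else 0)"


section \<open>\<open>L\<^sup>2\<close> and \<open>H\<^sub>0(div)\<close>\<close>

definition l2i :: "'a measure \<Rightarrow> ('a \<Rightarrow> 'b::euclidean_space) \<Rightarrow> ('a \<Rightarrow> 'b) \<Rightarrow> real" where
  "l2i M f g = (\<integral>x. f x \<bullet> g x \<partial>M)"

definition l2norm :: "'a measure \<Rightarrow> ('a \<Rightarrow> 'b::euclidean_space) \<Rightarrow> real" where
  "l2norm M f = sqrt (l2i M f f)"

definition L2 :: "(real^'n) set \<Rightarrow> (real^'n \<Rightarrow> 'b::euclidean_space) set" where
  "L2 D = {f. f \<in> borel_measurable (lebesgue_on D) \<and>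
              integrable (lebesgue_on D) (\<lambda>x. (norm (f x))\<^sup>2)}"

primrec Ck :: "nat \<Rightarrow> (real^'n \<Rightarrow> real) \<Rightarrow> bool" where
  "Ck 0 f = continuous_on UNIV f"
| "Ck (Suc m) f = ((\<forall>x. f differentiable (at x)) \<and> (\<forall>i. Ck m (\<lambda>x. grad f x $ i)))"

definition smooth :: "(real^'n \<Rightarrow> real) \<Rightarrow> bool" where
  "smooth f = (\<forall>m. Ck m f)"

definition weak_div :: "(real^'n) set \<Rightarrow> (real^'n \<Rightarrow> real^'n) \<Rightarrow> (real^'n \<Rightarrow> real) \<Rightarrow> bool" where
  "weak_div D v g = (\<forall>\<phi>. smooth \<phi> \<and> compact (closure {x. \<phi> x \<noteq> 0}) \<and> closure {x. \<phi> x \<noteq> 0} \<subseteq> D \<longrightarrow>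
      l2i (lebesgue_on D) v (grad \<phi>) = - l2i (lebesgue_on D) g \<phi>)"

text \<open>For \<open>v\<close> with weak divergence \<open>g\<close> the normal trace is the functional
  \<open>\<phi> \<mapsto> (v, grad \<phi>) + (g, \<phi>)\<close>. It is tested with restrictions to the bounded set \<open>D\<close> of functions
  that are smooth on the whole space, so \<open>\<phi>\<close> need not vanish on the boundary of \<open>D\<close>.\<close>
definition zero_normal_trace ::
    "(real^'n) set \<Rightarrow> (real^'n \<Rightarrow> real^'n) \<Rightarrow> (real^'n \<Rightarrow> real) \<Rightarrow> bool" where
  "zero_normal_trace D v g = (\<forall>\<phi>. smooth \<phi> \<longrightarrow>
      l2i (lebesgue_on D) v (grad \<phi>) + l2i (lebesgue_on D) g \<phi> = 0)"

definition H0_div :: "(real^'n) set \<Rightarrow> (real^'n \<Rightarrow> real^'n) set" where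
  "H0_div D = {v \<in> L2 D. \<exists>g\<in>L2 D. weak_div D v g \<and> zero_normal_trace D v g}"


section \<open>Domain and mesh\<close>

text \<open>Polytopes in the finite element sense: open and not necessarily convex.\<close>
definition polytopal_domain :: "(real^'n) set \<Rightarrow> bool" where
  "polytopal_domain \<Omega> = (\<Omega> \<noteq> {} \<and> connected \<Omega> \<and>
     (\<exists>P. finite P \<and> (\<forall>K\<in>P. polytope K) \<and> \<Omega> = interior (\<Union>P)))"

definition simplicial_mesh :: "(real^'n) set \<Rightarrow> (real^'n) set set \<Rightarrow> bool" where
  "simplicial_mesh \<Omega> Th = (triangulation Th \<and> (\<forall>T\<in>Th. int CARD('n) simplex T) \<and> closure \<Omega> = \<Union>Th)"

definition verts :: "(real^'n) set \<Rightarrow> (real^'n) set" where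
  "verts S = {v. v extreme_point_of S}"

definition barycenter :: "(real^'n) set \<Rightarrow> real^'n" where
  "barycenter S = (1 / real (card (verts S))) *\<^sub>R (\<Sum>v\<in>verts S. v)"

text \<open>Vertices are their own indices: \<open>bary T v\<close> is the barycentric coordinate of the vertex \<open>v\<close>
  and \<open>opp T v\<close> the facet opposite to it.\<close>
definition bary :: "(real^'n) set \<Rightarrow> real^'n \<Rightarrow> real^'n \<Rightarrow> real" where
  "bary T v = (THE l. (\<exists>a c. l = (\<lambda>x. a \<bullet> x + c)) \<and> (\<forall>w\<in>verts T. l w = (if w = v then 1 else 0)))"

definition opp :: "(real^'n) set \<Rightarrow> real^'n \<Rightarrow> (real^'n) set" where
  "opp T v = convex hull (verts T - {v})"

definition tvec :: "real^'n \<Rightarrow> real^'n \<Rightarrow> real^'n" where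
  "tvec v w = w - v"

definition facets_of :: "(real^'n) set \<Rightarrow> (real^'n) set set" where
  "facets_of T = {F. F facet_of T}"

definition facets :: "(real^'n) set set \<Rightarrow> (real^'n) set set" where
  "facets Th = (\<Union>T\<in>Th. facets_of T)"

definition interior_facets :: "(real^'n) set set \<Rightarrow> (real^'n) set set" where
  "interior_facets Th =
     {F. \<exists>T\<in>Th. \<exists>T'\<in>Th. T \<noteq> T' \<and> F \<in> facets_of T \<and> F \<in> facets_of T'}"

definition out_normal :: "(real^'n) set \<Rightarrow> (real^'n) set \<Rightarrow> real^'n" where
  "out_normal T F = (THE n. norm n = 1 \<and> (\<forall>x\<in>F. \<forall>y\<in>T. n \<bullet> (y - x) \<le> 0))"

text \<open>Fixed facet normals \<open>nF\<close>. A boundary facet belongs to one cell only, so there the condition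
  says that the normal points out of the domain.\<close>
definition facet_normals :: "(real^'n) set set \<Rightarrow> ((real^'n) set \<Rightarrow> real^'n) \<Rightarrow> bool" where
  "facet_normals Th nF = (\<forall>F\<in>facets Th. \<exists>T\<in>Th. F \<in> facets_of T \<and> nF F = out_normal T F)"

definition plus_cell ::
    "(real^'n) set set \<Rightarrow> ((real^'n) set \<Rightarrow> real^'n) \<Rightarrow> (real^'n) set \<Rightarrow> (real^'n) set" where
  "plus_cell Th nF F = (THE T. T \<in> Th \<and> F \<in> facets_of T \<and> out_normal T F = nF F)"

definition minus_cell ::
    "(real^'n) set set \<Rightarrow> ((real^'n) set \<Rightarrow> real^'n) \<Rightarrow> (real^'n) set \<Rightarrow> (real^'n) set" where
  "minus_cell Th nF F = (THE T. T \<in> Th \<and> F \<in> facets_of T \<and> out_normal T F = - nF F)"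

text \<open>Surface measure on the flat set \<open>F\<close> with unit normal \<open>\<nu>\<close>: the \<open>(d - 1)\<close>-dimensional measure of
  \<open>A \<subseteq> F\<close> is the volume of the right prism of height one over \<open>A\<close>.\<close>
definition facet_measure :: "real^'n \<Rightarrow> (real^'n) set \<Rightarrow> (real^'n) measure" where
  "facet_measure \<nu> F =
     distr (restrict_space lborel {x + s *\<^sub>R \<nu> | x s. x \<in> F \<and> 0 \<le> s \<and> s \<le> 1}) borel
       (\<lambda>y. y - (\<nu> \<bullet> (y - barycenter F)) *\<^sub>R \<nu>)"


section \<open>Local stress space\<close>

definition Btn :: "nat \<Rightarrow> (real^'n) set \<Rightarrow> (real^'n \<Rightarrow> real^'n^'n) set" where
  "Btn m T = {\<tau> \<in> Poly m traceless_matrices. \<forall>F\<in>facets_of T. \<forall>x\<in>F.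
      tproj (out_normal T F) (\<tau> x *v out_normal T F) = 0}"

definition skew_facet :: "real^'n \<Rightarrow> (real^'n^'n) set" where
  "skew_facet \<nu> = {A \<in> skew_matrices. A *v \<nu> = 0}"

definition xF :: "((real^'n) set \<Rightarrow> real^'n) \<Rightarrow> (real^'n) set \<Rightarrow> real^'n \<Rightarrow> real^'n" where
  "xF nF F x = tproj (nF F) (x - barycenter F)"

text \<open>\<open>j T l\<close> is the vertex of \<open>T\<close>, distinct from \<open>l\<close>, that is fixed for the vertex \<open>l\<close>.\<close>
definition Efun ::
    "((real^'n) set \<Rightarrow> real^'n) \<Rightarrow> ((real^'n) set \<Rightarrow> real^'n \<Rightarrow> real^'n) \<Rightarrow>
     (real^'n) set \<Rightarrow> real^'n \<Rightarrow> real^'n^'n \<Rightarrow> real^'n \<Rightarrow> real^'n^'n" where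
  "Efun nF j T l A x = (\<Sum>i\<in>verts T - {l, j T l}.
      (tvec i (j T l) \<bullet> (A *v xF nF (opp T l) x)) *\<^sub>R dev (outer (grad (bary T i) x) (tvec i l)))"

definition P0_plus ::
    "((real^'n) set \<Rightarrow> real^'n) \<Rightarrow> ((real^'n) set \<Rightarrow> real^'n \<Rightarrow> real^'n) \<Rightarrow>
     (real^'n) set \<Rightarrow> (real^'n \<Rightarrow> real^'n^'n) set" where
  "P0_plus nF j T = fplus (Poly 0 traceless_matrices)
      (fspan {Efun nF j T l A | l A. l \<in> verts T \<and> A \<in> skew_facet (nF (opp T l))})"

definition Sigma_plus ::
    "((real^'n) set \<Rightarrow> real^'n) \<Rightarrow> ((real^'n) set \<Rightarrow> real^'n \<Rightarrow> real^'n) \<Rightarrow> nat \<Rightarrow>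
     (real^'n) set \<Rightarrow> (real^'n \<Rightarrow> real^'n^'n) set" where
  "Sigma_plus nF j k T =
     {\<tau> \<in> fplus (if k = 0 then P0_plus nF j T else Poly k traceless_matrices) (Btn (k + 1) T).
        \<forall>q\<in>Poly k skew_matrices. l2i (lebesgue_on T) \<tau> q = 0}"


section \<open>Facet spaces\<close>

text \<open>Tangential fields on a facet \<open>F\<close> take values in the orthogonal complement of its normal, and
  are extended by zero off \<open>F\<close>.\<close>
definition Rt ::
    "((real^'n) set \<Rightarrow> real^'n) \<Rightarrow> nat \<Rightarrow> (real^'n) set \<Rightarrow> (real^'n \<Rightarrow> real^'n) set" where
  "Rt nF k F = frestrict F `
     (if k = 0 then fplus (Poly 0 {w. w \<bullet> nF F = 0}) {\<lambda>x. A *v xF nF F x | A. A \<in> skew_facet (nF F)}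
      else Poly k {w. w \<bullet> nF F = 0})"

definition Lambda_ht ::
    "(real^'n) set set \<Rightarrow> ((real^'n) set \<Rightarrow> real^'n) \<Rightarrow> nat \<Rightarrow>
     ((real^'n) set \<Rightarrow> real^'n \<Rightarrow> real^'n) set" where
  "Lambda_ht Th nF k = {\<mu>. (\<forall>F\<in>interior_facets Th. \<mu> F \<in> Rt nF k F) \<and>
      (\<forall>F. F \<notin> interior_facets Th \<longrightarrow> \<mu> F = (\<lambda>x. 0))}"


section \<open>Global spaces\<close>

text \<open>A piecewise polynomial function, up to null sets, is the family \<open>w\<close> of its polynomials
  \<open>w T\<close>, with \<open>w T = 0\<close> for \<open>T\<close> outside the mesh; \<open>pw Th w\<close> is the corresponding function.\<close>
definition broken ::
    "(real^'n) set set \<Rightarrow> ((real^'n) set \<Rightarrow> (real^'n \<Rightarrow> 'b::real_vector) set) \<Rightarrow>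
     ((real^'n) set \<Rightarrow> real^'n \<Rightarrow> 'b) set" where
  "broken Th S = {w. (\<forall>T\<in>Th. w T \<in> S T) \<and> (\<forall>T. T \<notin> Th \<longrightarrow> w T = (\<lambda>x. 0))}"

definition pw ::
    "(real^'n) set set \<Rightarrow> ((real^'n) set \<Rightarrow> real^'n \<Rightarrow> 'b::real_vector) \<Rightarrow> real^'n \<Rightarrow> 'b" where
  "pw Th w x = (\<Sum>T\<in>Th. indicator (interior T) x *\<^sub>R w T x)"

definition Sigma_h ::
    "(real^'n) set set \<Rightarrow> ((real^'n) set \<Rightarrow> real^'n) \<Rightarrow> ((real^'n) set \<Rightarrow> real^'n \<Rightarrow> real^'n) \<Rightarrow>
     nat \<Rightarrow> ((real^'n) set \<Rightarrow> real^'n \<Rightarrow> real^'n^'n) set" where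
  "Sigma_h Th nF j k = broken Th (Sigma_plus nF j k)"

definition tn_jump ::
    "(real^'n) set set \<Rightarrow> ((real^'n) set \<Rightarrow> real^'n) \<Rightarrow> ((real^'n) set \<Rightarrow> real^'n \<Rightarrow> real^'n^'n) \<Rightarrow>
     (real^'n) set \<Rightarrow> real^'n \<Rightarrow> real^'n" where
  "tn_jump Th nF \<tau> F x = tproj (nF F) (\<tau> (plus_cell Th nF F) x *v nF F)
                        - tproj (nF F) (\<tau> (minus_cell Th nF F) x *v nF F)"

definition Sigma_tn ::
    "(real^'n) set set \<Rightarrow> ((real^'n) set \<Rightarrow> real^'n) \<Rightarrow> ((real^'n) set \<Rightarrow> real^'n \<Rightarrow> real^'n) \<Rightarrow>
     nat \<Rightarrow> ((real^'n) set \<Rightarrow> real^'n \<Rightarrow> real^'n^'n) set" where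
  "Sigma_tn Th nF j k = {\<tau> \<in> Sigma_h Th nF j k.
      \<forall>F\<in>interior_facets Th. \<forall>x\<in>F. tn_jump Th nF \<tau> F x = 0}"

definition V_h ::
    "(real^'n) set \<Rightarrow> (real^'n) set set \<Rightarrow> nat \<Rightarrow> ((real^'n) set \<Rightarrow> real^'n \<Rightarrow> real^'n) set" where
  "V_h \<Omega> Th k = {v \<in> broken Th (\<lambda>T. Poly (k + 1) UNIV). pw Th v \<in> H0_div \<Omega>}"

definition Q_h ::
    "(real^'n) set \<Rightarrow> (real^'n) set set \<Rightarrow> nat \<Rightarrow> ((real^'n) set \<Rightarrow> real^'n \<Rightarrow> real) set" where
  "Q_h \<Omega> Th k = {q \<in> broken Th (\<lambda>T. Poly k UNIV). (\<integral>x. pw Th q x \<partial>lebesgue_on \<Omega>) = 0}"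


section \<open>Forms and discrete problems\<close>

definition ip ::
    "(real^'n) set \<Rightarrow> (real^'n) set set \<Rightarrow> ((real^'n) set \<Rightarrow> real^'n \<Rightarrow> 'b::euclidean_space) \<Rightarrow>
     ((real^'n) set \<Rightarrow> real^'n \<Rightarrow> 'b) \<Rightarrow> real" where
  "ip \<Omega> Th v w = l2i (lebesgue_on \<Omega>) (pw Th v) (pw Th w)"

text \<open>For fields in \<open>V_h\<close> the divergence is the piecewise one.\<close>
definition pdiv ::
    "((real^'n) set \<Rightarrow> real^'n \<Rightarrow> real^'n) \<Rightarrow> (real^'n) set \<Rightarrow> real^'n \<Rightarrow> real" where
  "pdiv v T = vdiv (v T)"

definition nn_bdry ::
    "((real^'n) set \<Rightarrow> real^'n) \<Rightarrow> (real^'n) set \<Rightarrow> (real^'n \<Rightarrow> real^'n^'n) \<Rightarrow>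
     (real^'n \<Rightarrow> real^'n) \<Rightarrow> real" where
  "nn_bdry nF T \<tau> v = (\<Sum>F\<in>facets_of T. l2i (facet_measure (nF F) F)
      (\<lambda>x. out_normal T F \<bullet> (\<tau> x *v out_normal T F)) (\<lambda>x. v x \<bullet> out_normal T F))"

definition b_h ::
    "(real^'n) set \<Rightarrow> (real^'n) set set \<Rightarrow> ((real^'n) set \<Rightarrow> real^'n) \<Rightarrow>
     ((real^'n) set \<Rightarrow> real^'n \<Rightarrow> real^'n^'n) \<Rightarrow> ((real^'n) set \<Rightarrow> real^'n \<Rightarrow> real) \<Rightarrow>
     ((real^'n) set \<Rightarrow> real^'n \<Rightarrow> real^'n) \<Rightarrow> real" where
  "b_h \<Omega> Th nF \<tau> q v =
     (\<Sum>T\<in>Th. l2i (lebesgue_on T) (mdiv (\<tau> T)) (v T) - nn_bdry nF T (\<tau> T) (v T))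
     - ip \<Omega> Th (pdiv v) q"

definition dev_eps_w ::
    "(real^'n) set \<Rightarrow> (real^'n) set set \<Rightarrow> ((real^'n) set \<Rightarrow> real^'n) \<Rightarrow>
     ((real^'n) set \<Rightarrow> real^'n \<Rightarrow> real^'n) \<Rightarrow> nat \<Rightarrow>
     ((real^'n) set \<Rightarrow> real^'n \<Rightarrow> real^'n) \<Rightarrow> ((real^'n) set \<Rightarrow> real^'n \<Rightarrow> real^'n) \<Rightarrow>
     (real^'n) set \<Rightarrow> real^'n \<Rightarrow> real^'n^'n" where
  "dev_eps_w \<Omega> Th nF j k v \<mu> = (THE e. e \<in> Sigma_h Th nF j k \<and> (\<forall>\<tau>\<in>Sigma_h Th nF j k.
     ip \<Omega> Th e \<tau> =
       (\<Sum>T\<in>Th. - l2i (lebesgue_on T) (v T) (mdiv (\<tau> T)) + nn_bdry nF T (\<tau> T) (v T)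
         + (\<Sum>F\<in>facets_of T. l2i (facet_measure (nF F) F)
              (\<mu> F) (\<lambda>x. tproj (nF F) (\<tau> T x *v out_normal T F))))))"

definition solves_H ::
    "(real^'n) set \<Rightarrow> (real^'n) set set \<Rightarrow> ((real^'n) set \<Rightarrow> real^'n) \<Rightarrow>
     ((real^'n) set \<Rightarrow> real^'n \<Rightarrow> real^'n) \<Rightarrow> nat \<Rightarrow> real \<Rightarrow> (real^'n \<Rightarrow> real^'n) \<Rightarrow>
     ((real^'n) set \<Rightarrow> real^'n \<Rightarrow> real^'n) \<Rightarrow> ((real^'n) set \<Rightarrow> real^'n \<Rightarrow> real^'n) \<Rightarrow>
     ((real^'n) set \<Rightarrow> real^'n \<Rightarrow> real) \<Rightarrow> bool" where
  "solves_H \<Omega> Th nF j k \<nu> f u l p \<longleftrightarrow>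
     u \<in> V_h \<Omega> Th k \<and> l \<in> Lambda_ht Th nF k \<and> p \<in> Q_h \<Omega> Th k \<and>
     (\<forall>v\<in>V_h \<Omega> Th k. \<forall>\<mu>\<in>Lambda_ht Th nF k. \<forall>q\<in>Q_h \<Omega> Th k.
        \<nu> * ip \<Omega> Th (dev_eps_w \<Omega> Th nF j k u l) (dev_eps_w \<Omega> Th nF j k v \<mu>)
          + ip \<Omega> Th u v + ip \<Omega> Th (pdiv v) p = l2i (lebesgue_on \<Omega>) f (pw Th v) \<and>
        ip \<Omega> Th (pdiv u) q = 0)"

definition solves_D ::
    "(real^'n) set \<Rightarrow> (real^'n) set set \<Rightarrow> ((real^'n) set \<Rightarrow> real^'n) \<Rightarrow>
     ((real^'n) set \<Rightarrow> real^'n \<Rightarrow> real^'n) \<Rightarrow> nat \<Rightarrow> real \<Rightarrow> (real^'n \<Rightarrow> real^'n) \<Rightarrow>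
     ((real^'n) set \<Rightarrow> real^'n \<Rightarrow> real^'n^'n) \<Rightarrow> ((real^'n) set \<Rightarrow> real^'n \<Rightarrow> real^'n) \<Rightarrow>
     ((real^'n) set \<Rightarrow> real^'n \<Rightarrow> real) \<Rightarrow> bool" where
  "solves_D \<Omega> Th nF j k \<nu> f \<sigma> u p \<longleftrightarrow>
     \<sigma> \<in> Sigma_tn Th nF j k \<and> u \<in> V_h \<Omega> Th k \<and> p \<in> Q_h \<Omega> Th k \<and>
     (\<forall>\<tau>\<in>Sigma_tn Th nF j k. \<forall>q\<in>Q_h \<Omega> Th k. \<forall>v\<in>V_h \<Omega> Th k.
        inverse \<nu> * ip \<Omega> Th \<sigma> \<tau> + b_h \<Omega> Th nF \<tau> q u = 0 \<and>
        b_h \<Omega> Th nF \<sigma> p v - ip \<Omega> Th u v = - l2i (lebesgue_on \<Omega>) f (pw Th v))"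

definition skel_norm ::
    "(real^'n) set set \<Rightarrow> ((real^'n) set \<Rightarrow> real^'n) \<Rightarrow>
     ((real^'n) set \<Rightarrow> real^'n \<Rightarrow> real^'n) \<Rightarrow> real" where
  "skel_norm Th nF \<mu> = sqrt (\<Sum>F\<in>facets Th. l2i (facet_measure (nF F) F) (\<mu> F) (\<mu> F))"

text \<open>Well-posedness in the sense of Hadamard: existence, uniqueness, and continuous dependence on
  \<open>f\<close>.\<close>
definition well_posed_H ::
    "(real^'n) set \<Rightarrow> (real^'n) set set \<Rightarrow> ((real^'n) set \<Rightarrow> real^'n) \<Rightarrow>
     ((real^'n) set \<Rightarrow> real^'n \<Rightarrow> real^'n) \<Rightarrow> nat \<Rightarrow> real \<Rightarrow> bool" where
  "well_posed_H \<Omega> Th nF j k \<nu> \<longleftrightarrow>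
     (\<forall>f\<in>L2 \<Omega>. \<exists>!(u, l, p). solves_H \<Omega> Th nF j k \<nu> f u l p) \<and>
     (\<exists>C. \<forall>f\<in>L2 \<Omega>. \<forall>u l p. solves_H \<Omega> Th nF j k \<nu> f u l p \<longrightarrow>
        l2norm (lebesgue_on \<Omega>) (pw Th u) + skel_norm Th nF l + l2norm (lebesgue_on \<Omega>) (pw Th p)
          \<le> C * l2norm (lebesgue_on \<Omega>) f)"

end

theory Submission
  imports Defs "HOL-Library.Function_Algebras"
begin

text \<open>
  Both methods impose tangential-normal continuity of the stress, (D) in the space and (H) by a
  multiplier. The weak strain of \<open>(u, \<lambda>)\<close> is the Riesz representative, in the broken stress space, of a
  functional that is the sum of a cell form in \<open>u\<close> and a skeleton form in \<open>\<lambda>\<close>. The skeleton form pairs \<open>\<lambda>\<close>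
  with the tangential-normal jumps, and these jumps lie in the facet spaces, so the stresses without jump are
  exactly the common kernel of the skeleton forms (lemma \<open>Sigma_tn_iff\<close>). Therefore the multiplier
  disappears from an equation tested with such stresses, which leads from (H) to (D). Conversely, a
  functional that vanishes on the common kernel of finitely many functionals is a combination of them
  (lemma \<open>functional_in_span\<close>); applied to the residual of the first equation of (D) it produces \<open>\<lambda>\<close>.

  Problem (H) is a system with a symmetric bilinear form on a finite-dimensional space, so existence,
  uniqueness and stability all follow once the form is nondegenerate. Testing a solution of the
  homogeneous problem with itself shows that velocity and strain vanish. For the other two unknowns:

  \<^item> \<open>\<lambda> = 0\<close>, since every element of the facet space of one facet is the tangential-normal trace of a weakly
    symmetric stress in one adjacent cell, with zero trace on the other facets of this cell (lemma
    \<open>trace_onto_Rt\<close>). An explicit lift has the trace, and bubbles without trace can be added to correct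
    its skew part (lemma \<open>weak_symmetry_correction\<close>).

  \<^item> \<open>p = 0\<close>, since no nonzero discrete pressure is orthogonal to all divergences of discrete velocities
    (lemma \<open>pressure_zero\<close>). Velocities that are bubbles along an edge show that \<open>p\<close> is constant on each
    cell, and pairs of lowest-order Raviart-Thomas fields show that neighbouring constants agree. Any two
    cells are linked through facets because the domain is connected and sets of codimension two do not
    disconnect it (lemma \<open>facet_connected\<close>).

  Integration by parts is required only for these two kinds of velocities. Their flows are translations and
  dilations, and it suffices to differentiate an integral along such a flow (lemma \<open>flow_gauss\<close>), so no
  divergence theorem with surface integrals enters. That the fluxes of a Raviart-Thomas pair match is
  seen by mapping one cell affinely to the other (lemma \<open>flux_match\<close>).
\<close>

section \<open>Finite-dimensional linear algebra\<close>

instantiation "fun" :: (type, real_vector) real_vector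
begin
definition "scaleR_fun c f = (\<lambda>x. c *\<^sub>R f x)"
instance
  by standard (simp_all add: scaleR_fun_def fun_eq_iff algebra_simps)
end

lemma scaleR_fun_apply [simp]: "(c *\<^sub>R f) x = c *\<^sub>R f x"
  by (simp add: scaleR_fun_def)

lemma sum_fun_apply: "(\<Sum>i\<in>I. f i) x = (\<Sum>i\<in>I. f i x)"
  by (induction I rule: infinite_finite_induct) auto

text \<open>Integral functionals are linear only where the integrals exist, so linearity is relative to a set.\<close>
definition lin_on :: "'a::real_vector set \<Rightarrow> ('a \<Rightarrow> real) \<Rightarrow> bool" where
  "lin_on W g \<longleftrightarrow> (\<forall>x\<in>W. \<forall>y\<in>W. \<forall>a b. g (a *\<^sub>R x + b *\<^sub>R y) = a * g x + b * g y)"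

lemma lin_onI:
  assumes "\<And>x y a b. x \<in> W \<Longrightarrow> y \<in> W \<Longrightarrow> g (a *\<^sub>R x + b *\<^sub>R y) = a * g x + b * g y"
  shows "lin_on W g"
  using assms by (auto simp: lin_on_def)

lemma lin_onD: "lin_on W g \<Longrightarrow> x \<in> W \<Longrightarrow> y \<in> W \<Longrightarrow> g (a *\<^sub>R x + b *\<^sub>R y) = a * g x + b * g y"
  by (auto simp: lin_on_def)

lemma lin_on_scale: "lin_on W g \<Longrightarrow> x \<in> W \<Longrightarrow> g (a *\<^sub>R x) = a * g x"
  using lin_onD[of W g x x a 0] by simp

lemma lin_on_zero: "lin_on W g \<Longrightarrow> x \<in> W \<Longrightarrow> g 0 = 0"
  using lin_on_scale[of W g x 0] by simp

lemma lin_on_diff: "lin_on W g \<Longrightarrow> x \<in> W \<Longrightarrow> y \<in> W \<Longrightarrow> g (x - y) = g x - g y"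
  using lin_onD[of W g x y 1 "-1"] by simp

lemma lin_on_sum:
  assumes "lin_on W g" "subspace W" "\<And>i. i \<in> I \<Longrightarrow> x i \<in> W"
  shows "g (\<Sum>i\<in>I. c i *\<^sub>R x i) = (\<Sum>i\<in>I. c i * g (x i))"
  using assms(3)
proof (induction I rule: infinite_finite_induct)
  case (insert i I)
  have "(\<Sum>i\<in>I. c i *\<^sub>R x i) \<in> W"
    using assms(2) insert by (auto intro!: subspace_sum subspace_scale)
  then show ?case
    using insert lin_onD[OF assms(1), of "x i" "\<Sum>i\<in>I. c i *\<^sub>R x i" "c i" 1] by auto
qed (use lin_on_zero[OF assms(1)] subspace_0[OF assms(2)] in auto)

lemma lin_on_basis_sum:
  assumes "lin_on W g" "subspace W" "\<And>b. b \<in> B \<Longrightarrow> b \<in> W"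
  shows "g (\<Sum>b\<in>B. c b *\<^sub>R b) = (\<Sum>b\<in>B. c b * g b)"
  by (rule lin_on_sum[OF assms(1,2)]) (rule assms(3))

text \<open>This is the only solvability principle used below: it yields solutions of symmetric systems and the
  Lagrange multiplier of a constrained one. Induction on the set of functionals. If the kernel of the
  others is not contained in the kernel of \<open>f a\<close>, take a vector \<open>v\<close> of the former with \<open>f a v \<noteq> 0\<close>;
  subtracting from \<open>g\<close> the multiple of \<open>f a\<close> that agrees with \<open>g\<close> at \<open>v\<close> leaves a functional to which
  the induction hypothesis applies.\<close>
lemma functional_in_span:
  assumes "finite I" "subspace W" "\<And>i. i \<in> I \<Longrightarrow> lin_on W (f i)" "lin_on W g"
    and "\<And>w. w \<in> W \<Longrightarrow> (\<And>i. i \<in> I \<Longrightarrow> f i w = 0) \<Longrightarrow> g w = 0"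
  shows "\<exists>c. \<forall>w\<in>W. g w = (\<Sum>i\<in>I. c i * f i w)"
  using assms
proof (induction I arbitrary: g rule: finite_induct)
  case empty
  then show ?case by auto
next
  case (insert a I)
  show ?case
  proof (cases "\<exists>v\<in>W. (\<forall>i\<in>I. f i v = 0) \<and> f a v \<noteq> 0")
    case False
    then have g0: "g w = 0" if "w \<in> W" "\<And>i. i \<in> I \<Longrightarrow> f i w = 0" for w
      using insert.prems(4)[OF that(1)] that by blast
    have "\<exists>c. \<forall>w\<in>W. g w = (\<Sum>i\<in>I. c i * f i w)"
      by (rule insert.IH[OF insert.prems(1) insert.prems(2) insert.prems(3) g0]) auto
    then obtain c where c: "\<forall>w\<in>W. g w = (\<Sum>i\<in>I. c i * f i w)" by blast
    have "(\<Sum>i\<in>I. (c(a := 0)) i * f i w) = (\<Sum>i\<in>I. c i * f i w)" for w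
      using insert by (intro sum.cong) auto
    then show ?thesis
      using insert c by (intro exI[of _ "c(a := 0)"]) auto
  next
    case True
    then obtain v where v: "v \<in> W" "\<And>i. i \<in> I \<Longrightarrow> f i v = 0" "f a v \<noteq> 0" by blast
    define h where "h w = g w - (g v / f a v) * f a w" for w
    have lf: "lin_on W (f a)" and lg: "lin_on W g" using insert by auto
    have lh: "lin_on W h"
      by (rule lin_onI) (simp add: h_def lin_onD[OF lf] lin_onD[OF lg] algebra_simps)
    have h0: "h w = 0" if w: "w \<in> W" "\<And>i. i \<in> I \<Longrightarrow> f i w = 0" for w
    proof -
      define u where "u = w + (- (f a w / f a v)) *\<^sub>R v"
      have u: "u \<in> W" unfolding u_def using w v insert.prems(1)
        by (auto intro!: subspace_add subspace_scale subspace_diff)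
      have fu: "f i u = f i w - (f a w / f a v) * f i v" if "i \<in> insert a I" for i
        using lin_onD[OF insert.prems(2)[OF that] w(1) v(1), of 1 "- (f a w / f a v)"] by (simp add: u_def)
      have "g u = 0"
        using u fu w v by (intro insert.prems(4)) auto
      moreover have "g u = g w - (f a w / f a v) * g v"
        using lin_onD[OF lg w(1) v(1), of 1 "- (f a w / f a v)"] by (simp add: u_def)
      ultimately show ?thesis by (simp add: h_def mult.commute)
    qed
    have "\<exists>c. \<forall>w\<in>W. h w = (\<Sum>i\<in>I. c i * f i w)"
      by (rule insert.IH[OF insert.prems(1) insert.prems(2) lh h0]) auto
    then obtain c where c: "\<forall>w\<in>W. h w = (\<Sum>i\<in>I. c i * f i w)" by blast
    have "(\<Sum>i\<in>I. (c(a := g v / f a v)) i * f i w) = (\<Sum>i\<in>I. c i * f i w)" for w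
      using insert by (intro sum.cong) auto
    then show ?thesis
      using insert c by (intro exI[of _ "c(a := g v / f a v)"]) (auto simp: h_def algebra_simps)
  qed
qed

definition fin_dim :: "'a::real_vector set \<Rightarrow> bool" where
  "fin_dim W \<longleftrightarrow> (\<exists>B. finite B \<and> W \<subseteq> span B)"

lemma fin_dim_subset: "fin_dim W \<Longrightarrow> V \<subseteq> W \<Longrightarrow> fin_dim V"
  unfolding fin_dim_def by (meson order_trans)

lemma fin_dim_basis:
  assumes "subspace W" "fin_dim W"
  obtains B where "finite B" "independent B" "W = span B"
proof -
  obtain S where S: "finite S" "W \<subseteq> span S" using assms by (auto simp: fin_dim_def)
  obtain B where B: "B \<subseteq> W" "independent B" "W \<subseteq> span B"
    using maximal_independent_subset by blast
  have "finite B" using independent_span_bound[OF S(1) B(2)] B(1) S(2) by blast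
  moreover have "span B = W"
    using B assms(1) span_minimal by (metis subset_antisym)
  ultimately show ?thesis using that B by auto
qed

lemma span_finite_combination:
  assumes "finite B" "x \<in> span B"
  obtains c where "x = (\<Sum>b\<in>B. c b *\<^sub>R b)"
  using assms by (auto simp: span_finite)

lemma lin_on_zero_span:
  assumes "finite B" "W = span B" "lin_on W g" "\<And>b. b \<in> B \<Longrightarrow> g b = 0" "w \<in> W"
  shows "g w = 0"
proof -
  obtain c where c: "w = (\<Sum>b\<in>B. c b *\<^sub>R b)"
    using assms span_finite_combination by blast
  show ?thesis unfolding c using assms lin_on_basis_sum[OF assms(3), of B c]
    by (auto simp: span_base)
qed

lemma fin_dim_linear_image:
  assumes "linear f" "fin_dim W"
  shows "fin_dim (f ` W)"
proof -
  obtain S where S: "finite S" "W \<subseteq> span S" using assms by (auto simp: fin_dim_def)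
  then have "f ` W \<subseteq> span (f ` S)" using linear_span_image[OF assms(1)] by blast
  then show ?thesis using S by (auto simp: fin_dim_def)
qed

lemma fin_dim_sums:
  assumes "finite I" "\<And>i. i \<in> I \<Longrightarrow> fin_dim (U i)"
    and "\<And>w. w \<in> W \<Longrightarrow> \<exists>u. (\<forall>i\<in>I. u i \<in> U i) \<and> w = (\<Sum>i\<in>I. u i)"
  shows "fin_dim W"
proof -
  have "\<exists>S. \<forall>i\<in>I. finite (S i) \<and> U i \<subseteq> span (S i)"
    using assms(2) unfolding fin_dim_def by metis
  then obtain S where S: "\<And>i. i \<in> I \<Longrightarrow> finite (S i)" "\<And>i. i \<in> I \<Longrightarrow> U i \<subseteq> span (S i)" by blast
  have "W \<subseteq> span (\<Union>i\<in>I. S i)"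
  proof
    fix w assume "w \<in> W"
    then obtain u where u: "\<forall>i\<in>I. u i \<in> U i" "w = (\<Sum>i\<in>I. u i)" using assms(3) by blast
    have "u i \<in> span (\<Union>i\<in>I. S i)" if "i \<in> I" for i
      using u S that span_mono[of "S i" "\<Union>i\<in>I. S i"] by blast
    then show "w \<in> span (\<Union>i\<in>I. S i)" unfolding u by (intro span_sum) auto
  qed
  then show ?thesis using S assms(1) by (auto simp: fin_dim_def intro!: exI[of _ "\<Union>i\<in>I. S i"])
qed

lemma fin_dim_Times:
  assumes "fin_dim U" "fin_dim W"
  shows "fin_dim (U \<times> W)"
proof -
  have lin: "linear (\<lambda>x::'a. (x, 0::'b))" "linear (\<lambda>x::'b. (0::'a, x))"
    by (auto intro!: linearI)
  define V where "V i = (if i then (\<lambda>x::'a. (x, 0::'b)) ` U else (\<lambda>x::'b. (0::'a, x)) ` W)" for i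
  show ?thesis
  proof (rule fin_dim_sums[where I = "{True, False}" and U = V])
    show "fin_dim (V i)" for i
      unfolding V_def using fin_dim_linear_image[OF lin(1) assms(1)] fin_dim_linear_image[OF lin(2) assms(2)] by simp
  next
    fix w assume "w \<in> U \<times> W"
    then show "\<exists>u. (\<forall>i\<in>{True, False}. u i \<in> V i) \<and> w = sum u {True, False}"
      unfolding V_def by (intro exI[of _ "\<lambda>i. if i then (fst w, 0) else (0, snd w)"]) force
  qed auto
qed

definition bilin_on :: "'a::real_vector set \<Rightarrow> ('a \<Rightarrow> 'a \<Rightarrow> real) \<Rightarrow> bool" where
  "bilin_on W A \<longleftrightarrow> (\<forall>x\<in>W. lin_on W (A x) \<and> lin_on W (\<lambda>y. A y x))"

text \<open>If all \<open>A b\<close> with \<open>b\<close> in a basis vanish at \<open>w\<close>, then by symmetry \<open>A w\<close> vanishes, so \<open>w = 0\<close>. Hence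
  every functional is a combination of the \<open>A b\<close>, and no count of dimensions is required.\<close>
lemma symmetric_form_represents:
  assumes W: "subspace W" "fin_dim W" and A: "bilin_on W A"
    and sym: "\<And>x y. x \<in> W \<Longrightarrow> y \<in> W \<Longrightarrow> A x y = A y x"
    and nondeg: "\<And>x. x \<in> W \<Longrightarrow> (\<And>y. y \<in> W \<Longrightarrow> A x y = 0) \<Longrightarrow> x = 0"
    and g: "lin_on W g"
  shows "\<exists>!w. w \<in> W \<and> (\<forall>y\<in>W. A w y = g y)"
proof -
  obtain B where B: "finite B" "independent B" "W = span B" by (rule fin_dim_basis[OF W])
  have l: "lin_on W (A b)" "lin_on W (\<lambda>y. A y b)" if "b \<in> W" for b using A that unfolding bilin_on_def by blast+
  have BW: "b \<in> W" if "b \<in> B" for b unfolding B(3) using that by (rule span_base)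
  have "\<exists>c. \<forall>w\<in>W. g w = (\<Sum>b\<in>B. c b * A b w)"
  proof (rule functional_in_span)
    fix w assume w: "w \<in> W" "\<And>b. b \<in> B \<Longrightarrow> A b w = 0"
    have "A w y = 0" if "y \<in> W" for y
      using lin_on_zero_span[OF B(1,3) l(2)[OF w(1)] w(2) that] sym[OF w(1) that] by simp
    then have "w = 0" using nondeg w by blast
    then show "g w = 0" using lin_on_zero[OF g w(1)] by simp
  qed (use B(1) W(1) g l(1)[OF BW] in simp_all)
  then obtain c where c: "\<forall>w\<in>W. g w = (\<Sum>b\<in>B. c b * A b w)" by blast
  define w where "w = (\<Sum>b\<in>B. c b *\<^sub>R b)"
  have w: "w \<in> W" unfolding w_def by (intro subspace_sum subspace_scale W(1) BW)
  have Aw: "A w y = g y" if "y \<in> W" for y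
    unfolding w_def using lin_on_basis_sum[OF l(2)[OF that] W(1) BW, where c = c] c that by simp
  show ?thesis
  proof (rule ex1I[of _ w])
    show "w \<in> W \<and> (\<forall>y\<in>W. A w y = g y)" using w Aw by simp
    fix v assume v: "v \<in> W \<and> (\<forall>y\<in>W. A v y = g y)"
    have "A (v - w) y = 0" if y: "y \<in> W" for y
    proof -
      have "A v y = g y" using v y by blast
      then show ?thesis using lin_on_diff[OF l(2)[OF y] _ w, of v] v Aw[OF y] by simp
    qed
    then have "v - w = 0" using v by (intro nondeg subspace_diff[OF W(1) _ w]) auto
    then show "v = w" by simp
  qed
qed

text \<open>Each coordinate of the solution \<open>w\<close> is a linear functional, hence a value \<open>A v w\<close> with fixed \<open>v\<close>, which
  the bound on \<open>A w\<close> controls. The quantity \<open>q w w\<close> is quadratic in the coordinates.\<close>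
lemma symmetric_form_stability:
  assumes W: "subspace W" "fin_dim W" and A: "bilin_on W A"
    and sym: "\<And>x y. x \<in> W \<Longrightarrow> y \<in> W \<Longrightarrow> A x y = A y x"
    and nondeg: "\<And>x. x \<in> W \<Longrightarrow> (\<And>y. y \<in> W \<Longrightarrow> A x y = 0) \<Longrightarrow> x = 0"
    and q: "bilin_on W q"
    and N: "\<And>y. y \<in> W \<Longrightarrow> 0 \<le> N y"
  shows "\<exists>C\<ge>0. \<forall>w\<in>W. \<forall>t\<ge>0. (\<forall>y\<in>W. \<bar>A w y\<bar> \<le> t * N y) \<longrightarrow> q w w \<le> C * t\<^sup>2"
proof -
  obtain B where B: "finite B" "independent B" "W = span B" by (rule fin_dim_basis[OF W])
  have l: "lin_on W (A b)" "lin_on W (\<lambda>y. A y b)" if "b \<in> W" for b using A that unfolding bilin_on_def by blast+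
  have lq: "lin_on W (q b)" "lin_on W (\<lambda>y. q y b)" if "b \<in> W" for b using q that unfolding bilin_on_def by blast+
  have BW: "b \<in> W" if "b \<in> B" for b unfolding B(3) using that by (rule span_base)
  have "\<exists>g. linear g \<and> (\<forall>x\<in>B. g x = (if x = b then 1 else (0::real)))" for b
    by (rule linear_independent_extend[OF B(2)])
  then obtain g where g: "\<And>b. linear (g b)" "\<And>b x. x \<in> B \<Longrightarrow> g b x = (if x = b then 1 else (0::real))"
    by metis
  have lg: "lin_on W (g b)" for b
    by (rule lin_onI) (simp add: linear_add[OF g(1)] linear_scale[OF g(1)])
  have rep: "w = (\<Sum>b\<in>B. g b w *\<^sub>R b)" if "w \<in> W" for w
  proof -
    have "w \<in> span B" using that B(3) by simp
    then obtain c where c: "w = (\<Sum>b\<in>B. c b *\<^sub>R b)" by (rule span_finite_combination[OF B(1)])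
    have "g b w = c b" if "b \<in> B" for b
    proof -
      have "g b w = (\<Sum>x\<in>B. c x * g b x)"
        unfolding c by (rule lin_on_basis_sum[OF lg W(1) BW])
      also have "\<dots> = (\<Sum>x\<in>B. if x = b then c x else 0)" by (intro sum.cong) (auto simp: g)
      finally show ?thesis using that B(1) by simp
    qed
    then show ?thesis using c by (metis (no_types, lifting) sum.cong)
  qed
  have ex: "\<exists>x. \<forall>w\<in>W. g b w = (\<Sum>s\<in>B. x s * A w s)" for b
  proof -
    obtain v where v: "v \<in> W" "\<forall>y\<in>W. A v y = g b y"
      using symmetric_form_represents[OF W A sym nondeg lg[of b]] by blast
    have "g b w = (\<Sum>s\<in>B. g s v * A w s)" if w: "w \<in> W" for w
    proof -
      have "g b w = A v w" using v(2) w by simp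
      also have "\<dots> = A w v" by (rule sym[OF v(1) w])
      also have "\<dots> = A w (\<Sum>s\<in>B. g s v *\<^sub>R s)" using rep[OF v(1)] by simp
      also have "\<dots> = (\<Sum>s\<in>B. g s v * A w s)" by (rule lin_on_basis_sum[OF l(1)[OF w] W(1) BW])
      finally show ?thesis .
    qed
    then show ?thesis by (intro exI[of _ "\<lambda>s. g s v"]) blast
  qed
  have "\<exists>x. \<forall>b. \<forall>w\<in>W. g b w = (\<Sum>s\<in>B. x b s * A w s)" by (rule choice) (use ex in blast)
  then obtain x where x: "\<And>b w. w \<in> W \<Longrightarrow> g b w = (\<Sum>s\<in>B. x b s * A w s)" by blast
  define K where "K b = (\<Sum>s\<in>B. \<bar>x b s\<bar> * N s)" for b
  have K: "\<bar>g b w\<bar> \<le> K b * t" if w: "w \<in> W" and t: "\<forall>y\<in>W. \<bar>A w y\<bar> \<le> t * N y" for b w t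
  proof -
    have "\<bar>g b w\<bar> \<le> (\<Sum>s\<in>B. \<bar>x b s * A w s\<bar>)" using x[OF w] by auto
    also have "\<dots> \<le> (\<Sum>s\<in>B. \<bar>x b s\<bar> * (t * N s))"
      using t BW by (intro sum_mono) (auto simp: abs_mult intro!: mult_left_mono)
    also have "\<dots> = K b * t" by (simp add: K_def sum_distrib_left sum_distrib_right algebra_simps)
    finally show ?thesis .
  qed
  have K0: "K b \<ge> 0" for b unfolding K_def using N BW by (auto intro!: sum_nonneg)
  define C where "C = (\<Sum>b\<in>B. \<Sum>c\<in>B. K b * K c * \<bar>q b c\<bar>)"
  have "q w w \<le> C * t\<^sup>2" if w: "w \<in> W" and t: "t \<ge> 0" "\<forall>y\<in>W. \<bar>A w y\<bar> \<le> t * N y" for w t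
  proof -
    have "q w w = q (\<Sum>b\<in>B. g b w *\<^sub>R b) w" using rep[OF w] by simp
    also have "\<dots> = (\<Sum>b\<in>B. g b w * q b w)" by (rule lin_on_basis_sum[OF lq(2)[OF w] W(1) BW])
    also have "\<dots> = (\<Sum>b\<in>B. g b w * q b (\<Sum>c\<in>B. g c w *\<^sub>R c))" using rep[OF w] by simp
    also have "\<dots> = (\<Sum>b\<in>B. g b w * (\<Sum>c\<in>B. g c w * q b c))"
      using lin_on_basis_sum[OF lq(1)[OF BW] W(1) BW] by (intro sum.cong refl) simp
    also have "\<dots> = (\<Sum>b\<in>B. \<Sum>c\<in>B. g b w * g c w * q b c)" by (simp add: sum_distrib_left mult.assoc)
    also have "\<dots> \<le> (\<Sum>b\<in>B. \<Sum>c\<in>B. (K b * t) * (K c * t) * \<bar>q b c\<bar>)"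
    proof (intro sum_mono)
      fix b c
      have "g b w * g c w * q b c \<le> \<bar>g b w\<bar> * \<bar>g c w\<bar> * \<bar>q b c\<bar>" by (metis abs_ge_self abs_mult)
      also have "\<dots> \<le> (K b * t) * (K c * t) * \<bar>q b c\<bar>"
        using K[OF w t(2)] K0 t(1) by (intro mult_mono) auto
      finally show "g b w * g c w * q b c \<le> (K b * t) * (K c * t) * \<bar>q b c\<bar>" .
    qed
    also have "\<dots> = C * t\<^sup>2"
      by (simp add: C_def sum_distrib_right sum_distrib_left power2_eq_square algebra_simps)
    finally show ?thesis .
  qed
  moreover have "C \<ge> 0" unfolding C_def using K0 by (auto intro!: sum_nonneg)
  ultimately show ?thesis by blast
qed

section \<open>Polynomials with vector values\<close>

lemma finite_multiindices: "finite {\<alpha> :: 'n::finite \<Rightarrow> nat. (\<Sum>i\<in>UNIV. \<alpha> i) \<le> m}"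
proof (rule finite_subset)
  show "{\<alpha> :: 'n \<Rightarrow> nat. (\<Sum>i\<in>UNIV. \<alpha> i) \<le> m} \<subseteq> {\<alpha>. \<forall>i. (i \<in> UNIV \<longrightarrow> \<alpha> i \<in> {..m}) \<and> (i \<notin> UNIV \<longrightarrow> \<alpha> i = 0)}"
  proof
    fix \<alpha> :: "'n \<Rightarrow> nat" assume \<alpha>: "\<alpha> \<in> {\<alpha>. (\<Sum>i\<in>UNIV. \<alpha> i) \<le> m}"
    have "\<alpha> i \<le> m" for i using \<alpha> member_le_sum[of i UNIV \<alpha>] by auto
    then show "\<alpha> \<in> {\<alpha>. \<forall>i. (i \<in> UNIV \<longrightarrow> \<alpha> i \<in> {..m}) \<and> (i \<notin> UNIV \<longrightarrow> \<alpha> i = 0)}" by simp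
  qed
  show "finite {\<alpha> :: 'n \<Rightarrow> nat. \<forall>i. (i \<in> UNIV \<longrightarrow> \<alpha> i \<in> {..m}) \<and> (i \<notin> UNIV \<longrightarrow> \<alpha> i = 0)}"
    by (rule finite_set_of_finite_funs) auto
qed

abbreviation (input) multi_indices :: "nat \<Rightarrow> ('n::finite \<Rightarrow> nat) set" where
  "multi_indices m \<equiv> {\<alpha>. (\<Sum>i\<in>UNIV. \<alpha> i) \<le> m}"

abbreviation (input) monomial :: "real^'n \<Rightarrow> ('n \<Rightarrow> nat) \<Rightarrow> real" where
  "monomial x \<alpha> \<equiv> \<Prod>i\<in>UNIV. x $ i ^ \<alpha> i"

lemma PolyE:
  assumes "p \<in> Poly m X"
  obtains c where "\<And>\<alpha>. c \<alpha> \<in> X" "p = (\<lambda>x. \<Sum>\<alpha>\<in>multi_indices m. monomial x \<alpha> *\<^sub>R c \<alpha>)"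
  using assms by (auto simp: Poly_def)

lemma subspace_Poly: "subspace X \<Longrightarrow> subspace (Poly m X)"
proof (rule subspaceI)
  assume X: "subspace X"
  show "0 \<in> Poly m X" unfolding Poly_def using subspace_0[OF X] by (auto intro!: exI[of _ "\<lambda>_. 0"])
  show "p + q \<in> Poly m X" if pq: "p \<in> Poly m X" "q \<in> Poly m X" for p q :: "real^'n \<Rightarrow> 'a"
  proof -
    obtain c where "\<And>\<alpha>. c \<alpha> \<in> X" "p = (\<lambda>x. \<Sum>\<alpha>\<in>multi_indices m. monomial x \<alpha> *\<^sub>R c \<alpha>)"
      using PolyE[OF pq(1)] by blast
    moreover obtain d where "\<And>\<alpha>. d \<alpha> \<in> X" "q = (\<lambda>x. \<Sum>\<alpha>\<in>multi_indices m. monomial x \<alpha> *\<^sub>R d \<alpha>)"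
      using PolyE[OF pq(2)] by blast
    ultimately show ?thesis using X unfolding Poly_def
      by (auto intro!: exI[of _ "\<lambda>\<alpha>. c \<alpha> + d \<alpha>"] simp: subspace_add scaleR_add_right sum.distrib)
  qed
  show "r *\<^sub>R p \<in> Poly m X" if pp: "p \<in> Poly m X" for r and p :: "real^'n \<Rightarrow> 'a"
  proof -
    obtain c where "\<And>\<alpha>. c \<alpha> \<in> X" "p = (\<lambda>x. \<Sum>\<alpha>\<in>multi_indices m. monomial x \<alpha> *\<^sub>R c \<alpha>)"
      using PolyE[OF pp] by blast
    then show ?thesis using X unfolding Poly_def
      by (auto intro!: exI[of _ "\<lambda>\<alpha>. r *\<^sub>R c \<alpha>"] simp: subspace_scale scaleR_sum_right mult.commute)
  qed
qed

lemma Poly_add: "subspace X \<Longrightarrow> p \<in> Poly m X \<Longrightarrow> q \<in> Poly m X \<Longrightarrow> (\<lambda>x. p x + q x) \<in> Poly m X"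
  using subspace_add[OF subspace_Poly, of X p m q] by (simp add: plus_fun_def)

lemma Poly_scale: "subspace X \<Longrightarrow> p \<in> Poly m X \<Longrightarrow> (\<lambda>x. c *\<^sub>R p x) \<in> Poly m X"
  using subspace_scale[OF subspace_Poly, of X p m c] by (simp add: scaleR_fun_def)

lemma Poly_sum:
  assumes "subspace X" "\<And>i. i \<in> I \<Longrightarrow> f i \<in> Poly m X"
  shows "(\<lambda>x. \<Sum>i\<in>I. f i x) \<in> Poly m X"
proof -
  have "(\<lambda>x. \<Sum>i\<in>I. f i x) = (\<Sum>i\<in>I. f i)" by (simp add: fun_eq_iff sum_fun_apply)
  then show ?thesis using subspace_sum[OF subspace_Poly, of X I f m] assms by simp
qed

lemma Poly_monomial:
  assumes "subspace X" "(\<Sum>i\<in>UNIV. \<alpha> i) \<le> m" "v \<in> X"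
  shows "(\<lambda>x::real^'n. monomial x \<alpha> *\<^sub>R v) \<in> Poly m X"
proof -
  have "(\<lambda>x::real^'n. monomial x \<alpha> *\<^sub>R v) =
    (\<lambda>x. \<Sum>\<beta>\<in>multi_indices m. monomial x \<beta> *\<^sub>R (if \<beta> = \<alpha> then v else 0))"
    using assms(2) finite_multiindices[of m, where 'n = 'n] by (intro ext) (simp add: if_distrib[of "\<lambda>v. _ *\<^sub>R v"] sum.delta' cong: if_cong)
  then show ?thesis unfolding Poly_def
    using assms(3) subspace_0[OF assms(1)] by (auto intro!: exI[of _ "\<lambda>\<beta>. if \<beta> = \<alpha> then v else 0"])
qed

lemma Poly_const: "subspace X \<Longrightarrow> v \<in> X \<Longrightarrow> (\<lambda>x::real^'n. v) \<in> Poly m X"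
  using Poly_monomial[of X "\<lambda>_. 0" m v] by simp

lemma Poly_mono:
  assumes "subspace Y" "m \<le> k" "X \<subseteq> Y" "p \<in> Poly m X"
  shows "p \<in> Poly k Y"
proof -
  obtain c where c: "\<And>\<alpha>. c \<alpha> \<in> X" "p = (\<lambda>x. \<Sum>\<alpha>\<in>multi_indices m. monomial x \<alpha> *\<^sub>R c \<alpha>)"
    using PolyE[OF assms(4)] by blast
  show ?thesis unfolding c(2) using assms c(1) by (intro Poly_sum Poly_monomial) auto
qed

lemma Poly_map:
  assumes "linear L" "\<And>v. v \<in> X \<Longrightarrow> L v \<in> Y" "p \<in> Poly m X"
  shows "(\<lambda>x. L (p x)) \<in> Poly m Y"
proof -
  obtain c where c: "\<And>\<alpha>. c \<alpha> \<in> X" "p = (\<lambda>x. \<Sum>\<alpha>\<in>multi_indices m. monomial x \<alpha> *\<^sub>R c \<alpha>)"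
    using PolyE[OF assms(3)] by blast
  show ?thesis unfolding c(2) Poly_def
    using assms c(1) by (auto intro!: exI[of _ "\<lambda>\<alpha>. L (c \<alpha>)"] simp: linear_sum linear_scale)
qed

lemma Poly_0_iff: "p \<in> Poly 0 X \<longleftrightarrow> (\<exists>v\<in>X. p = (\<lambda>x::real^'n. v))"
proof
  have *: "{\<alpha> :: 'n \<Rightarrow> nat. (\<Sum>i\<in>UNIV. \<alpha> i) \<le> 0} = {\<lambda>_. 0}" by (auto simp: fun_eq_iff)
  show "p \<in> Poly 0 X \<Longrightarrow> \<exists>v\<in>X. p = (\<lambda>x. v)"
    by (erule PolyE) (simp only: *, auto)
  assume "\<exists>v\<in>X. p = (\<lambda>x. v)"
  then obtain v where "v \<in> X" "p = (\<lambda>x. v)" by blast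
  then show "p \<in> Poly 0 X" unfolding Poly_def * by (auto intro!: exI[of _ "\<lambda>_. v"])
qed

lemma Poly_coord:
  assumes X: "subspace X" and p: "p \<in> Poly m X"
  shows "(\<lambda>x::real^'n. x $ i *\<^sub>R p x) \<in> Poly (Suc m) X"
proof -
  obtain c where c: "\<And>\<alpha>. c \<alpha> \<in> X" "p = (\<lambda>x. \<Sum>\<alpha>\<in>multi_indices m. monomial x \<alpha> *\<^sub>R c \<alpha>)"
    using PolyE[OF p] by blast
  have "(\<lambda>x. x $ i *\<^sub>R p x) = (\<lambda>x. \<Sum>\<alpha>\<in>multi_indices m. x $ i *\<^sub>R monomial x \<alpha> *\<^sub>R c \<alpha>)"
    unfolding c(2) by (simp add: scaleR_sum_right)
  also have "\<dots> \<in> Poly (Suc m) X"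
  proof (rule Poly_sum[OF X])
    fix \<alpha> :: "'n \<Rightarrow> nat" assume "\<alpha> \<in> {\<alpha>. (\<Sum>i\<in>UNIV. \<alpha> i) \<le> m}"
    define \<beta> where "\<beta> = \<alpha>(i := Suc (\<alpha> i))"
    have "(\<Sum>i\<in>UNIV. \<beta> i) = Suc (\<Sum>i\<in>UNIV. \<alpha> i)"
      by (simp add: \<beta>_def sum.remove[of UNIV i])
    moreover have "x $ i * monomial x \<alpha> = monomial x \<beta>" for x :: "real^'n"
      by (simp add: \<beta>_def prod.remove[of UNIV i])
    ultimately show "(\<lambda>x::real^'n. x $ i *\<^sub>R monomial x \<alpha> *\<^sub>R c \<alpha>) \<in> Poly (Suc m) X"
      using Poly_monomial[OF X, of \<beta> "Suc m" "c \<alpha>"] c(1) \<open>\<alpha> \<in> _\<close> by simp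
  qed
  finally show ?thesis .
qed

lemma Poly_affine_mult:
  assumes X: "subspace X" and p: "p \<in> Poly m X"
  shows "(\<lambda>x::real^'n. (a \<bullet> x + b) *\<^sub>R p x) \<in> Poly (Suc m) X"
proof -
  have "(\<lambda>x::real^'n. (a \<bullet> x + b) *\<^sub>R p x) = (\<lambda>x. (\<Sum>i\<in>UNIV. a $ i *\<^sub>R (x $ i *\<^sub>R p x)) + b *\<^sub>R p x)"
    by (simp add: inner_vec_def scaleR_add_left scaleR_sum_left)
  also have "\<dots> \<in> Poly (Suc m) X"
    by (intro Poly_add Poly_sum Poly_scale Poly_coord X p Poly_mono[OF X _ _ p]) auto
  finally show ?thesis .
qed

text \<open>Splitting off one coordinate from every nonconstant monomial; this is what inductions on the degree
  run on.\<close>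
lemma Poly_decompose:
  assumes X: "subspace X" and p: "p \<in> Poly (Suc m) X"
  shows "\<exists>c q. c \<in> X \<and> (\<forall>i. q i \<in> Poly m X) \<and> p = (\<lambda>x::real^'n. c + (\<Sum>i\<in>UNIV. x $ i *\<^sub>R q i x))"
proof -
  define D where "D = {p. \<exists>c q. c \<in> X \<and> (\<forall>i. q i \<in> Poly m X) \<and> p = (\<lambda>x::real^'n. c + (\<Sum>i\<in>UNIV. x $ i *\<^sub>R q i x))}"
  have Z: "(\<lambda>x::real^'n. 0) \<in> Poly m X" using Poly_const[OF X subspace_0[OF X]] .
  have D0: "(\<lambda>x. 0) \<in> D" unfolding D_def mem_Collect_eq using subspace_0[OF X] Z
    by (intro exI[of _ 0] exI[of _ "\<lambda>_ _. 0"] conjI) simp_all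
  have Dadd: "(\<lambda>x. f x + g x) \<in> D" if fg: "f \<in> D" "g \<in> D" for f g
  proof -
    obtain c q where "c \<in> X" "\<forall>i. q i \<in> Poly m X" "f = (\<lambda>x. c + (\<Sum>i\<in>UNIV. x $ i *\<^sub>R q i x))"
      using fg(1) by (auto simp: D_def)
    moreover obtain d r where "d \<in> X" "\<forall>i. r i \<in> Poly m X" "g = (\<lambda>x. d + (\<Sum>i\<in>UNIV. x $ i *\<^sub>R r i x))"
      using fg(2) by (auto simp: D_def)
    ultimately show ?thesis unfolding D_def mem_Collect_eq using X
      by (intro exI[of _ "c + d"] exI[of _ "\<lambda>i x. q i x + r i x"] conjI allI)
        (simp_all add: subspace_add Poly_add scaleR_add_right sum.distrib algebra_simps)
  qed
  have Dsum: "(\<lambda>x. \<Sum>j\<in>J. f j x) \<in> D" if "finite J" "\<And>j. j \<in> J \<Longrightarrow> f j \<in> D" for J and f :: "('n \<Rightarrow> nat) \<Rightarrow> _"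
    using that by (induction J rule: finite_induct) (auto intro!: D0 Dadd)
  obtain c where c: "\<And>\<alpha>. c \<alpha> \<in> X" "p = (\<lambda>x. \<Sum>\<alpha>\<in>multi_indices (Suc m). monomial x \<alpha> *\<^sub>R c \<alpha>)"
    using PolyE[OF p] by blast
  have "p \<in> D" unfolding c(2)
  proof (rule Dsum[OF finite_multiindices])
    fix \<alpha> :: "'n \<Rightarrow> nat" assume \<alpha>: "\<alpha> \<in> {\<alpha>. (\<Sum>i\<in>UNIV. \<alpha> i) \<le> Suc m}"
    show "(\<lambda>x::real^'n. monomial x \<alpha> *\<^sub>R c \<alpha>) \<in> D"
    proof (cases "\<forall>i. \<alpha> i = 0")
      case True
      then show ?thesis unfolding D_def mem_Collect_eq using c(1) Z
        by (intro exI[of _ "c \<alpha>"] exI[of _ "\<lambda>_ _. 0"] conjI) simp_all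
    next
      case False
      then obtain j where j: "\<alpha> j \<noteq> 0" by blast
      define \<beta> where "\<beta> = \<alpha>(j := \<alpha> j - 1)"
      have s: "Suc (\<Sum>i\<in>UNIV. \<beta> i) = (\<Sum>i\<in>UNIV. \<alpha> i)"
        using j by (simp add: \<beta>_def sum.remove[of UNIV j])
      have e: "monomial x \<alpha> = x $ j * monomial x \<beta>" for x :: "real^'n"
        using j by (cases "\<alpha> j") (simp_all add: \<beta>_def prod.remove[of UNIV j])
      define q where "q i = (\<lambda>x::real^'n. if i = j then monomial x \<beta> *\<^sub>R c \<alpha> else 0)" for i
      have "q i \<in> Poly m X" for i
        unfolding q_def using s \<alpha> Z Poly_monomial[OF X _ c(1), of \<beta> m] by (cases "i = j") auto
      moreover have "(\<lambda>x::real^'n. monomial x \<alpha> *\<^sub>R c \<alpha>) = (\<lambda>x. 0 + (\<Sum>i\<in>UNIV. x $ i *\<^sub>R q i x))"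
        by (simp add: q_def e if_distrib[of "\<lambda>v. _ *\<^sub>R v"] sum.delta' cong: if_cong)
      ultimately show ?thesis unfolding D_def mem_Collect_eq using subspace_0[OF X]
        by (intro exI[of _ 0] exI[of _ q] conjI) simp_all
    qed
  qed
  then show ?thesis by (auto simp: D_def)
qed

text \<open>The case of degree zero is separate because the degree of the derivative is a truncated difference.\<close>
lemma Poly_derivative:
  fixes X :: "'b::real_normed_vector set"
  assumes X: "subspace X" and p: "p \<in> Poly m X"
  shows "\<exists>D. (\<forall>x::real^'n. (p has_derivative (\<lambda>h. D h x)) (at x)) \<and> (\<forall>h. D h \<in> Poly (m - 1) X)"
  using p
proof (induction m arbitrary: p)
  case 0
  then obtain v where "p = (\<lambda>x. v)" by (auto simp: Poly_0_iff)
  then show ?case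
    using Poly_const[OF X subspace_0[OF X]] by (intro exI[of _ "\<lambda>_ _. 0"]) auto
next
  case (Suc m)
  obtain c q where q: "\<And>i. q i \<in> Poly m X" "p = (\<lambda>x. c + (\<Sum>i\<in>UNIV. x $ i *\<^sub>R q i x))"
    using Poly_decompose[OF X Suc.prems] by blast
  obtain D where D: "\<And>i x. (q i has_derivative (\<lambda>h. D i h x)) (at x)" "\<And>i h. D i h \<in> Poly (m - 1) X"
    using Suc.IH[OF q(1)] by metis
  have D': "(\<lambda>x. x $ i *\<^sub>R D i h x) \<in> Poly m X" for i h
  proof (cases m)
    case 0
    then obtain v where v: "q i = (\<lambda>x. v)" using q(1)[of i] by (auto simp: Poly_0_iff)
    have "D i h x = 0" for x
      using D(1)[of i x] has_derivative_unique[of "q i" _ x "\<lambda>_. 0"] unfolding v by (metis has_derivative_const)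
    then show ?thesis using Poly_const[OF X subspace_0[OF X]] by simp
  next
    case (Suc l)
    then show ?thesis using Poly_coord[OF X D(2)[of i h], of i] by simp
  qed
  show ?case
  proof (intro exI conjI allI)
    fix x :: "real^'n"
    show "(p has_derivative (\<lambda>h. \<Sum>i\<in>UNIV. x $ i *\<^sub>R D i h x + h $ i *\<^sub>R q i x)) (at x)"
      unfolding q(2)
      by (auto intro!: derivative_eq_intros D(1) bounded_linear_imp_has_derivative bounded_linear_vec_nth)
  next
    fix h :: "real^'n"
    show "(\<lambda>x. \<Sum>i\<in>UNIV. x $ i *\<^sub>R D i h x + h $ i *\<^sub>R q i x) \<in> Poly (Suc m - 1) X"
      using D' q(1) by (auto intro!: Poly_sum Poly_add Poly_scale X)
  qed
qed

lemma Poly_has_derivative: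
  fixes X :: "'b::real_normed_vector set"
  assumes X: "subspace X" and p: "p \<in> Poly m X"
  shows "(p has_derivative frechet_derivative p (at x)) (at x)"
proof -
  obtain D where D: "\<And>x. (p has_derivative (\<lambda>h. D h x)) (at x)"
    using Poly_derivative[OF assms] by blast
  show ?thesis using D[of x] frechet_derivative_at[OF D[of x]] by simp
qed

lemma Poly_frechet_derivative:
  fixes X :: "'b::real_normed_vector set"
  assumes X: "subspace X" and p: "p \<in> Poly m X"
  shows "(\<lambda>x. frechet_derivative p (at x) h) \<in> Poly (m - 1) X"
proof -
  obtain D where D: "\<And>x. (p has_derivative (\<lambda>h. D h x)) (at x)" "\<And>h. D h \<in> Poly (m - 1) X"
    using Poly_derivative[OF assms] by blast
  have "(\<lambda>x. frechet_derivative p (at x) h) = D h"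
    by (simp add: frechet_derivative_at[OF D(1), symmetric])
  then show ?thesis using D(2) by simp
qed

lemma Poly_continuous:
  fixes X :: "'b::real_normed_vector set"
  assumes "subspace X" "p \<in> Poly m X"
  shows "continuous_on S p"
  using Poly_has_derivative[OF assms] by (auto intro!: continuous_at_imp_continuous_on has_derivative_continuous)

text \<open>The partial derivatives vanish on the same open set and have smaller degree. By induction they
  vanish everywhere, so the polynomial is constant.\<close>
lemma Poly_zero_on_open:
  fixes X :: "'b::real_normed_vector set"
  assumes X: "subspace X" and p: "p \<in> Poly m X" and U: "open U" "U \<noteq> {}" "\<And>x. x \<in> U \<Longrightarrow> p x = 0"
  shows "p = (\<lambda>x. 0)"
  using p U(3)
proof (induction m arbitrary: p)
  case 0
  then show ?case using U(2) by (auto simp: Poly_0_iff)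
next
  case (Suc m)
  have "frechet_derivative p (at x) h = 0" for x h
  proof -
    have "(\<lambda>x. frechet_derivative p (at x) h) = (\<lambda>x. 0)"
    proof (rule Suc.IH)
      show "(\<lambda>x. frechet_derivative p (at x) h) \<in> Poly m X"
        using Poly_frechet_derivative[OF X Suc.prems(1), of h] by simp
      show "frechet_derivative p (at x) h = 0" if x: "x \<in> U" for x
      proof -
        have "((\<lambda>x. 0) has_derivative frechet_derivative p (at x)) (at x)"
          by (rule has_derivative_transform_within_open[OF Poly_has_derivative[OF X Suc.prems(1)] U(1) x])
            (use Suc.prems in auto)
        then show ?thesis using has_derivative_unique[OF _ has_derivative_const] by metis
      qed
    qed
    then show ?thesis by metis
  qed
  then have "frechet_derivative p (at x) = (\<lambda>h. 0)" for x by (simp add: fun_eq_iff)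
  then have "(p has_derivative (\<lambda>h. 0)) (at x within UNIV)" for x
    using Poly_has_derivative[OF X Suc.prems(1), of x] by simp
  then obtain c where "\<And>x. x \<in> UNIV \<Longrightarrow> p x = c"
    using has_derivative_zero_constant[of UNIV p] by auto
  then show ?case using Suc.prems U(2) by fastforce
qed

lemma fin_dim_Poly: "fin_dim (Poly m (X :: 'b::euclidean_space set) :: (real^'n \<Rightarrow> 'b) set)"
proof -
  define S where "S = (\<lambda>(\<alpha>, b). \<lambda>x::real^'n. monomial x \<alpha> *\<^sub>R (b :: 'b)) ` ({\<alpha>. (\<Sum>i\<in>UNIV. \<alpha> i) \<le> m} \<times> Basis)"
  have "Poly m X \<subseteq> span S"
  proof
    fix p :: "real^'n \<Rightarrow> 'b" assume "p \<in> Poly m X"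
    then obtain c where c: "p = (\<lambda>x. \<Sum>\<alpha>\<in>multi_indices m. monomial x \<alpha> *\<^sub>R c \<alpha>)"
      by (rule PolyE)
    have "p = (\<Sum>\<alpha>\<in>multi_indices m. \<Sum>b\<in>Basis. (c \<alpha> \<bullet> b) *\<^sub>R (\<lambda>x. monomial x \<alpha> *\<^sub>R b))"
    proof
      fix x
      have "monomial x \<alpha> *\<^sub>R c \<alpha> = (\<Sum>b\<in>Basis. (c \<alpha> \<bullet> b) *\<^sub>R monomial x \<alpha> *\<^sub>R b)" for \<alpha>
        by (subst (1) euclidean_representation[of "c \<alpha>", symmetric]) (simp add: scaleR_sum_right mult.commute)
      then show "p x = (\<Sum>\<alpha>\<in>multi_indices m. \<Sum>b\<in>Basis. (c \<alpha> \<bullet> b) *\<^sub>R (\<lambda>x. monomial x \<alpha> *\<^sub>R b)) x"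
        by (simp add: c sum_fun_apply)
    qed
    also have "\<dots> \<in> span S"
      by (intro span_sum span_scale span_base) (auto simp: S_def)
    finally show "p \<in> span S" .
  qed
  moreover have "finite S" unfolding S_def using finite_multiindices[of m, where 'n = 'n] by auto
  ultimately show ?thesis by (auto simp: fin_dim_def)
qed

lemma frechet_derivative_lincomb:
  assumes "p \<in> Poly m UNIV" "q \<in> Poly l UNIV"
  shows "frechet_derivative (\<lambda>x. a *\<^sub>R p x + b *\<^sub>R q x) (at x) =
     (\<lambda>h. a *\<^sub>R frechet_derivative p (at x) h + b *\<^sub>R frechet_derivative (q :: real^'n \<Rightarrow> 'b::real_normed_vector) (at x) h)"
  by (rule frechet_derivative_at[symmetric])
    (intro derivative_intros Poly_has_derivative[OF subspace_UNIV assms(1)] Poly_has_derivative[OF subspace_UNIV assms(2)])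

lemma vdiv_lincomb:
  assumes "v \<in> Poly m UNIV" "w \<in> Poly l UNIV"
  shows "vdiv (\<lambda>x. a *\<^sub>R v x + b *\<^sub>R w x) x = a * vdiv v x + b * vdiv w x"
  unfolding vdiv_def frechet_derivative_lincomb[OF assms] by (simp add: sum.distrib sum_distrib_left)

lemma Poly_vec_nth: "p \<in> Poly m UNIV \<Longrightarrow> (\<lambda>x. p x $ i) \<in> Poly m UNIV"
  by (rule Poly_map[of "\<lambda>y. y $ i" UNIV]) (auto intro: linearI)

lemma mdiv_lincomb:
  assumes "\<sigma> \<in> Poly m UNIV" "\<tau> \<in> Poly l UNIV"
  shows "mdiv (\<lambda>x. a *\<^sub>R \<sigma> x + b *\<^sub>R \<tau> x) x = a *\<^sub>R mdiv \<sigma> x + b *\<^sub>R mdiv \<tau> x"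
  using vdiv_lincomb[OF Poly_vec_nth[OF assms(1)] Poly_vec_nth[OF assms(2)], of a _ b]
  by (simp add: mdiv_def vec_eq_iff)

lemma Poly_vdiv: 
  assumes "v \<in> Poly m UNIV" shows "vdiv v \<in> Poly (m - 1) UNIV"
proof -
  have "(\<lambda>x. \<Sum>i\<in>UNIV. frechet_derivative v (at x) (axis i 1) $ i) \<in> Poly (m - 1) UNIV"
    by (intro Poly_sum Poly_vec_nth Poly_frechet_derivative subspace_UNIV assms)
  then show ?thesis by (simp add: vdiv_def[abs_def])
qed

lemma Poly_vec_lambda:
  assumes "\<And>i. (\<lambda>x. f x i) \<in> Poly m UNIV"
  shows "(\<lambda>x. (\<chi> i. (f x i :: real)) :: real^'m) \<in> Poly m UNIV"
proof -
  have "(\<lambda>x. (\<chi> i. f x i) :: real^'m) = (\<lambda>x. \<Sum>i\<in>UNIV. f x i *\<^sub>R axis i 1)"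
    by (simp add: fun_eq_iff vec_eq_iff axis_def if_distrib[of "\<lambda>v. _ * v"] sum.delta' cong: if_cong)
  also have "\<dots> \<in> Poly m UNIV"
    by (intro Poly_sum subspace_UNIV Poly_map[OF _ _ assms, of "\<lambda>r. r *\<^sub>R axis _ 1"])
      (auto intro!: linearI simp: scaleR_add_left)
  finally show ?thesis .
qed

lemma Poly_mdiv: 
  assumes "\<tau> \<in> Poly m UNIV" shows "mdiv \<tau> \<in> Poly (m - 1) UNIV"
  unfolding mdiv_def[abs_def] by (intro Poly_vec_lambda Poly_vdiv Poly_vec_nth assms)

section \<open>Matrices\<close>

lemma outer_mult: "outer a b *v c = (b \<bullet> c) *\<^sub>R a"
  by (simp add: outer_def vec_eq_iff matrix_vector_mult_def inner_vec_def sum_distrib_right sum_distrib_left mult.assoc mult.left_commute mult.commute)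

lemma tproj_eq: "tproj \<nu> w = w - (\<nu> \<bullet> w) *\<^sub>R \<nu>"
  by (simp add: tproj_def matrix_vector_mult_diff_rdistrib outer_mult)

lemma tproj_uminus: "tproj (- \<nu>) w = tproj \<nu> w"
  by (simp add: tproj_eq)

lemma linear_tproj: "linear (tproj \<nu>)"
  by (rule linearI) (simp_all add: tproj_eq algebra_simps inner_add_right)

lemma tproj_tangential: "norm \<nu> = 1 \<Longrightarrow> tproj \<nu> w \<bullet> \<nu> = 0"
  by (simp add: tproj_eq inner_diff_left norm_eq_1 inner_commute[of w])

lemma inner_mat_one: "mat 1 \<bullet> (Q :: real^'n^'n) = trace Q"
  by (simp add: inner_vec_def mat_def trace_def if_distrib[of "\<lambda>r. r * _"] cong: if_cong)

lemma inner_outer: "outer a b \<bullet> (Q :: real^'n^'n) = a \<bullet> (Q *v b)"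
  by (simp add: inner_vec_def outer_def matrix_vector_mult_def sum_distrib_left mult.assoc mult.left_commute mult.commute)

lemma trace_skew: "Q \<in> skew_matrices \<Longrightarrow> trace Q = 0"
proof -
  assume "Q \<in> skew_matrices"
  then have *: "transpose Q = - Q" by (simp add: skew_matrices_def)
  have "Q $ i $ i = 0" for i
    using arg_cong[OF *, of "\<lambda>A. A $ i $ i"] by (simp add: transpose_def)
  then show ?thesis by (simp add: trace_def)
qed

text \<open>The deviator subtracts a multiple of the identity, which is orthogonal to skew matrices.\<close>
lemma inner_dev_skew: "Q \<in> skew_matrices \<Longrightarrow> dev A \<bullet> Q = A \<bullet> Q"
  by (simp add: dev_def inner_diff_left inner_mat_one trace_skew)

lemma trace_dev: "trace (dev (A :: real^'n^'n)) = 0"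
  by (simp add: dev_def trace_def mat_def sum_subtractf)

lemma dev_traceless: "dev A \<in> traceless_matrices"
  by (simp add: traceless_matrices_def trace_dev)

lemma trace_add: "trace (A + B) = trace A + trace B"
  by (simp add: trace_def sum.distrib)

lemma trace_scaleR: "trace (c *\<^sub>R A) = c * trace A"
  by (simp add: trace_def sum_distrib_left)

lemma subspace_traceless: "subspace traceless_matrices"
  by (auto intro!: subspaceI simp: traceless_matrices_def trace_add trace_scaleR) (simp add: trace_def)

lemma subspace_skew: "subspace skew_matrices"
proof (rule subspaceI)
  show "x + y \<in> skew_matrices" if "x \<in> skew_matrices" "y \<in> skew_matrices" for x y :: "real^'a^'a"
  proof -
    have "transpose (x + y) = transpose x + transpose y" by (simp add: transpose_def vec_eq_iff)
    then show ?thesis using that by (simp add: skew_matrices_def)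
  qed
  show "c *\<^sub>R x \<in> skew_matrices" if "x \<in> skew_matrices" for c and x :: "real^'a^'a"
  proof -
    have "transpose (c *\<^sub>R x) = c *\<^sub>R transpose x" by (simp add: transpose_def vec_eq_iff)
    then show ?thesis using that by (simp add: skew_matrices_def)
  qed
qed (simp add: skew_matrices_def transpose_def vec_eq_iff)

lemma skew_inner: 
  assumes "Q \<in> skew_matrices" shows "a \<bullet> (Q *v b) = - ((Q *v a) \<bullet> b)"
proof -
  have "a \<bullet> (Q *v b) = (transpose Q *v a) \<bullet> b" by (simp add: dot_lmul_matrix transpose_matrix_vector)
  also have "\<dots> = ((- Q) *v a) \<bullet> b" using assms by (simp add: skew_matrices_def)
  finally show ?thesis by (simp add: matrix_vector_mult_def inner_vec_def sum_negf)
qed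

section \<open>Barycentric coordinates of a simplex\<close>

text \<open>The gradient of a barycentric coordinate, chosen as the coefficient vector of the affine function.\<close>
definition bgrad :: "(real^'n) set \<Rightarrow> real^'n \<Rightarrow> real^'n" where
  "bgrad T v = (SOME a. \<exists>c. bary T v = (\<lambda>x. a \<bullet> x + c))"

locale cell =
  fixes T :: "(real^'n) set"
  assumes simplex: "int CARD('n) simplex T"
begin

lemma verts_props:
  "finite (verts T)" "\<not> affine_dependent (verts T)" "card (verts T) = CARD('n) + 1" "T = convex hull (verts T)"
proof -
  obtain C where C: "\<not> affine_dependent C" "int (card C) = int CARD('n) + 1" "T = convex hull C"
    using simplex unfolding simplex_def by blast
  have "verts T = C" unfolding verts_def C(3)
    using extreme_point_of_convex_hull_affine_independent[OF C(1)] by blast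
  then show "finite (verts T)" "\<not> affine_dependent (verts T)" "card (verts T) = CARD('n) + 1" "T = convex hull (verts T)"
    using C aff_independent_finite by auto
qed

lemma affine_hull_verts: "affine hull (verts T) = UNIV"
proof -
  have "aff_dim (verts T) = int DIM(real^'n)"
    using verts_props affine_independent_iff_card[of "verts T"] by simp
  then show ?thesis using aff_dim_eq_full by blast
qed

text \<open>The vertices are affinely independent and as many as the dimension plus one, so they affinely span
  the space.\<close>
lemma affine_functional_unique:
  assumes "\<And>w. w \<in> verts T \<Longrightarrow> a \<bullet> w + c = a' \<bullet> w + c'"
  shows "a = a'" "c = c'"
proof -
  have "verts T \<subseteq> {x. (a - a') \<bullet> x = c' - c}" using assms by (auto simp: inner_diff_left algebra_simps)
  then have "affine hull (verts T) \<subseteq> {x. (a - a') \<bullet> x = c' - c}"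
    by (rule hull_minimal) (rule affine_hyperplane)
  then have *: "(a - a') \<bullet> x = c' - c" for x using affine_hull_verts by auto
  then show "c = c'" using *[of 0] by simp
  then show "a = a'" using *[of "a - a'"] by simp
qed

lemma other_vertex: "v \<in> verts T \<Longrightarrow> \<exists>w\<in>verts T. w \<noteq> v"
proof (rule ccontr)
  assume "v \<in> verts T" "\<not> (\<exists>w\<in>verts T. w \<noteq> v)"
  then have "verts T = {v}" by blast
  then show False using verts_props(3) by simp
qed

lemma bary_ex:
  assumes v: "v \<in> verts T"
  shows "\<exists>a c. \<forall>w\<in>verts T. a \<bullet> w + c = (if w = v then 1 else 0)"
proof -
  obtain w0 where w0: "w0 \<in> verts T" "w0 \<noteq> v" using other_vertex[OF v] by blast
  have ins: "insert w0 (verts T - {w0}) = verts T" using w0 by blast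
  have "independent ((\<lambda>x. - w0 + x) ` (verts T - {w0}))"
    using affine_dependent_iff_dependent[of w0 "verts T - {w0}"] verts_props(2) unfolding ins by simp
  then obtain f where f: "linear f" "\<forall>x\<in>(\<lambda>x. - w0 + x) ` (verts T - {w0}). f x = (if w0 + x = v then 1 else (0::real))"
    using linear_independent_extend[of "(\<lambda>x. - w0 + x) ` (verts T - {w0})" "\<lambda>x. if w0 + x = v then 1 else (0::real)"] by blast
  define a where "a = adjoint f 1"
  have fa: "f x = a \<bullet> x" for x using adjoint_works[OF f(1), of x 1] by (simp add: a_def inner_commute)
  have "a \<bullet> w + (- (a \<bullet> w0)) = (if w = v then 1 else 0)" if w: "w \<in> verts T" for w
  proof (cases "w = w0")
    case False
    then have "f (- w0 + w) = (if w = v then 1 else 0)" using f(2) w by auto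
    then show ?thesis by (simp add: fa inner_diff_right)
  qed (use w0 in auto)
  then show ?thesis by blast
qed

lemma bary_affine:
  assumes v: "v \<in> verts T"
  shows "\<exists>a c. bary T v = (\<lambda>x. a \<bullet> x + c)" and "w \<in> verts T \<Longrightarrow> bary T v w = (if w = v then 1 else 0)"
proof -
  obtain a c where ac: "\<And>w. w\<in>verts T \<Longrightarrow> a \<bullet> w + c = (if w = v then 1 else 0)" using bary_ex[OF v] by blast
  have "bary T v = (\<lambda>x. a \<bullet> x + c)" unfolding bary_def
  proof (rule the_equality)
    show "(\<exists>a' c'. (\<lambda>x. a \<bullet> x + c) = (\<lambda>x. a' \<bullet> x + c')) \<and> (\<forall>w\<in>verts T. a \<bullet> w + c = (if w = v then 1 else 0))"
      using ac by blast
    fix l assume l: "(\<exists>a c. l = (\<lambda>x. a \<bullet> x + c)) \<and> (\<forall>w\<in>verts T. l w = (if w = v then 1 else 0))"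
    then obtain a' c' where l': "l = (\<lambda>x. a' \<bullet> x + c')" by blast
    have "a' \<bullet> w + c' = a \<bullet> w + c" if "w \<in> verts T" for w using l l' ac that by simp
    from affine_functional_unique[OF this] show "l = (\<lambda>x. a \<bullet> x + c)" using l' by simp
  qed
  then show "\<exists>a c. bary T v = (\<lambda>x. a \<bullet> x + c)" "w \<in> verts T \<Longrightarrow> bary T v w = (if w = v then 1 else 0)"
    using ac by auto
qed

lemma bary_eq: assumes "v \<in> verts T" shows "bary T v x = bgrad T v \<bullet> x + bary T v 0"
proof -
  have "\<exists>c. bary T v = (\<lambda>x. bgrad T v \<bullet> x + c)"
    unfolding bgrad_def by (rule someI_ex) (rule bary_affine(1)[OF assms])
  then obtain c where "bary T v = (\<lambda>x. bgrad T v \<bullet> x + c)" by blast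
  then show ?thesis by simp
qed

lemma bary_diff: "v \<in> verts T \<Longrightarrow> bary T v x - bary T v y = bgrad T v \<bullet> (x - y)"
  using bary_eq[of v x] bary_eq[of v y] by (simp add: inner_diff_right)

lemma bary_add: "v \<in> verts T \<Longrightarrow> bary T v (x + h) = bary T v x + bgrad T v \<bullet> h"
  using bary_eq[of v "x + h"] bary_eq[of v x] by (simp add: inner_add_right)

lemma bary_has_derivative: "v \<in> verts T \<Longrightarrow> (bary T v has_derivative (\<lambda>h. bgrad T v \<bullet> h)) (at x within S)"
proof -
  assume v: "v \<in> verts T"
  have "bary T v = (\<lambda>x. bgrad T v \<bullet> x + bary T v 0)" by (intro ext bary_eq[OF v])
  moreover have "((\<lambda>x. bgrad T v \<bullet> x + bary T v 0) has_derivative (\<lambda>h. bgrad T v \<bullet> h)) (at x within S)"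
    by (auto intro!: derivative_eq_intros)
  ultimately show ?thesis by simp
qed

lemma grad_bary: assumes "v \<in> verts T" shows "grad (bary T v) x = bgrad T v"
proof -
  have "frechet_derivative (bary T v) (at x) = (\<lambda>h. bgrad T v \<bullet> h)"
    by (rule frechet_derivative_at[OF bary_has_derivative[OF assms], symmetric])
  then show ?thesis by (simp add: grad_def vec_eq_iff inner_axis)
qed

lemma bary_vertex: "v \<in> verts T \<Longrightarrow> w \<in> verts T \<Longrightarrow> bary T v w = (if w = v then 1 else 0)"
  by (rule bary_affine(2))

lemma bgrad_edge:
  "i \<in> verts T \<Longrightarrow> a \<in> verts T \<Longrightarrow> b \<in> verts T \<Longrightarrow>
    bgrad T i \<bullet> (b - a) = (if b = i then 1 else 0) - (if a = i then 1 else 0)"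
  using bary_diff[of i b a] bary_vertex[of i] by simp

lemma bgrad_nonzero: "v \<in> verts T \<Longrightarrow> bgrad T v \<noteq> 0"
proof
  assume v: "v \<in> verts T" "bgrad T v = 0"
  obtain w where "w \<in> verts T" "w \<noteq> v" using other_vertex[OF v(1)] by blast
  then show False using bgrad_edge[of v w v] v by simp
qed

lemma affine_combination_eq:
  fixes r :: "real^'n \<Rightarrow> real"
  shows "(\<Sum>v\<in>verts T. r v * bary T v x) = (\<Sum>v\<in>verts T. r v *\<^sub>R bgrad T v) \<bullet> x + (\<Sum>v\<in>verts T. r v * bary T v 0)"
proof -
  have "(\<Sum>v\<in>verts T. r v * bary T v x) = (\<Sum>v\<in>verts T. r v * (bgrad T v \<bullet> x) + r v * bary T v 0)"
    by (intro sum.cong refl) (simp add: bary_eq[of _ x] distrib_left)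
  then show ?thesis by (simp add: sum.distrib inner_sum_left)
qed

lemma affine_combination_vertex:
  fixes r :: "real^'n \<Rightarrow> real"
  assumes "w \<in> verts T" shows "(\<Sum>v\<in>verts T. r v * bary T v w) = r w"
proof -
  have "(\<Sum>v\<in>verts T. r v * bary T v w) = (\<Sum>v\<in>verts T. if w = v then r v else 0)"
    using assms by (intro sum.cong) (auto simp: bary_vertex)
  then show ?thesis using assms verts_props(1) by simp
qed

lemma bary_sum: "(\<Sum>v\<in>verts T. bary T v x) = 1" and bgrad_sum: "(\<Sum>v\<in>verts T. bgrad T v) = 0"
proof -
  have "(\<Sum>v\<in>verts T. bgrad T v) \<bullet> w + (\<Sum>v\<in>verts T. bary T v 0) = 0 \<bullet> w + 1" if "w \<in> verts T" for w
    using affine_combination_eq[of "\<lambda>_. 1" w] affine_combination_vertex[OF that, of "\<lambda>_. 1"] by simp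
  from affine_functional_unique[OF this]
  show "(\<Sum>v\<in>verts T. bary T v x) = 1" "(\<Sum>v\<in>verts T. bgrad T v) = 0"
    using affine_combination_eq[of "\<lambda>_. 1" x] by simp_all
qed

text \<open>The edges from a vertex and the gradients of the other coordinates are dual bases. The linear part of
  the expansion of an affine function in barycentric coordinates gives this first identity; the
  transposed one is in \<open>bgrad_repr\<close>.\<close>
lemma bgrad_dual: "(\<Sum>v\<in>verts T. (v \<bullet> w) *\<^sub>R bgrad T v) = w"
  and bary_repr_inner: "(\<Sum>v\<in>verts T. (v \<bullet> w) * bary T v x) = x \<bullet> w"
proof -
  have "(\<Sum>v\<in>verts T. (v \<bullet> w) *\<^sub>R bgrad T v) \<bullet> u + (\<Sum>v\<in>verts T. (v \<bullet> w) * bary T v 0) = w \<bullet> u + 0" if "u \<in> verts T" for u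
    using affine_combination_eq[of "\<lambda>v. v \<bullet> w" u] affine_combination_vertex[OF that, of "\<lambda>v. v \<bullet> w"] by (simp add: inner_commute)
  from affine_functional_unique[OF this]
  show "(\<Sum>v\<in>verts T. (v \<bullet> w) *\<^sub>R bgrad T v) = w" "(\<Sum>v\<in>verts T. (v \<bullet> w) * bary T v x) = x \<bullet> w"
    using affine_combination_eq[of "\<lambda>v. v \<bullet> w" x] by (simp_all add: inner_commute)
qed

lemma bary_repr: "(\<Sum>v\<in>verts T. bary T v x *\<^sub>R v) = x"
  by (rule vector_eq_rdot[THEN iffD1]) (use bary_repr_inner[of _ x] in \<open>simp add: inner_sum_left mult.commute\<close>)

lemma bgrad_repr: "(\<Sum>v\<in>verts T. (bgrad T v \<bullet> w) *\<^sub>R v) = w"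
proof (rule vector_eq_rdot[THEN iffD1], rule allI)
  fix u
  have "(\<Sum>v\<in>verts T. (bgrad T v \<bullet> w) *\<^sub>R v) \<bullet> u = (\<Sum>v\<in>verts T. (v \<bullet> u) *\<^sub>R bgrad T v) \<bullet> w"
    by (simp add: inner_sum_left mult.commute)
  then show "(\<Sum>v\<in>verts T. (bgrad T v \<bullet> w) *\<^sub>R v) \<bullet> u = w \<bullet> u" by (simp add: bgrad_dual inner_commute)
qed

lemma bgrad_repr_from: "(\<Sum>v\<in>verts T. (bgrad T v \<bullet> w) *\<^sub>R (v - b)) = w"
proof -
  have "(\<Sum>v\<in>verts T. (bgrad T v \<bullet> w) *\<^sub>R (v - b)) = w - (\<Sum>v\<in>verts T. (bgrad T v \<bullet> w) *\<^sub>R b)"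
    by (simp add: scaleR_diff_right sum_subtractf bgrad_repr)
  also have "(\<Sum>v\<in>verts T. (bgrad T v \<bullet> w) *\<^sub>R b) = ((\<Sum>v\<in>verts T. bgrad T v) \<bullet> w) *\<^sub>R b"
    by (simp add: inner_sum_left scaleR_sum_left)
  finally show ?thesis by (simp add: bgrad_sum)
qed

lemma bgrad_dual_from: "(\<Sum>v\<in>verts T. ((v - b) \<bullet> w) *\<^sub>R bgrad T v) = w"
  by (simp add: inner_diff_left scaleR_diff_left sum_subtractf bgrad_dual bgrad_sum flip: scaleR_sum_right)

lemma zero_if_edges_orthogonal:
  assumes "b \<in> verts T" "\<And>a. a \<in> verts T \<Longrightarrow> a \<noteq> b \<Longrightarrow> w \<bullet> (a - b) = 0"
  shows "w = 0"
proof -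
  have "w = (\<Sum>v\<in>verts T. ((v - b) \<bullet> w) *\<^sub>R bgrad T v)" by (simp add: bgrad_dual_from)
  also have "\<dots> = 0"
  proof (intro sum.neutral ballI)
    fix v assume v: "v \<in> verts T"
    have "(v - b) \<bullet> w = 0" using assms(2)[OF v] by (cases "v = b") (simp_all add: inner_commute)
    then show "((v - b) \<bullet> w) *\<^sub>R bgrad T v = 0" by simp
  qed
  finally show ?thesis .
qed

text \<open>The tangent directions of a facet span a hyperplane, whose normal line contains the gradient of the
  opposite coordinate.\<close>
lemma bgrad_direction:
  assumes "l \<in> verts T" "\<And>a b. a \<in> verts T - {l} \<Longrightarrow> b \<in> verts T - {l} \<Longrightarrow> w \<bullet> (a - b) = 0"
  shows "\<exists>c. w = c *\<^sub>R bgrad T l"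
proof -
  obtain b where b: "b \<in> verts T" "b \<noteq> l" using other_vertex[OF assms(1)] by blast
  have "w = (\<Sum>v\<in>verts T. ((v - b) \<bullet> w) *\<^sub>R bgrad T v)" by (simp add: bgrad_dual_from)
  also have "\<dots> = (\<Sum>v\<in>{l}. ((v - b) \<bullet> w) *\<^sub>R bgrad T v)"
  proof (rule sum.mono_neutral_right)
    show "\<forall>v\<in>verts T - {l}. ((v - b) \<bullet> w) *\<^sub>R bgrad T v = 0"
      using assms(2)[of _ b] b by (simp add: inner_commute)
  qed (use assms(1) verts_props(1) in auto)
  finally show ?thesis by auto
qed

lemma mem_iff: "x \<in> T \<longleftrightarrow> (\<forall>v\<in>verts T. 0 \<le> bary T v x)"
proof
  assume "x \<in> T"
  then have "x \<in> convex hull (verts T)" using verts_props(4) by simp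
  show "\<forall>v\<in>verts T. 0 \<le> bary T v x"
  proof
    fix v assume v: "v \<in> verts T"
    have "verts T \<subseteq> {x. bgrad T v \<bullet> x \<ge> - bary T v 0}"
    proof
      fix w assume w: "w \<in> verts T"
      show "w \<in> {x. bgrad T v \<bullet> x \<ge> - bary T v 0}"
        using bary_eq[OF v, of w] bary_vertex[OF v w] by (auto split: if_splits)
    qed
    then have "convex hull (verts T) \<subseteq> {x. bgrad T v \<bullet> x \<ge> - bary T v 0}"
      by (rule hull_minimal) (rule convex_halfspace_ge)
    then show "0 \<le> bary T v x" using \<open>x \<in> convex hull _\<close> bary_eq[OF v, of x] by auto
  qed
next
  assume "\<forall>v\<in>verts T. 0 \<le> bary T v x"
  then have "\<exists>u. (\<forall>v\<in>verts T. 0 \<le> u v) \<and> sum u (verts T) = 1 \<and> (\<Sum>v\<in>verts T. u v *\<^sub>R v) = x"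
    by (intro exI[of _ "\<lambda>v. bary T v x"] conjI bary_sum bary_repr)
  then have "x \<in> convex hull (verts T)" unfolding convex_hull_finite[OF verts_props(1)] by simp
  then show "x \<in> T" using verts_props(4) by simp
qed

lemma verts_subset: "verts T \<subseteq> T"
  by (auto simp: verts_def extreme_point_of_def)

lemma convex_cell: "convex T" and compact_cell: "compact T"
  using convex_simplex[OF simplex] compact_simplex[OF simplex] by auto

lemma continuous_bary: "v \<in> verts T \<Longrightarrow> continuous_on S (bary T v)"
  using has_derivative_continuous_on[of S "bary T v" "\<lambda>_ h. bgrad T v \<bullet> h"] bary_has_derivative by blast

lemma interior_pos: "(\<And>v. v \<in> verts T \<Longrightarrow> 0 < bary T v x) \<Longrightarrow> x \<in> interior T"
proof -
  assume x: "\<And>v. v \<in> verts T \<Longrightarrow> 0 < bary T v x"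
  have "open (\<Inter>v\<in>verts T. {x. 0 < bary T v x})"
    using verts_props(1) by (intro open_INT) (auto intro!: open_Collect_less continuous_bary)
  moreover have "(\<Inter>v\<in>verts T. {x. 0 < bary T v x}) \<subseteq> T"
    using mem_iff less_imp_le by blast
  ultimately show ?thesis using x by (intro interiorI) auto
qed

lemma positive_point: "\<exists>x. \<forall>v\<in>verts T. 0 < bary T v x"
proof -
  define c where "c = (1 / (CARD('n) + 1)) *\<^sub>R (\<Sum>w\<in>verts T. w)"
  have "bary T v c = 1 / (CARD('n) + 1)" if v: "v \<in> verts T" for v
  proof -
    have "(\<Sum>w\<in>verts T. bary T v w) = (\<Sum>w\<in>verts T. bgrad T v \<bullet> w + bary T v 0)"
      by (intro sum.cong refl bary_eq[OF v])
    also have "\<dots> = (CARD('n) + 1) * bary T v c"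
      by (subst bary_eq[OF v, of c]) (simp add: c_def sum.distrib inner_sum_right verts_props(3) distrib_left)
    finally have "(CARD('n) + 1) * bary T v c = (\<Sum>w\<in>verts T. if w = v then 1 else 0)"
      using v by (simp add: bary_vertex)
    then show ?thesis using v verts_props(1) by (simp add: field_simps)
  qed
  then show ?thesis by (intro exI[of _ c]) auto
qed

lemma interior_nonempty: "interior T \<noteq> {}"
  using positive_point interior_pos by blast

lemma facets_of_eq: "facets_of T = opp T ` verts T"
proof -
  have ne: "verts T - {v} \<noteq> {}" if "v \<in> verts T" for v using other_vertex[OF that] by blast
  have "F facet_of T \<longleftrightarrow> F \<noteq> {} \<and> (\<exists>u. u \<in> verts T \<and> F = convex hull (verts T - {u}))" for F
    using facet_of_convex_hull_affine_independent[OF verts_props(2), of F] unfolding verts_props(4)[symmetric] .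
  then show ?thesis unfolding facets_of_def opp_def using ne by (auto simp: image_iff)
qed

lemma opp_iff: assumes l: "l \<in> verts T" shows "x \<in> opp T l \<longleftrightarrow> x \<in> T \<and> bary T l x = 0"
proof
  assume x: "x \<in> opp T l"
  have "verts T - {l} \<subseteq> {x. bgrad T l \<bullet> x = - bary T l 0}"
  proof
    fix w assume w: "w \<in> verts T - {l}"
    then show "w \<in> {x. bgrad T l \<bullet> x = - bary T l 0}"
      using bary_eq[OF l, of w] bary_vertex[OF l, of w] by simp
  qed
  then have "opp T l \<subseteq> {x. bgrad T l \<bullet> x = - bary T l 0}"
    unfolding opp_def by (rule hull_minimal) (simp add: convex_hyperplane)
  then have "bary T l x = 0" using x bary_eq[OF l, of x] by auto
  moreover have "opp T l \<subseteq> T" unfolding opp_def by (subst (2) verts_props(4)) (rule hull_mono, blast)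
  ultimately show "x \<in> T \<and> bary T l x = 0" using x by blast
next
  assume x: "x \<in> T \<and> bary T l x = 0"
  have "(\<Sum>v\<in>verts T - {l}. bary T v x) = 1" "(\<Sum>v\<in>verts T - {l}. bary T v x *\<^sub>R v) = x"
    using bary_sum[of x] bary_repr[of x] x l verts_props(1) by (simp_all add: sum_diff1)
  moreover have "\<forall>v\<in>verts T - {l}. 0 \<le> bary T v x" using x mem_iff by blast
  ultimately have "\<exists>u. (\<forall>v\<in>verts T - {l}. 0 \<le> u v) \<and> sum u (verts T - {l}) = 1 \<and> (\<Sum>v\<in>verts T - {l}. u v *\<^sub>R v) = x"
    by (intro exI[of _ "\<lambda>v. bary T v x"] conjI)
  then show "x \<in> opp T l"
    unfolding opp_def using verts_props(1) by (simp add: convex_hull_finite)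
qed

lemma opp_verts_iff: "l \<in> verts T \<Longrightarrow> w \<in> verts T \<Longrightarrow> w \<in> opp T l \<longleftrightarrow> w \<noteq> l"
  using opp_iff[of l w] verts_subset bary_vertex[of l w] by (auto split: if_splits)

lemma verts_opp: "l \<in> verts T \<Longrightarrow> verts (opp T l) = verts T - {l}"
proof -
  assume l: "l \<in> verts T"
  have "\<not> affine_dependent (verts T - {l})" using verts_props(2) affine_dependent_subset by blast
  then show ?thesis unfolding opp_def verts_def[of "convex hull _"]
    using extreme_point_of_convex_hull_affine_independent by blast
qed

lemma barycenter_in: assumes l: "l \<in> verts T" shows "barycenter (opp T l) \<in> opp T l"
proof -
  let ?V = "verts T - {l}"
  have c: "card ?V = CARD('n)" using l verts_props(1,3) by simp
  have f: "finite ?V" using verts_props(1) by simp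
  have "barycenter (opp T l) = (\<Sum>v\<in>?V. (1 / real (card ?V)) *\<^sub>R v)"
    unfolding barycenter_def verts_opp[OF l] by (simp add: scaleR_sum_right)
  also have "\<dots> \<in> opp T l"
    unfolding opp_def by (rule convex_sum[OF f convex_convex_hull]) (use c in \<open>auto simp: hull_inc\<close>)
  finally show ?thesis .
qed

lemma out_normal_opp:
  assumes l: "l \<in> verts T" shows "out_normal T (opp T l) = - (1 / norm (bgrad T l)) *\<^sub>R bgrad T l"
  unfolding out_normal_def
proof (rule the_equality)
  let ?n = "- (1 / norm (bgrad T l)) *\<^sub>R bgrad T l"
  have N: "norm (bgrad T l) > 0" using bgrad_nonzero[OF l] by simp
  have "?n \<bullet> (y - x) \<le> 0" if "x \<in> opp T l" "y \<in> T" for x y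
  proof -
    have "bgrad T l \<bullet> (y - x) = bary T l y" using bary_diff[OF l, of y x] opp_iff[OF l, of x] that by simp
    then show ?thesis using mem_iff[of y] that(2) l N by (simp add: divide_simps)
  qed
  then show "norm ?n = 1 \<and> (\<forall>x\<in>opp T l. \<forall>y\<in>T. ?n \<bullet> (y - x) \<le> 0)" using N by simp
  fix n assume n: "norm n = 1 \<and> (\<forall>x\<in>opp T l. \<forall>y\<in>T. n \<bullet> (y - x) \<le> 0)"
  have "n \<bullet> (a - b) = 0" if "a \<in> verts T - {l}" "b \<in> verts T - {l}" for a b
  proof -
    have ab: "a \<in> opp T l" "b \<in> opp T l" "a \<in> T" "b \<in> T" using that opp_verts_iff[OF l] verts_subset by auto
    have "n \<bullet> (a - b) \<le> 0" "n \<bullet> (b - a) \<le> 0" using n ab by blast+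
    then show ?thesis by (simp add: inner_diff_right)
  qed
  then obtain c where c: "n = c *\<^sub>R bgrad T l" using bgrad_direction[OF l] by blast
  obtain w where w: "w \<in> verts T" "w \<noteq> l" using other_vertex[OF l] by blast
  have "n \<bullet> (l - w) \<le> 0" using n w l opp_verts_iff[OF l w(1)] verts_subset by blast
  then have "c \<le> 0" using bgrad_edge[of l w l] w l c by simp
  moreover have "\<bar>c\<bar> * norm (bgrad T l) = 1" using n c by simp
  ultimately have "c = - (1 / norm (bgrad T l))" using N by (simp add: field_simps)
  then show "n = ?n" using c by simp
qed

lemma norm_out_normal: "l \<in> verts T \<Longrightarrow> norm (out_normal T (opp T l)) = 1"
  using bgrad_nonzero[of l] by (simp add: out_normal_opp)

lemma unit_normal_unique:
  assumes l: "l \<in> verts T" and \<nu>: "norm \<nu> = 1"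
    and "\<And>a b. a \<in> verts T - {l} \<Longrightarrow> b \<in> verts T - {l} \<Longrightarrow> \<nu> \<bullet> (a - b) = 0"
  shows "\<nu> = out_normal T (opp T l) \<or> \<nu> = - out_normal T (opp T l)"
proof -
  obtain c where c: "\<nu> = c *\<^sub>R bgrad T l" using bgrad_direction[OF l assms(3)] by blast
  have N: "norm (bgrad T l) > 0" using bgrad_nonzero[OF l] by simp
  have "\<bar>c\<bar> = 1 / norm (bgrad T l)" using \<nu> c N by (simp add: field_simps)
  then have "c = 1 / norm (bgrad T l) \<or> c = - (1 / norm (bgrad T l))" by (auto simp: abs_if split: if_splits)
  then show ?thesis unfolding c out_normal_opp[OF l] by auto
qed

end

section \<open>Integrals over compact sets and inner products\<close>

lemma compact_sets_lebesgue: "compact S \<Longrightarrow> S \<in> sets lebesgue"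
  using lmeasurable_compact by blast

lemma integrable_compact:
  fixes f :: "'a::euclidean_space \<Rightarrow> 'b::euclidean_space"
  assumes "compact S" "continuous_on S f"
  shows "integrable (lebesgue_on S) f"
proof -
  have *: "integrable lborel (\<lambda>x. indicator S x *\<^sub>R f x)" using assms by (rule borel_integrable_compact)
  then have "integrable lebesgue (\<lambda>x. indicator S x *\<^sub>R f x)"
    using integrable_completion borel_measurable_integrable by blast
  then show ?thesis
    using compact_sets_lebesgue[OF assms(1)] by (subst integrable_restrict_space) auto
qed

lemma integral_lborel_compact:
  fixes f :: "'a::euclidean_space \<Rightarrow> 'b::euclidean_space"
  assumes "compact S" "continuous_on S f"
  shows "integral\<^sup>L (lebesgue_on S) f = (\<integral>x. indicator S x *\<^sub>R f x \<partial>lborel)"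
proof -
  have *: "integrable lborel (\<lambda>x. indicator S x *\<^sub>R f x)" using assms by (rule borel_integrable_compact)
  have "integral\<^sup>L (lebesgue_on S) f = (\<integral>x. indicator S x *\<^sub>R f x \<partial>lebesgue)"
    using compact_sets_lebesgue[OF assms(1)] by (subst integral_restrict_space) auto
  also have "\<dots> = (\<integral>x. indicator S x *\<^sub>R f x \<partial>lborel)"
    by (rule integral_completion) (rule borel_measurable_integrable[OF *])
  finally show ?thesis .
qed

text \<open>The exceptional set is null, and inside the interior it is open.\<close>
lemma integral_zero_on_interior:
  fixes h :: "'a::euclidean_space \<Rightarrow> real"
  assumes K: "compact K" "continuous_on K h" "\<And>x. x \<in> K \<Longrightarrow> 0 \<le> h x"
    and z: "integral\<^sup>L (lebesgue_on K) h = 0" and x: "x \<in> interior K"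
  shows "h x = 0"
proof -
  have KS: "K \<in> sets lebesgue" using compact_sets_lebesgue K by blast
  have nonneg: "AE x in lebesgue_on K. 0 \<le> h x"
    using K(3) by (intro AE_I2) simp
  have "AE x in lebesgue_on K. h x = 0"
    using integral_nonneg_eq_0_iff_AE[OF integrable_compact[OF K(1,2)] nonneg] z by simp
  then have ae: "AE x in lebesgue. x \<in> K \<longrightarrow> h x = 0"
    using KS by (simp add: AE_restrict_space_iff)
  define U where "U = interior K \<inter> h -` (- {0})"
  have "open U" unfolding U_def
    by (rule continuous_open_preimage) (auto intro: continuous_on_subset[OF K(2) interior_subset])
  have "AE x in lebesgue. x \<notin> U"
    using ae by (rule AE_mp) (use interior_subset in \<open>auto simp: U_def intro!: AE_I2\<close>)
  then have "U \<in> null_sets lebesgue"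
    using \<open>open U\<close> by (subst AE_iff_null_sets) auto
  then have "negligible U" by (simp add: negligible_iff_null_sets)
  then have "U = {}" using open_not_negligible[OF \<open>open U\<close>] by blast
  then show ?thesis using x by (auto simp: U_def)
qed

lemma l2i_commute: "l2i M f g = l2i M g f"
  by (simp add: l2i_def inner_commute)

lemma l2i_lincomb:
  assumes "integrable M (\<lambda>x. f x \<bullet> h x)" "integrable M (\<lambda>x. g x \<bullet> h x)"
  shows "l2i M (\<lambda>x. a *\<^sub>R f x + b *\<^sub>R g x) h = a * l2i M f h + b * l2i M g h"
  using assms by (simp add: l2i_def inner_add_left)

lemma l2i_nonneg: "0 \<le> l2i M f f"
  by (simp add: l2i_def)

lemma integrable_inner_compact:
  fixes f g :: "'a::euclidean_space \<Rightarrow> 'b::euclidean_space"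
  shows "compact S \<Longrightarrow> continuous_on S f \<Longrightarrow> continuous_on S g \<Longrightarrow> integrable (lebesgue_on S) (\<lambda>x. f x \<bullet> g x)"
  by (intro integrable_compact continuous_intros)

lemma l2i_lincomb_compact:
  fixes f g h :: "real^'n \<Rightarrow> 'b::euclidean_space"
  assumes "compact S" "continuous_on S f" "continuous_on S g" "continuous_on S h"
  shows "l2i (lebesgue_on S) (\<lambda>x. a *\<^sub>R f x + b *\<^sub>R g x) h = a * l2i (lebesgue_on S) f h + b * l2i (lebesgue_on S) g h"
    and "l2i (lebesgue_on S) h (\<lambda>x. a *\<^sub>R f x + b *\<^sub>R g x) = a * l2i (lebesgue_on S) h f + b * l2i (lebesgue_on S) h g"
proof -
  show "l2i (lebesgue_on S) (\<lambda>x. a *\<^sub>R f x + b *\<^sub>R g x) h = a * l2i (lebesgue_on S) f h + b * l2i (lebesgue_on S) g h"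
    by (intro l2i_lincomb integrable_inner_compact assms)
  then show "l2i (lebesgue_on S) h (\<lambda>x. a *\<^sub>R f x + b *\<^sub>R g x) = a * l2i (lebesgue_on S) h f + b * l2i (lebesgue_on S) h g"
    by (simp add: l2i_commute[of _ h])
qed

lemma integrable_L2_inner:
  fixes f g :: "real^'n \<Rightarrow> 'b::euclidean_space"
  assumes f: "f \<in> L2 D" and g: "g \<in> L2 D"
  shows "integrable (lebesgue_on D) (\<lambda>x. f x \<bullet> g x)"
proof (rule Bochner_Integration.integrable_bound)
  show "integrable (lebesgue_on D) (\<lambda>x. (norm (f x))\<^sup>2 + (norm (g x))\<^sup>2)"
    using f g by (auto simp: L2_def)
  show "(\<lambda>x. f x \<bullet> g x) \<in> borel_measurable (lebesgue_on D)"
    using f g by (auto simp: L2_def intro: borel_measurable_inner)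
  show "AE x in lebesgue_on D. norm (f x \<bullet> g x) \<le> norm ((norm (f x))\<^sup>2 + (norm (g x))\<^sup>2)"
  proof (rule AE_I2)
    fix x
    have "\<bar>f x \<bullet> g x\<bar> \<le> norm (f x) * norm (g x)" by (rule Cauchy_Schwarz_ineq2)
    also have "\<dots> \<le> (norm (f x))\<^sup>2 + (norm (g x))\<^sup>2"
      using sum_squares_bound[of "norm (f x)" "norm (g x)"] mult_nonneg_nonneg[OF norm_ge_zero norm_ge_zero, of "f x" "g x"] by linarith
    finally show "norm (f x \<bullet> g x) \<le> norm ((norm (f x))\<^sup>2 + (norm (g x))\<^sup>2)" by simp
  qed
qed

lemma L2_lincomb:
  fixes f g :: "real^'n \<Rightarrow> 'b::euclidean_space"
  assumes f: "f \<in> L2 D" and g: "g \<in> L2 D"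
  shows "(\<lambda>x. a *\<^sub>R f x + b *\<^sub>R g x) \<in> L2 D"
proof -
  have "integrable (lebesgue_on D) (\<lambda>x. a\<^sup>2 * (norm (f x))\<^sup>2 + 2 * a * b * (f x \<bullet> g x) + b\<^sup>2 * (norm (g x))\<^sup>2)"
    using integrable_L2_inner[OF f g] f g by (auto simp: L2_def)
  moreover have "(norm (a *\<^sub>R f x + b *\<^sub>R g x))\<^sup>2 = a\<^sup>2 * (norm (f x))\<^sup>2 + 2 * a * b * (f x \<bullet> g x) + b\<^sup>2 * (norm (g x))\<^sup>2" for x
    unfolding power2_norm_eq_inner
    by (simp add: inner_add_left inner_add_right inner_commute algebra_simps power2_eq_square)
  ultimately show ?thesis using f g by (auto simp: L2_def)
qed

lemma l2_Cauchy_Schwarz: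
  fixes f g :: "real^'n \<Rightarrow> 'b::euclidean_space"
  assumes f: "f \<in> L2 D" and g: "g \<in> L2 D"
  shows "\<bar>l2i (lebesgue_on D) f g\<bar> \<le> l2norm (lebesgue_on D) f * l2norm (lebesgue_on D) g"
proof -
  let ?M = "lebesgue_on D"
  define A where "A = l2i ?M f f" define B where "B = l2i ?M f g" define C where "C = l2i ?M g g"
  have q: "0 \<le> A - 2 * t * B + t\<^sup>2 * C" for t
  proof -
    have "0 \<le> l2i ?M (\<lambda>x. 1 *\<^sub>R f x + (-t) *\<^sub>R g x) (\<lambda>x. 1 *\<^sub>R f x + (-t) *\<^sub>R g x)" by (rule l2i_nonneg)
    also have "\<dots> = 1 * l2i ?M f (\<lambda>x. 1 *\<^sub>R f x + (-t) *\<^sub>R g x) + (-t) * l2i ?M g (\<lambda>x. 1 *\<^sub>R f x + (-t) *\<^sub>R g x)"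
      by (intro l2i_lincomb integrable_L2_inner L2_lincomb f g)
    also have "\<dots> = 1 * (1 * A + (-t) * B) + (-t) * (1 * B + (-t) * C)"
      unfolding A_def B_def C_def l2i_commute[of _ _ "\<lambda>x. 1 *\<^sub>R f x + (-t) *\<^sub>R g x"] 
      by (subst (1 2) l2i_lincomb) (auto intro!: integrable_L2_inner f g simp: l2i_commute[of _ g f])
    finally show ?thesis by (simp add: power2_eq_square algebra_simps)
  qed
  have AC: "A \<ge> 0" "C \<ge> 0" by (simp_all add: A_def C_def l2i_nonneg)
  have "B\<^sup>2 \<le> A * C"
  proof (cases "C = 0")
    case True
    have "B = 0"
    proof (rule ccontr)
      assume "B \<noteq> 0"
      then show False using q[of "(A + 1) / (2 * B)"] True AC by simp
    qed
    then show ?thesis using True by simp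
  next
    case False
    then have "C > 0" using AC by simp
    then show ?thesis using q[of "B / C"] by (simp add: field_simps power2_eq_square)
  qed
  then have "\<bar>B\<bar> \<le> sqrt (A * C)" by (metis real_sqrt_le_iff real_sqrt_abs)
  then show ?thesis by (simp add: A_def B_def C_def l2norm_def real_sqrt_mult)
qed

section \<open>Surface measure on a flat facet\<close>

text \<open>The facet measure is Lebesgue measure on this prism, projected to the plane of the facet. Surface
  integrals thereby become volume integrals over a compact set.\<close>
definition prism :: "real^'n \<Rightarrow> (real^'n) set \<Rightarrow> (real^'n) set" where
  "prism \<nu> F = {x + s *\<^sub>R \<nu> | x s. x \<in> F \<and> 0 \<le> s \<and> s \<le> 1}"

definition facet_proj :: "real^'n \<Rightarrow> (real^'n) set \<Rightarrow> real^'n \<Rightarrow> real^'n" where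
  "facet_proj \<nu> F y = y - (\<nu> \<bullet> (y - barycenter F)) *\<^sub>R \<nu>"

text \<open>Integrands on a facet: functions extended by zero off the facet are discontinuous on the whole space,
  so Borel measurability is demanded there and continuity on the facet only.\<close>
definition facet_fun :: "(real^'n) set \<Rightarrow> (real^'n \<Rightarrow> 'b::euclidean_space) \<Rightarrow> bool" where
  "facet_fun F g \<longleftrightarrow> g \<in> borel_measurable borel \<and> continuous_on F g"

text \<open>What is needed of a facet \<open>F\<close> with unit normal \<open>\<nu>\<close> to integrate over it.\<close>
locale flat =
  fixes \<nu> :: "real^'n" and F :: "(real^'n) set"
  assumes unit: "norm \<nu> = 1" and compact: "compact F"
    and flat: "\<And>x. x \<in> F \<Longrightarrow> \<nu> \<bullet> (x - barycenter F) = 0"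
begin

lemma prism_image: "prism \<nu> F = (\<lambda>(x, s). x + s *\<^sub>R \<nu>) ` (F \<times> {0..1})"
proof (rule set_eqI)
  fix y
  have "y \<in> (\<lambda>(x, s). x + s *\<^sub>R \<nu>) ` (F \<times> {0..1}) \<longleftrightarrow> (\<exists>x\<in>F. \<exists>s\<in>{0..1}. y = x + s *\<^sub>R \<nu>)" by auto
  then show "y \<in> prism \<nu> F \<longleftrightarrow> y \<in> (\<lambda>(x, s). x + s *\<^sub>R \<nu>) ` (F \<times> {0..1})"
    unfolding prism_def mem_Collect_eq atLeastAtMost_iff Bex_def by blast
qed

lemma compact_prism: "compact (prism \<nu> F)"
proof -
  show ?thesis unfolding prism_image
    by (auto intro!: compact_continuous_image compact_Times compact continuous_intros simp: split_beta)
qed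

lemma convex_prism: "convex F \<Longrightarrow> convex (prism \<nu> F)"
  unfolding prism_image
  by (intro convex_linear_image convex_Times convex_real_interval)
    (auto simp: linear_iff algebra_simps)

lemma proj_prism: "x \<in> F \<Longrightarrow> facet_proj \<nu> F (x + s *\<^sub>R \<nu>) = x"
  using flat[of x] unit by (simp add: facet_proj_def inner_add_right inner_diff_right norm_eq_1)

lemma proj_in: "y \<in> prism \<nu> F \<Longrightarrow> facet_proj \<nu> F y \<in> F"
  using proj_prism by (auto simp: prism_def)

lemma continuous_proj: "continuous_on S (facet_proj \<nu> F)"
  unfolding facet_proj_def by (intro continuous_intros)

lemma continuous_comp_proj: "continuous_on F g \<Longrightarrow> continuous_on (prism \<nu> F) (\<lambda>y. g (facet_proj \<nu> F y))"
  using continuous_on_compose2[of F g "prism \<nu> F" "facet_proj \<nu> F"] continuous_proj proj_in by auto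

lemma facet_integral:
  fixes g :: "real^'n \<Rightarrow> 'b::euclidean_space"
  assumes g: "facet_fun F g"
  shows "integrable (facet_measure \<nu> F) g"
    and "integral\<^sup>L (facet_measure \<nu> F) g = integral\<^sup>L (lebesgue_on (prism \<nu> F)) (\<lambda>y. g (facet_proj \<nu> F y))"
proof -
  let ?P = "prism \<nu> F"
  have fm: "facet_measure \<nu> F = distr (restrict_space lborel ?P) borel (facet_proj \<nu> F)"
    unfolding facet_measure_def prism_def facet_proj_def ..
  have P: "?P \<in> sets lborel" using compact_prism by (simp add: borel_compact)
  have c: "continuous_on ?P (\<lambda>y. g (facet_proj \<nu> F y))"
    using g by (intro continuous_comp_proj) (simp add: facet_fun_def)
  have m: "facet_proj \<nu> F \<in> measurable (restrict_space lborel ?P) borel"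
    by (rule measurable_restrict_space1) (simp add: borel_measurable_continuous_onI continuous_proj)
  have gb: "g \<in> borel_measurable borel" using g by (simp add: facet_fun_def)
  have *: "integrable lborel (\<lambda>y. indicator ?P y *\<^sub>R g (facet_proj \<nu> F y))"
    by (rule borel_integrable_compact[OF compact_prism c])
  then have "integrable (restrict_space lborel ?P) (\<lambda>y. g (facet_proj \<nu> F y))"
    using P by (subst integrable_restrict_space) auto
  then show "integrable (facet_measure \<nu> F) g"
    unfolding fm by (subst integrable_distr_eq[OF m gb])
  have "integral\<^sup>L (facet_measure \<nu> F) g = integral\<^sup>L (restrict_space lborel ?P) (\<lambda>y. g (facet_proj \<nu> F y))"
    unfolding fm by (rule integral_distr[OF m gb])
  also have "\<dots> = (\<integral>y. indicator ?P y *\<^sub>R g (facet_proj \<nu> F y) \<partial>lborel)"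
    using P by (subst integral_restrict_space) auto
  also have "\<dots> = integral\<^sup>L (lebesgue_on ?P) (\<lambda>y. g (facet_proj \<nu> F y))"
    by (rule integral_lborel_compact[OF compact_prism c, symmetric])
  finally show "integral\<^sup>L (facet_measure \<nu> F) g = integral\<^sup>L (lebesgue_on ?P) (\<lambda>y. g (facet_proj \<nu> F y))" .
qed

lemma facet_fun_inner: "facet_fun F f \<Longrightarrow> facet_fun F g \<Longrightarrow> facet_fun F (\<lambda>x. f x \<bullet> g x)"
  by (auto simp: facet_fun_def intro!: continuous_intros borel_measurable_inner)

lemma facet_l2i_lincomb:
  assumes "facet_fun F f" "facet_fun F g" "facet_fun F h"
  shows "l2i (facet_measure \<nu> F) (\<lambda>x. a *\<^sub>R f x + b *\<^sub>R g x) h = a * l2i (facet_measure \<nu> F) f h + b * l2i (facet_measure \<nu> F) g h"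
    and "l2i (facet_measure \<nu> F) h (\<lambda>x. a *\<^sub>R f x + b *\<^sub>R g x) = a * l2i (facet_measure \<nu> F) h f + b * l2i (facet_measure \<nu> F) h g"
proof -
  show "l2i (facet_measure \<nu> F) (\<lambda>x. a *\<^sub>R f x + b *\<^sub>R g x) h = a * l2i (facet_measure \<nu> F) f h + b * l2i (facet_measure \<nu> F) g h"
    by (intro l2i_lincomb facet_integral facet_fun_inner assms)
  then show "l2i (facet_measure \<nu> F) h (\<lambda>x. a *\<^sub>R f x + b *\<^sub>R g x) = a * l2i (facet_measure \<nu> F) h f + b * l2i (facet_measure \<nu> F) h g"
    by (simp add: l2i_commute[of _ h])
qed

lemma facet_l2i_cong:
  assumes f: "facet_fun F f" "facet_fun F f'" "facet_fun F g" "facet_fun F g'"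
    and eq: "\<And>x. x \<in> F \<Longrightarrow> f x = f' x" "\<And>x. x \<in> F \<Longrightarrow> g x = g' x"
  shows "l2i (facet_measure \<nu> F) f g = l2i (facet_measure \<nu> F) f' g'"
  unfolding l2i_def facet_integral(2)[OF facet_fun_inner[OF f(1,3)]] facet_integral(2)[OF facet_fun_inner[OF f(2,4)]]
  by (intro Bochner_Integration.integral_cong refl) (use eq proj_in in auto)

lemma facet_l2i_zero:
  assumes f: "facet_fun F f" and z: "l2i (facet_measure \<nu> F) f f = 0" and x: "x \<in> F" and
    int: "interior (prism \<nu> F) \<noteq> {}" and conv: "convex F"
  shows "f x = 0"
proof -
  let ?P = "prism \<nu> F"
  let ?h = "\<lambda>y. f (facet_proj \<nu> F y) \<bullet> f (facet_proj \<nu> F y)"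
  have c: "continuous_on ?P ?h"
    using f by (intro continuous_intros continuous_comp_proj) (simp_all add: facet_fun_def)
  have "integral\<^sup>L (lebesgue_on ?P) ?h = 0"
    using z unfolding l2i_def facet_integral(2)[OF facet_fun_inner[OF f f]] .
  then have h0: "?h y = 0" if "y \<in> interior ?P" for y
    using integral_zero_on_interior[OF compact_prism c _ _ that] by simp
  have cP: "convex ?P" by (rule convex_prism[OF conv])
  have "x = x + 0 *\<^sub>R \<nu>" by simp
  then have xP: "x \<in> ?P" using x unfolding prism_def by fastforce
  have "x \<in> closure (interior ?P)"
    using convex_closure_interior[OF cP int] xP closure_subset by blast
  moreover have "closure (interior ?P) \<subseteq> {y \<in> ?P. ?h y = 0}"
  proof (rule closure_minimal)
    show "interior ?P \<subseteq> {y \<in> ?P. ?h y = 0}" using h0 interior_subset by blast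
    show "closed {y \<in> ?P. ?h y = 0}"
      using continuous_closed_preimage_constant[OF c compact_imp_closed[OF compact_prism]] by blast
  qed
  ultimately have "?h x = 0" by blast
  moreover have "facet_proj \<nu> F x = x" using proj_prism[OF x, of 0] by simp
  ultimately show ?thesis by simp
qed

end

section \<open>Facets of a simplex\<close>

context cell begin

lemma facet_compact: "l \<in> verts T \<Longrightarrow> compact (opp T l)"
  unfolding opp_def using verts_props(1) by (simp add: finite_imp_compact_convex_hull)

lemma facet_convex: "convex (opp T l)"
  unfolding opp_def by (rule convex_convex_hull)

lemma out_normal_inner: 
  assumes l: "l \<in> verts T" and x: "x \<in> opp T l" 
  shows "out_normal T (opp T l) \<bullet> (y - x) = - (bary T l y / norm (bgrad T l))"
  using bary_diff[OF l, of y x] opp_iff[OF l, of x] x by (simp add: out_normal_opp[OF l])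

lemma flat_facet:
  assumes l: "l \<in> verts T" and \<nu>: "\<nu> = out_normal T (opp T l) \<or> \<nu> = - out_normal T (opp T l)"
  shows "flat \<nu> (opp T l)"
proof
  show "norm \<nu> = 1" using \<nu> norm_out_normal[OF l] by auto
  show "compact (opp T l)" by (rule facet_compact[OF l])
  show "\<nu> \<bullet> (x - barycenter (opp T l)) = 0" if "x \<in> opp T l" for x
    using out_normal_inner[OF l barycenter_in[OF l], of x] opp_iff[OF l, of x] that \<nu> by auto
qed

text \<open>A convex set without interior lies in a hyperplane. The normal of that hyperplane would be orthogonal to
  the facet and also to the facet normal.\<close>
lemma prism_interior:
  assumes l: "l \<in> verts T" and \<nu>: "\<nu> = out_normal T (opp T l) \<or> \<nu> = - out_normal T (opp T l)"
  shows "interior (prism \<nu> (opp T l)) \<noteq> {}"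
proof
  assume e: "interior (prism \<nu> (opp T l)) = {}"
  interpret flat \<nu> "opp T l" by (rule flat_facet[OF assms])
  obtain a b where ab: "a \<noteq> 0" "prism \<nu> (opp T l) \<subseteq> {x. a \<bullet> x = b}"
    using empty_interior_subset_hyperplane[OF convex_prism[OF facet_convex] e] by blast
  have p: "x + s *\<^sub>R \<nu> \<in> prism \<nu> (opp T l)" if "x \<in> opp T l" "0 \<le> s" "s \<le> 1" for x s
    using that unfolding prism_def by blast
  have s0: "a \<bullet> x = b" if "x \<in> opp T l" for x using p[OF that, of 0] ab(2) by auto
  have "a \<bullet> (v - w) = 0" if "v \<in> verts T - {l}" "w \<in> verts T - {l}" for v w
    using s0[of v] s0[of w] that opp_verts_iff[OF l] by (simp add: inner_diff_right)
  then obtain c where c: "a = c *\<^sub>R bgrad T l" using bgrad_direction[OF l] by blast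
  have "a \<bullet> (barycenter (opp T l) + 1 *\<^sub>R \<nu>) = b" using p[OF barycenter_in[OF l], of 1] ab(2) by auto
  then have "a \<bullet> \<nu> = 0" using s0[OF barycenter_in[OF l]] by (simp add: inner_add_right)
  then have "c * (bgrad T l \<bullet> bgrad T l) = 0" using \<nu> bgrad_nonzero[OF l] by (auto simp: c out_normal_opp[OF l])
  then show False using ab(1) c bgrad_nonzero[OF l] by simp
qed

lemma bary_barycenter:
  assumes l: "l \<in> verts T" and m: "m \<in> verts T" "m \<noteq> l"
  shows "bary T m (barycenter (opp T l)) = 1 / CARD('n)"
proof -
  let ?V = "verts T - {l}"
  have c: "card ?V = CARD('n)" using l verts_props(1,3) by simp
  have "(\<Sum>w\<in>?V. bary T m w) = (\<Sum>w\<in>?V. bgrad T m \<bullet> w + bary T m 0)"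
    by (intro sum.cong refl bary_eq[OF m(1)])
  also have "\<dots> = CARD('n) * bary T m (barycenter (opp T l))"
    by (subst bary_eq[OF m(1), of "barycenter (opp T l)"])
      (simp add: barycenter_def verts_opp[OF l] c sum.distrib inner_sum_right distrib_left)
  finally have "CARD('n) * bary T m (barycenter (opp T l)) = (\<Sum>w\<in>?V. if w = m then 1 else 0)"
    using m by (simp add: bary_vertex)
  then show ?thesis using m verts_props(1) by (simp add: field_simps)
qed

text \<open>At the barycenter of a facet all barycentric coordinates but the opposite one are positive, and that
  one increases along the inner normal.\<close>
lemma near_facet_interior:
  assumes l: "l \<in> verts T"
  shows "\<forall>\<^sub>F e in at_right 0. barycenter (opp T l) - e *\<^sub>R out_normal T (opp T l) \<in> interior T"
proof -
  let ?x = "\<lambda>e. barycenter (opp T l) - e *\<^sub>R out_normal T (opp T l)"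
  have "\<forall>\<^sub>F e in at_right 0. 0 < bary T m (?x e)" if m: "m \<in> verts T" for m
  proof (cases "m = l")
    case True
    have "0 < bary T m (?x e)" if "e > 0" for e
      using bary_diff[OF l, of "?x e" "barycenter (opp T l)"] opp_iff[OF l] barycenter_in[OF l] that bgrad_nonzero[OF l]
      by (simp add: True out_normal_opp[OF l])
    then show ?thesis using eventually_at_right_less[of "0::real"] by (auto elim: eventually_mono)
  next
    case False
    have "((\<lambda>e. bary T m (?x e)) \<longlongrightarrow> bary T m (?x 0)) (at_right 0)"
      by (subst (1 2) bary_eq[OF m]) (auto intro!: tendsto_eq_intros)
    moreover have "0 < bary T m (?x 0)" using bary_barycenter[OF l m False] by simp
    ultimately show ?thesis by (rule order_tendstoD(1))
  qed
  then have "\<forall>\<^sub>F e in at_right 0. \<forall>m\<in>verts T. 0 < bary T m (?x e)"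
    using verts_props(1) by (simp add: eventually_ball_finite_distrib)
  then show ?thesis by (rule eventually_mono) (blast intro: interior_pos)
qed

end

section \<open>Meshes\<close>

lemma continuous_in_L2:
  fixes g :: "real^'n \<Rightarrow> 'b::euclidean_space"
  assumes g: "continuous_on UNIV g" and D: "bounded D" "D \<in> sets lebesgue"
  shows "g \<in> L2 D"
proof -
  have K: "compact (closure D)" using D(1) by simp
  have "integrable (lebesgue_on (closure D)) (\<lambda>x. (norm (g x))\<^sup>2)"
    by (intro integrable_compact[OF K] continuous_intros continuous_on_subset[OF g]) auto
  then have "integrable lebesgue (\<lambda>x. indicator (closure D) x *\<^sub>R (norm (g x))\<^sup>2)"
    using compact_sets_lebesgue[OF K] by (subst (asm) integrable_restrict_space) auto
  then have "integrable lebesgue (\<lambda>x. indicator D x *\<^sub>R (indicator (closure D) x *\<^sub>R (norm (g x))\<^sup>2))"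
    by (rule integrable_mult_indicator[OF D(2)])
  also have "(\<lambda>x. indicator D x *\<^sub>R (indicator (closure D) x *\<^sub>R (norm (g x))\<^sup>2)) = (\<lambda>x. indicator D x *\<^sub>R (norm (g x))\<^sup>2)"
    using closure_subset[of D] by (auto simp: fun_eq_iff indicator_def)
  finally have "integrable (lebesgue_on D) (\<lambda>x. (norm (g x))\<^sup>2)"
    using D(2) by (subst integrable_restrict_space) auto
  moreover have "g \<in> borel_measurable (lebesgue_on D)"
    using borel_measurable_continuous_onI[OF g] by (intro measurable_restrict_space1 measurable_completion) simp
  ultimately show ?thesis by (simp add: L2_def)
qed

locale mesh =
  fixes \<Omega> :: "(real^'n) set" and Th :: "(real^'n) set set" and nF :: "(real^'n) set \<Rightarrow> real^'n"
  assumes domain: "polytopal_domain \<Omega>"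
    and mesh: "simplicial_mesh \<Omega> Th"
    and normals: "facet_normals Th nF"
begin

lemma cell: "T \<in> Th \<Longrightarrow> cell T"
  using mesh by (simp add: simplicial_mesh_def cell_def)

lemma finite_Th: "finite Th"
  using mesh by (simp add: simplicial_mesh_def triangulation_def)

lemma closure_domain: "closure \<Omega> = \<Union>Th"
  using mesh by (simp add: simplicial_mesh_def)

lemma face_inter: "T \<in> Th \<Longrightarrow> T' \<in> Th \<Longrightarrow> (T \<inter> T') face_of T"
  using mesh by (simp add: simplicial_mesh_def triangulation_def)

lemma compact_cell: "T \<in> Th \<Longrightarrow> compact T"
  using cell.compact_cell cell by blast

lemma open_domain: "open \<Omega>"
  using domain by (auto simp: polytopal_domain_def)

lemma bounded_domain: "bounded \<Omega>"
proof -
  have "compact (closure \<Omega>)" unfolding closure_domain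
    using finite_Th compact_cell by (intro compact_Union) auto
  then show ?thesis by (rule bounded_subset[OF compact_imp_bounded closure_subset])
qed

lemma domain_lebesgue [simp]: "\<Omega> \<in> sets lebesgue"
  using open_domain by simp

lemma domain_subset: "\<Omega> \<subseteq> \<Union>Th"
  using closure_domain closure_subset by blast

text \<open>A polytopal domain is the interior of a closed set, so it contains the interior of its closure.\<close>
lemma interior_cell_subset: assumes T: "T \<in> Th" shows "interior T \<subseteq> \<Omega>"
proof -
  obtain P where P: "finite P" "\<forall>K\<in>P. polytope K" "\<Omega> = interior (\<Union>P)"
    using domain by (auto simp: polytopal_domain_def)
  have "closed (\<Union>P)" using P by (intro closed_Union) (auto intro: compact_imp_closed polytope_imp_compact)
  then have "closure \<Omega> \<subseteq> \<Union>P" using P(3) interior_subset closure_minimal by blast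
  then have "T \<subseteq> \<Union>P" using T closure_domain by blast
  then show ?thesis using P(3) interior_mono by blast
qed

text \<open>A face that meets the interior of a simplex is the whole simplex.\<close>
lemma disjoint_interiors:
  assumes "T \<in> Th" "T' \<in> Th" "interior T \<inter> interior T' \<noteq> {}"
  shows "T = T'"
proof -
  have "T \<subseteq> T'" if T: "T \<in> Th" "T' \<in> Th" "interior T \<inter> interior T' \<noteq> {}" for T T'
  proof -
    have "T \<inter> T' \<inter> interior T \<noteq> {}" using T(3) interior_subset by blast
    then have "T \<inter> T' \<inter> rel_interior T \<noteq> {}"
      using interior_subset_rel_interior[of T] by blast
    then have "T \<subseteq> T \<inter> T'" using subset_of_face_of[OF face_inter[OF T(1,2)], of T] by blast
    then show ?thesis by blast
  qed
  from this[OF assms] this[of T' T] show ?thesis using assms by (auto simp: Int_commute)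
qed

lemma facetE:
  assumes "T \<in> Th" "F \<in> facets_of T"
  obtains l where "l \<in> verts T" "F = opp T l"
  using cell.facets_of_eq[OF cell[OF assms(1)]] assms(2) by blast

text \<open>All cells at a facet have the same vertices there, and these determine the normal up to sign.\<close>
lemma facet_normal_cases:
  assumes T: "T \<in> Th" and F: "F \<in> facets_of T"
  shows "nF F = out_normal T F \<or> nF F = - out_normal T F" 
proof -
  interpret T: cell T by (rule cell[OF T])
  obtain l where l: "l \<in> verts T" "F = opp T l" using facetE[OF T F] by blast
  have "F \<in> facets Th" using T F by (auto simp: facets_def)
  then obtain S where S: "S \<in> Th" "F \<in> facets_of S" "nF F = out_normal S F"
    using normals by (auto simp: facet_normals_def)
  interpret S: cell S by (rule cell[OF S(1)])
  obtain m where m: "m \<in> verts S" "F = opp S m" using facetE[OF S(1,2)] by blast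
  have v: "verts T - {l} = verts S - {m}" using T.verts_opp[OF l(1)] S.verts_opp[OF m(1)] l m by simp
  have "nF F \<bullet> (a - b) = 0" if "a \<in> verts T - {l}" "b \<in> verts T - {l}" for a b
  proof -
    have "nF F = (- (1 / norm (bgrad S m))) *\<^sub>R bgrad S m" using S(3) m(2) S.out_normal_opp[OF m(1)] by simp
    moreover have "bgrad S m \<bullet> (a - b) = 0" using S.bgrad_edge[OF m(1), of b a] that unfolding v by simp
    ultimately show ?thesis by simp
  qed
  moreover have "norm (nF F) = 1" using S.norm_out_normal[OF m(1)] S(3) m by simp
  ultimately show ?thesis using T.unit_normal_unique[OF l(1)] l(2) by blast
qed

lemma flat_facet: "T \<in> Th \<Longrightarrow> F \<in> facets_of T \<Longrightarrow> flat (nF F) F"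
  by (metis facetE facet_normal_cases cell cell.flat_facet)

lemma prism_interior: "T \<in> Th \<Longrightarrow> F \<in> facets_of T \<Longrightarrow> interior (prism (nF F) F) \<noteq> {}"
  by (metis facetE facet_normal_cases cell cell.prism_interior)

lemma convex_facet: "T \<in> Th \<Longrightarrow> F \<in> facets_of T \<Longrightarrow> convex F"
  by (metis facetE cell cell.facet_convex)

lemma norm_nF: "T \<in> Th \<Longrightarrow> F \<in> facets_of T \<Longrightarrow> norm (nF F) = 1"
  using flat_facet flat.unit by blast

text \<open>Just inside the barycenter of the common facet, two cells on the same side overlap.\<close>
lemma same_side:
  assumes T: "T \<in> Th" "F \<in> facets_of T" and S: "S \<in> Th" "F \<in> facets_of S" and n: "out_normal T F = out_normal S F"
  shows "T = S"
proof -
  interpret T: cell T by (rule cell[OF T(1)])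
  interpret S: cell S by (rule cell[OF S(1)])
  obtain l where l: "l \<in> verts T" "F = opp T l" using facetE[OF T] by blast
  obtain m where m: "m \<in> verts S" "F = opp S m" using facetE[OF S] by blast
  have "\<forall>\<^sub>F e in at_right 0. barycenter F - e *\<^sub>R out_normal T F \<in> interior T \<inter> interior S"
    using eventually_conj[OF T.near_facet_interior[OF l(1)] S.near_facet_interior[OF m(1)]]
    unfolding l(2)[symmetric] m(2)[symmetric] n[symmetric] by simp
  then obtain e where "barycenter F - e *\<^sub>R out_normal T F \<in> interior T \<inter> interior S"
    using eventually_happens'[of "at_right (0::real)"] by auto
  then show ?thesis using disjoint_interiors T S by blast
qed

lemma plus_cell:
  assumes F: "F \<in> facets Th"
  shows "plus_cell Th nF F \<in> Th" "F \<in> facets_of (plus_cell Th nF F)" "out_normal (plus_cell Th nF F) F = nF F"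
proof -
  obtain S where S: "S \<in> Th" "F \<in> facets_of S" "nF F = out_normal S F"
    using normals F by (auto simp: facet_normals_def)
  have "plus_cell Th nF F = S" unfolding plus_cell_def
  proof (rule the_equality)
    show "A = S" if A: "A \<in> Th \<and> F \<in> facets_of A \<and> out_normal A F = nF F" for A
      using same_side[of A F S] A S by simp
  qed (use S in simp)
  then show "plus_cell Th nF F \<in> Th" "F \<in> facets_of (plus_cell Th nF F)" "out_normal (plus_cell Th nF F) F = nF F"
    using S by auto
qed

lemma interior_facet_sub: "F \<in> interior_facets Th \<Longrightarrow> F \<in> facets Th"
  by (auto simp: interior_facets_def facets_def)

lemma minus_cell:
  assumes F: "F \<in> interior_facets Th"
  shows "minus_cell Th nF F \<in> Th" "F \<in> facets_of (minus_cell Th nF F)" "out_normal (minus_cell Th nF F) F = - nF F"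
proof -
  obtain A B where AB: "A \<in> Th" "B \<in> Th" "A \<noteq> B" "F \<in> facets_of A" "F \<in> facets_of B"
    using F by (auto simp: interior_facets_def)
  have "out_normal A F = - nF F \<or> out_normal B F = - nF F"
  proof (rule ccontr)
    assume "\<not> ?thesis"
    then have "out_normal A F = nF F" "out_normal B F = nF F"
      using facet_normal_cases[OF AB(1,4)] facet_normal_cases[OF AB(2,5)] by (metis minus_minus)+
    then show False using same_side AB by metis
  qed
  then obtain S where S: "S \<in> Th" "F \<in> facets_of S" "out_normal S F = - nF F" using AB by blast
  have "minus_cell Th nF F = S" unfolding minus_cell_def
  proof (rule the_equality)
    show "A = S" if A: "A \<in> Th \<and> F \<in> facets_of A \<and> out_normal A F = - nF F" for A
      using same_side[of A F S] A S by simp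
  qed (use S in simp)
  then show "minus_cell Th nF F \<in> Th" "F \<in> facets_of (minus_cell Th nF F)" "out_normal (minus_cell Th nF F) F = - nF F"
    using S by auto
qed

lemma cells_of_interior_facet:
  assumes F: "F \<in> interior_facets Th"
  shows "{T \<in> Th. F \<in> facets_of T} = {plus_cell Th nF F, minus_cell Th nF F}"
    and "plus_cell Th nF F \<noteq> minus_cell Th nF F"
proof -
  note P = plus_cell[OF interior_facet_sub[OF F]] and M = minus_cell[OF F]
  have "norm (nF F) = 1" using norm_nF P by blast
  have "nF F \<noteq> - nF F"
  proof
    assume "nF F = - nF F"
    then have "nF F + nF F = 0" by (metis add.right_inverse)
    then have "2 *\<^sub>R nF F = 0" by (simp add: scaleR_2)
    then show False using \<open>norm (nF F) = 1\<close> by simp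
  qed
  then show "plus_cell Th nF F \<noteq> minus_cell Th nF F" using P(3) M(3) by metis
  have "T = plus_cell Th nF F \<or> T = minus_cell Th nF F" if T: "T \<in> Th" "F \<in> facets_of T" for T
    using facet_normal_cases[OF T]
  proof
    assume "nF F = out_normal T F"
    then show ?thesis using same_side[OF T P(1,2)] P(3) by simp
  next
    assume "nF F = - out_normal T F"
    then show ?thesis using same_side[OF T M(1,2)] M(3) by simp
  qed
  then show "{T \<in> Th. F \<in> facets_of T} = {plus_cell Th nF F, minus_cell Th nF F}"
    using P(1,2) M(1,2) by blast
qed

lemma finite_facets_of: "T \<in> Th \<Longrightarrow> finite (facets_of T)"
  using cell.facets_of_eq[OF cell] cell.verts_props(1)[OF cell] by simp

lemma finite_facets: "finite (facets Th)"
  unfolding facets_def using finite_Th finite_facets_of by auto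

lemma finite_interior_facets: "finite (interior_facets Th)"
  using finite_subset[OF _ finite_facets] interior_facet_sub by blast

text \<open>Exchanges the order of summation: an interior facet has exactly the two cells of opposite normals.\<close>
lemma sum_over_facets:
  fixes G :: "(real^'n) set \<Rightarrow> (real^'n) set \<Rightarrow> real"
  assumes "\<And>T F. T \<in> Th \<Longrightarrow> F \<in> facets_of T \<Longrightarrow> F \<notin> interior_facets Th \<Longrightarrow> G T F = 0"
  shows "(\<Sum>T\<in>Th. \<Sum>F\<in>facets_of T. G T F)
     = (\<Sum>F\<in>interior_facets Th. G (plus_cell Th nF F) F + G (minus_cell Th nF F) F)"
proof -
  have r: "(\<Sum>F\<in>facets_of T. G T F) = (\<Sum>F\<in>facets Th. if F \<in> facets_of T then G T F else 0)" if "T \<in> Th" for T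
  proof -
    have "facets Th \<inter> facets_of T = facets_of T" using that by (auto simp: facets_def)
    then show ?thesis using sum.inter_restrict[OF finite_facets, of "G T" "facets_of T"] by simp
  qed
  have "(\<Sum>T\<in>Th. \<Sum>F\<in>facets_of T. G T F) = (\<Sum>T\<in>Th. \<Sum>F\<in>facets Th. if F \<in> facets_of T then G T F else 0)"
    by (rule sum.cong[OF refl r])
  also have "\<dots> = (\<Sum>F\<in>facets Th. \<Sum>T\<in>Th. if F \<in> facets_of T then G T F else 0)" by (rule sum.swap)
  also have "\<dots> = (\<Sum>F\<in>facets Th. \<Sum>T | T \<in> Th \<and> F \<in> facets_of T. G T F)"
    by (rule sum.cong[OF refl]) (simp add: sum.inter_filter finite_Th)
  also have "\<dots> = (\<Sum>F\<in>interior_facets Th. \<Sum>T | T \<in> Th \<and> F \<in> facets_of T. G T F)"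
    by (rule sum.mono_neutral_right) (use finite_facets interior_facet_sub assms in \<open>auto intro!: sum.neutral\<close>)
  also have "\<dots> = (\<Sum>F\<in>interior_facets Th. G (plus_cell Th nF F) F + G (minus_cell Th nF F) F)"
    by (rule sum.cong[OF refl]) (simp add: cells_of_interior_facet)
  finally show ?thesis .
qed

lemma integral_pieces:
  fixes h :: "(real^'n) set \<Rightarrow> real^'n \<Rightarrow> real"
  assumes h: "\<And>T. T \<in> Th \<Longrightarrow> integrable (lebesgue_on T) (h T)"
  shows "integrable (lebesgue_on \<Omega>) (\<lambda>x. \<Sum>T\<in>Th. indicator (interior T) x * h T x)"
    and "(\<integral>x. (\<Sum>T\<in>Th. indicator (interior T) x * h T x) \<partial>lebesgue_on \<Omega>) = (\<Sum>T\<in>Th. integral\<^sup>L (lebesgue_on T) (h T))"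
proof -
  have *: "integrable (lebesgue_on \<Omega>) (\<lambda>x. indicator (interior T) x * h T x) \<and>
     integral\<^sup>L (lebesgue_on \<Omega>) (\<lambda>x. indicator (interior T) x * h T x) = integral\<^sup>L (lebesgue_on T) (h T)" if T: "T \<in> Th" for T
  proof -
    have TS: "T \<in> sets lebesgue" using compact_sets_lebesgue compact_cell T by blast
    have i: "integrable lebesgue (\<lambda>x. indicator T x *\<^sub>R h T x)"
      using h[OF T] TS by (subst (asm) integrable_restrict_space) auto
    have e: "(\<lambda>x. indicator \<Omega> x *\<^sub>R (indicator (interior T) x * h T x)) = (\<lambda>x. indicator (interior T) x *\<^sub>R (indicator T x *\<^sub>R h T x))"
      using interior_cell_subset[OF T] interior_subset[of T] by (auto simp: fun_eq_iff indicator_def)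
    have i2: "integrable lebesgue (\<lambda>x. indicator (interior T) x *\<^sub>R (indicator T x *\<^sub>R h T x))"
      by (rule integrable_mult_indicator[OF _ i]) simp
    have "AE x in lebesgue. x \<notin> frontier T"
    proof -
      have "negligible (frontier T)" by (rule negligible_convex_frontier[OF cell.convex_cell[OF cell[OF T]]])
      then have "frontier T \<in> null_sets lebesgue" by (simp add: negligible_iff_null_sets)
      then show ?thesis by (rule AE_not_in)
    qed
    then have ae: "AE x in lebesgue. indicator (interior T) x *\<^sub>R (indicator T x *\<^sub>R h T x) = indicator T x *\<^sub>R h T x"
    proof (rule AE_mp, intro AE_I2 impI)
      fix x assume "x \<notin> frontier T"
      then have "x \<in> T \<Longrightarrow> x \<in> interior T" using closure_subset[of T] by (auto simp: frontier_def)
      then show "indicator (interior T) x *\<^sub>R (indicator T x *\<^sub>R h T x) = indicator T x *\<^sub>R h T x"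
        by (auto simp: indicator_def)
    qed
    have "integrable (lebesgue_on \<Omega>) (\<lambda>x. indicator (interior T) x * h T x)"
      using i2 by (subst integrable_restrict_space) (simp, simp only: e)
    moreover have "integral\<^sup>L (lebesgue_on \<Omega>) (\<lambda>x. indicator (interior T) x * h T x) = integral\<^sup>L lebesgue (\<lambda>x. indicator (interior T) x *\<^sub>R (indicator T x *\<^sub>R h T x))"
      by (subst integral_restrict_space) (simp, simp only: e)
    moreover have "\<dots> = integral\<^sup>L lebesgue (\<lambda>x. indicator T x *\<^sub>R h T x)"
      by (rule integral_cong_AE) (use i i2 ae borel_measurable_integrable in blast)+
    moreover have "\<dots> = integral\<^sup>L (lebesgue_on T) (h T)"
      using TS by (subst integral_restrict_space) auto
    ultimately show ?thesis by simp
  qed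
  show "integrable (lebesgue_on \<Omega>) (\<lambda>x. \<Sum>T\<in>Th. indicator (interior T) x * h T x)"
    by (intro Bochner_Integration.integrable_sum) (use * in blast)
  have "(\<integral>x. (\<Sum>T\<in>Th. indicator (interior T) x * h T x) \<partial>lebesgue_on \<Omega>) = (\<Sum>T\<in>Th. \<integral>x. indicator (interior T) x * h T x \<partial>lebesgue_on \<Omega>)"
    by (rule Bochner_Integration.integral_sum) (use * in blast)
  also have "\<dots> = (\<Sum>T\<in>Th. integral\<^sup>L (lebesgue_on T) (h T))" using * by (intro sum.cong refl) blast
  finally show "(\<integral>x. (\<Sum>T\<in>Th. indicator (interior T) x * h T x) \<partial>lebesgue_on \<Omega>) = (\<Sum>T\<in>Th. integral\<^sup>L (lebesgue_on T) (h T))" .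
qed

lemma pw_inner:
  fixes v w :: "(real^'n) set \<Rightarrow> real^'n \<Rightarrow> 'b::euclidean_space"
  shows "pw Th v x \<bullet> pw Th w x = (\<Sum>T\<in>Th. indicator (interior T) x * (v T x \<bullet> w T x))"
proof -
  have "pw Th v x \<bullet> pw Th w x = (\<Sum>T\<in>Th. \<Sum>S\<in>Th. indicator (interior T) x * (indicator (interior S) x * (v S x \<bullet> w T x)))"
    unfolding pw_def by (simp add: inner_sum_left inner_sum_right sum_distrib_left)
  also have "\<dots> = (\<Sum>T\<in>Th. \<Sum>S\<in>Th. if S = T then indicator (interior T) x * (v T x \<bullet> w T x) else 0)"
  proof (intro sum.cong refl)
    fix T S assume "T \<in> Th" "S \<in> Th"
    then show "indicator (interior T) x * (indicator (interior S) x * (v S x \<bullet> w T x)) = (if S = T then indicator (interior T) x * (v T x \<bullet> w T x) else 0)"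
      using disjoint_interiors[of T S] by (auto simp: indicator_def)
  qed
  finally show ?thesis using finite_Th by simp
qed

lemma ip_eq:
  fixes v w :: "(real^'n) set \<Rightarrow> real^'n \<Rightarrow> 'b::euclidean_space"
  assumes "\<And>T. T \<in> Th \<Longrightarrow> continuous_on T (v T)" "\<And>T. T \<in> Th \<Longrightarrow> continuous_on T (w T)"
  shows "ip \<Omega> Th v w = (\<Sum>T\<in>Th. l2i (lebesgue_on T) (v T) (w T))"
  unfolding ip_def l2i_def pw_inner
  by (intro integral_pieces integrable_inner_compact compact_cell assms)

lemma pw_lincomb: "pw Th (\<lambda>T x. a *\<^sub>R v T x + b *\<^sub>R w T x) x = a *\<^sub>R pw Th v x + b *\<^sub>R pw Th w x"
  by (simp add: pw_def scaleR_add_right sum.distrib scaleR_sum_right mult.commute)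

lemma pw_L2:
  fixes v :: "(real^'n) set \<Rightarrow> real^'n \<Rightarrow> 'b::euclidean_space"
  assumes v: "\<And>T. T \<in> Th \<Longrightarrow> continuous_on UNIV (v T)"
  shows "pw Th v \<in> L2 \<Omega>"
proof -
  have "integrable (lebesgue_on \<Omega>) (\<lambda>x. pw Th v x \<bullet> pw Th v x)"
    unfolding pw_inner by (intro integral_pieces integrable_inner_compact compact_cell continuous_on_subset[OF v]) auto
  moreover have "pw Th v \<in> borel_measurable (lebesgue_on \<Omega>)"
    unfolding pw_def[abs_def]
    by (intro borel_measurable_sum borel_measurable_scaleR measurable_restrict_space1 measurable_completion)
      (auto intro!: borel_measurable_continuous_onI v)
  ultimately show ?thesis by (simp add: L2_def power2_norm_eq_inner)
qed

end

section \<open>Tangential-normal components and facet spaces\<close>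

lemma fplus_eq: "fplus A B = {a + b | a b. a \<in> A \<and> b \<in> B}"
  by (simp add: fplus_def plus_fun_def)

lemma subspace_fplus: "subspace A \<Longrightarrow> subspace B \<Longrightarrow> subspace (fplus A B)"
  unfolding fplus_eq by (rule subspace_sums)

lemma fspan_eq: "fspan G = span G"
proof -
  have "(\<lambda>x. \<Sum>g\<in>S. c g *\<^sub>R g x) = (\<Sum>g\<in>S. c g *\<^sub>R g)" for S and c :: "('a \<Rightarrow> 'b) \<Rightarrow> real"
    by (simp add: fun_eq_iff sum_fun_apply)
  then show ?thesis unfolding fspan_def span_explicit by auto
qed

lemma linear_mat_vec: "linear (\<lambda>M :: real^'n^'m. M *v n)"
  by (rule linearI) (simp_all add: matrix_vector_mult_add_rdistrib scaleR_matrix_vector_assoc)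

definition tn_part :: "real^'n \<Rightarrow> real^'n^'n \<Rightarrow> real^'n" where
  "tn_part n M = tproj n (M *v n)"

lemma linear_tn: "linear (tn_part n)"
  unfolding tn_part_def using linear_compose[OF linear_mat_vec linear_tproj] by (simp add: o_def)

lemma tproj_self: "norm n = 1 \<Longrightarrow> tproj n n = 0"
  by (simp add: tproj_eq norm_eq_1)

lemma tn_dev_outer: "norm n = 1 \<Longrightarrow> tn_part n (dev (outer a b)) = (b \<bullet> n) *\<^sub>R tproj n a"
  by (simp add: tn_part_def dev_def matrix_vector_mult_diff_rdistrib outer_mult linear_diff[OF linear_tproj]
      linear_scale[OF linear_tproj] tproj_self flip: scaleR_matrix_vector_assoc)

lemma tn_uminus: "tn_part (- n) M = - tn_part n M"
proof -
  have "M *v (- n) = - (M *v n)" using matrix_vector_mult_scaleR[of M "-1" n] by simp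
  then show ?thesis by (simp add: tn_part_def tproj_uminus linear_neg[OF linear_tproj])
qed

lemma linear_frestrict: "linear (frestrict F :: ('a \<Rightarrow> 'b::real_vector) \<Rightarrow> 'a \<Rightarrow> 'b)"
  by (rule linearI) (auto simp: frestrict_def fun_eq_iff)

lemma subspace_tangential: "subspace {w :: real^'n. w \<bullet> \<nu> = 0}"
  by (auto intro!: subspaceI simp: inner_add_left)

lemma subspace_skew_facet: "subspace (skew_facet \<nu>)"
proof -
  have "skew_facet \<nu> = skew_matrices \<inter> {A. A *v \<nu> = 0}" by (auto simp: skew_facet_def)
  then show ?thesis
    using subspace_inter[OF subspace_skew linear_subspace_kernel[OF linear_mat_vec]] by simp
qed

lemma subspace_rotations: "subspace {\<lambda>x. A *v xF nF F x | A. A \<in> skew_facet \<nu>}"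
proof -
  have "{\<lambda>x. A *v xF nF F x | A. A \<in> skew_facet \<nu>} = (\<lambda>A x. A *v xF nF F x) ` skew_facet \<nu>" by auto
  moreover have "linear (\<lambda>A x. A *v xF nF F x)"
    by (rule linearI) (simp_all add: fun_eq_iff matrix_vector_mult_add_rdistrib scaleR_matrix_vector_assoc)
  ultimately show ?thesis using linear_subspace_image[OF _ subspace_skew_facet] by simp
qed

lemma subspace_Rt: "subspace (Rt nF k F)"
  unfolding Rt_def
  by (intro linear_subspace_image[OF linear_frestrict])
    (simp add: subspace_fplus subspace_Poly subspace_tangential subspace_rotations)

lemma Poly_id: "(\<lambda>x. x) \<in> Poly 1 (UNIV :: (real^'n) set)"
proof -
  have one: "(\<lambda>x :: real^'n. 1 :: real) \<in> Poly 0 UNIV" by (rule Poly_const[OF subspace_UNIV UNIV_I])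
  have "(\<lambda>x :: real^'n. x $ i) \<in> Poly 1 UNIV" for i
    using Poly_coord[OF subspace_UNIV one, of i] by simp
  from Poly_vec_lambda[of "\<lambda>x i. x $ i", OF this] show ?thesis by simp
qed

lemma Poly_xF: "xF nF F \<in> Poly 1 UNIV"
proof -
  have "(\<lambda>x. 1 *\<^sub>R x + (-1) *\<^sub>R barycenter F) \<in> Poly 1 UNIV"
    unfolding scaleR_one
    by (intro Poly_add Poly_id subspace_UNIV Poly_const) simp
  then have "(\<lambda>x. tproj (nF F) (1 *\<^sub>R x + (-1) *\<^sub>R barycenter F)) \<in> Poly 1 UNIV"
    by (rule Poly_map[OF linear_tproj UNIV_I])
  then show ?thesis by (simp add: xF_def[abs_def])
qed

text \<open>The rigid rotations in the lowest-order facet space are affine and tangential, so all facet spaces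
  consist of tangential polynomials.\<close>
lemma Rt_Poly: "Rt nF k F \<subseteq> frestrict F ` Poly (k + 1) {w. w \<bullet> nF F = 0}"
proof -
  have S: "subspace {w. w \<bullet> nF F = 0}" by (rule subspace_tangential)
  have "(\<lambda>x. A *v xF nF F x) \<in> Poly 1 {w. w \<bullet> nF F = 0}" if A: "A \<in> skew_facet (nF F)" for A
  proof (rule Poly_map[OF _ _ Poly_xF])
    show "linear ((*v) A)" by simp
    have "(A *v w) \<bullet> nF F = 0" for w
      using skew_inner[of A "nF F" w] A by (simp add: skew_facet_def inner_commute)
    then show "A *v w \<in> {w. w \<bullet> nF F = 0}" for w by simp
  qed
  moreover have "Poly 0 {w. w \<bullet> nF F = 0} \<subseteq> Poly 1 {w. w \<bullet> nF F = 0}" using Poly_mono[OF S] by blast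
  ultimately have "fplus (Poly 0 {w. w \<bullet> nF F = 0}) {\<lambda>x. A *v xF nF F x | A. A \<in> skew_facet (nF F)} \<subseteq> Poly 1 {w. w \<bullet> nF F = 0}"
    using subspace_add[OF subspace_Poly[OF S]] unfolding fplus_eq by blast
  moreover have "Poly k {w. w \<bullet> nF F = 0} \<subseteq> Poly (k + 1) {w. w \<bullet> nF F = 0}"
    using Poly_mono[OF S le_add1 subset_refl] by blast
  ultimately show ?thesis unfolding Rt_def by (cases "k = 0") auto
qed

lemma facet_fun_frestrict:
  assumes "closed F" "continuous_on UNIV p"
  shows "facet_fun F (frestrict F p)"
proof -
  have "frestrict F p = (\<lambda>x. indicator F x *\<^sub>R p x)" by (auto simp: frestrict_def fun_eq_iff)
  moreover have "(\<lambda>x. indicator F x *\<^sub>R p x) \<in> borel_measurable borel"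
    using assms by (intro borel_measurable_scaleR borel_measurable_indicator borel_measurable_continuous_onI) auto
  moreover have "continuous_on F (frestrict F p)"
    using continuous_on_subset[OF assms(2), of F] by (rule continuous_on_eq) (auto simp: frestrict_def)
  ultimately show ?thesis by (simp add: facet_fun_def)
qed

lemma facet_fun_continuous: "continuous_on UNIV p \<Longrightarrow> facet_fun F p"
  unfolding facet_fun_def using borel_measurable_continuous_onI continuous_on_subset[of UNIV p F] by blast

lemma facet_fun_Rt:
  assumes "closed F" "r \<in> Rt nF k F" shows "facet_fun F r"
proof -
  obtain p where "r = frestrict F p" "p \<in> Poly (k + 1) {w. w \<bullet> nF F = 0}" using assms(2) Rt_Poly by blast
  then show ?thesis using facet_fun_frestrict[OF assms(1)] Poly_continuous[OF subspace_tangential] by blast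
qed

lemma Rt_outside: "r \<in> Rt nF k F \<Longrightarrow> x \<notin> F \<Longrightarrow> r x = 0"
  by (auto simp: Rt_def frestrict_def)

lemma fin_dim_Rt: "fin_dim (Rt nF k F)"
  by (rule fin_dim_subset[OF fin_dim_linear_image[OF linear_frestrict fin_dim_Poly] Rt_Poly])

section \<open>Bubbles and weak symmetry\<close>

context cell begin

definition bary_pos :: "(real^'n) set" where
  "bary_pos = {x. \<forall>v\<in>verts T. 0 < bary T v x}"

lemma bary_pos: "open bary_pos" "bary_pos \<noteq> {}" "bary_pos \<subseteq> interior T" "bary_pos \<subseteq> T"
proof -
  have "bary_pos = (\<Inter>v\<in>verts T. {x. 0 < bary T v x})" by (auto simp: bary_pos_def)
  moreover have "open (\<Inter>v\<in>verts T. {x. 0 < bary T v x})"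
    using verts_props(1) by (intro open_INT) (auto intro!: open_Collect_less continuous_bary)
  ultimately show "open bary_pos" by simp
  show "bary_pos \<noteq> {}" using positive_point by (auto simp: bary_pos_def)
  show "bary_pos \<subseteq> interior T" using interior_pos by (auto simp: bary_pos_def)
  then show "bary_pos \<subseteq> T" using interior_subset by blast
qed

lemma Poly_zero_if_l2_zero:
  fixes p :: "real^'n \<Rightarrow> 'b::euclidean_space"
  assumes p: "p \<in> Poly m UNIV" and z: "l2i (lebesgue_on T) p p = 0"
  shows "p = (\<lambda>x. 0)"
proof (rule Poly_zero_on_open[OF subspace_UNIV p bary_pos(1,2)])
  fix x assume "x \<in> bary_pos"
  have "continuous_on T (\<lambda>x. p x \<bullet> p x)"
    by (intro continuous_intros Poly_continuous[OF subspace_UNIV p])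
  then have "p x \<bullet> p x = 0"
    using integral_zero_on_interior[of T "\<lambda>x. p x \<bullet> p x" x] compact_cell z bary_pos \<open>x \<in> bary_pos\<close> by (auto simp: l2i_def)
  then show "p x = 0" by simp
qed

lemma Poly_bary_mult:
  assumes "subspace X" "p \<in> Poly m X" "v \<in> verts T"
  shows "(\<lambda>x. bary T v x *\<^sub>R p x) \<in> Poly (m + 1) X"
proof -
  have "(\<lambda>x. bary T v x *\<^sub>R p x) = (\<lambda>x. (bgrad T v \<bullet> x + bary T v 0) *\<^sub>R p x)"
    by (intro ext) (simp only: bary_eq[OF assms(3), symmetric])
  then show ?thesis using Poly_affine_mult[OF assms(1,2)] by simp
qed

text \<open>The component of a matrix along the gradient at \<open>b\<close> and the edge from \<open>a\<close> to \<open>b\<close>. These components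
  determine a skew matrix.\<close>
definition edge_coeff :: "real^'n \<Rightarrow> real^'n \<Rightarrow> real^'n^'n \<Rightarrow> real" where
  "edge_coeff a b Q = bgrad T b \<bullet> (Q *v (b - a))"

text \<open>The tangential-normal part of \<open>dev (outer (bgrad T b) (b - a))\<close> vanishes on every facet except the one
  opposite to \<open>a\<close>, where the factor \<open>bary T a\<close> vanishes: on the facet opposite to \<open>b\<close> the gradient is
  normal, and the edge is tangential to the others. The coefficients are chosen so that the inner
  product of the bubble of \<open>q\<close> with \<open>q\<close> is a sum of weighted squares.\<close>
definition bubble :: "(real^'n \<Rightarrow> real^'n^'n) \<Rightarrow> real^'n \<Rightarrow> real^'n^'n" where
  "bubble q x = (\<Sum>b\<in>verts T. \<Sum>a\<in>verts T - {b}.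
     bary T a x *\<^sub>R edge_coeff a b (q x) *\<^sub>R dev (outer (bgrad T b) (b - a)))"

lemma linear_edge_coeff: "linear (edge_coeff a b)"
  unfolding edge_coeff_def
  by (rule linearI) (simp_all add: matrix_vector_mult_add_rdistrib inner_add_right flip: scaleR_matrix_vector_assoc)

lemma bubble_Poly:
  assumes q: "q \<in> Poly k UNIV" shows "bubble q \<in> Poly (k + 1) traceless_matrices"
  unfolding bubble_def
proof (intro Poly_sum subspace_traceless Poly_bary_mult)
  fix a b
  have "linear (\<lambda>Q. edge_coeff a b Q *\<^sub>R dev (outer (bgrad T b) (b - a)))"
    by (rule linearI) (simp_all add: linear_add[OF linear_edge_coeff] linear_scale[OF linear_edge_coeff] scaleR_add_left)
  then show "(\<lambda>x. edge_coeff a b (q x) *\<^sub>R dev (outer (bgrad T b) (b - a))) \<in> Poly k traceless_matrices"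
    by (rule Poly_map[OF _ _ q]) (intro subspace_scale subspace_traceless dev_traceless)
qed auto

lemma normal_inner_edge:
  assumes "l \<in> verts T" "n = s *\<^sub>R bgrad T l" "a \<in> verts T" "b \<in> verts T"
  shows "(b - a) \<bullet> n = s * ((if b = l then 1 else 0) - (if a = l then 1 else 0))"
  using bgrad_edge[OF assms(1,3,4)] by (simp add: assms(2) inner_commute)

lemma tproj_bgrad:
  assumes "norm n = 1" "n = s *\<^sub>R bgrad T l" shows "tproj n (bgrad T l) = 0"
proof -
  have "s \<noteq> 0" using assms by auto
  then have "bgrad T l = (1 / s) *\<^sub>R n" using assms by simp
  then show ?thesis by (simp only: linear_scale[OF linear_tproj] tproj_self[OF assms(1)] scaleR_zero_right)
qed

lemma bubble_trace:
  assumes l: "l \<in> verts T" and x: "x \<in> opp T l" and n: "norm n = 1" "n = s *\<^sub>R bgrad T l"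
  shows "tn_part n (bubble q x) = 0"
proof -
  have "tn_part n (bary T a x *\<^sub>R edge_coeff a b (q x) *\<^sub>R dev (outer (bgrad T b) (b - a))) = 0"
    if "b \<in> verts T" "a \<in> verts T - {b}" for a b
  proof -
    have "bary T a x *\<^sub>R ((b - a) \<bullet> n) *\<^sub>R tproj n (bgrad T b) = 0"
      using normal_inner_edge[OF l n(2), of a b] that opp_iff[OF l, of x] x tproj_bgrad[OF n]
      by (cases "b = l"; cases "a = l") auto
    then show ?thesis
      by (simp only: linear_scale[OF linear_tn] tn_dev_outer[OF n(1)]) (auto simp: scaleR_left_commute)
  qed
  then show ?thesis unfolding bubble_def
    by (simp add: linear_sum[OF linear_tn])
qed

lemma out_normal_scaled:
  assumes "l \<in> verts T" obtains s where "out_normal T (opp T l) = s *\<^sub>R bgrad T l"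
  using out_normal_opp[OF assms] by blast

lemma Btn_alt: "Btn m T = {\<tau> \<in> Poly m traceless_matrices. \<forall>l\<in>verts T. \<forall>x\<in>opp T l. tn_part (out_normal T (opp T l)) (\<tau> x) = 0}"
  unfolding Btn_def facets_of_eq tn_part_def by auto

lemma subspace_Btn: "subspace (Btn m T)"
proof (rule subspaceI)
  note S = subspace_Poly[OF subspace_traceless]
  show "0 \<in> Btn m T" unfolding Btn_alt using subspace_0[OF S] by (auto simp: linear_0[OF linear_tn])
  show "x + y \<in> Btn m T" if "x \<in> Btn m T" "y \<in> Btn m T" for x y
    using that subspace_add[OF S] unfolding Btn_alt by (auto simp: linear_add[OF linear_tn])
  show "c *\<^sub>R x \<in> Btn m T" if "x \<in> Btn m T" for c x
    using that subspace_scale[OF S] unfolding Btn_alt by (auto simp: linear_scale[OF linear_tn])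
qed

lemma bubble_Btn: "q \<in> Poly k UNIV \<Longrightarrow> bubble q \<in> Btn (k + 1) T"
proof -
  assume q: "q \<in> Poly k UNIV"
  have "tn_part (out_normal T (opp T l)) (bubble q x) = 0" if l: "l \<in> verts T" "x \<in> opp T l" for l x
  proof -
    obtain s where "out_normal T (opp T l) = s *\<^sub>R bgrad T l" by (rule out_normal_scaled[OF l(1)])
    then show ?thesis by (rule bubble_trace[OF l norm_out_normal[OF l(1)]])
  qed
  then show ?thesis unfolding Btn_alt using bubble_Poly[OF q] by simp
qed

lemma bubble_inner:
  assumes "Q \<in> skew_matrices"
  shows "bubble q x \<bullet> Q = (\<Sum>b\<in>verts T. \<Sum>a\<in>verts T - {b}. bary T a x * (edge_coeff a b (q x) * edge_coeff a b Q))"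
  unfolding bubble_def using assms
  by (simp add: inner_sum_left inner_dev_skew inner_outer edge_coeff_def mult.assoc)

text \<open>By skew symmetry \<open>Q\<close> maps each gradient to a vector that is orthogonal to all edges at a vertex, and
  the gradients span the space.\<close>
lemma zero_if_edge_coeffs_zero:
  assumes Q: "Q \<in> skew_matrices" and z: "\<And>a b. b \<in> verts T \<Longrightarrow> a \<in> verts T - {b} \<Longrightarrow> edge_coeff a b Q = 0"
  shows "Q = 0"
proof -
  have Qg: "Q *v bgrad T b = 0" if b: "b \<in> verts T" for b
  proof (rule zero_if_edges_orthogonal[OF b])
    fix a assume a: "a \<in> verts T" "a \<noteq> b"
    have "bgrad T b \<bullet> (Q *v (b - a)) = 0" using z[OF b, of a] a by (simp add: edge_coeff_def)
    then have "(Q *v bgrad T b) \<bullet> (b - a) = 0" using skew_inner[OF Q] by simp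
    then show "(Q *v bgrad T b) \<bullet> (a - b) = 0" by (simp add: inner_diff_right)
  qed
  have "Q *v w = 0" for w
  proof -
    have "Q *v w = Q *v (\<Sum>v\<in>verts T. (v \<bullet> w) *\<^sub>R bgrad T v)" by (simp add: bgrad_dual)
    also have "\<dots> = (\<Sum>v\<in>verts T. (v \<bullet> w) *\<^sub>R (Q *v bgrad T v))"
      by (simp add: linear_sum[OF matrix_vector_mul_linear] linear_scale[OF matrix_vector_mul_linear])
    finally show ?thesis using Qg by simp
  qed
  then show ?thesis by (simp add: matrix_eq)
qed

text \<open>The form \<open>(bubble q, q')\<close> on skew polynomials is symmetric and definite, hence some bubble cancels
  the moments of \<open>\<sigma>\<close> against skew polynomials, and it leaves the tangential-normal traces unchanged.\<close>
lemma weak_symmetry_correction: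
  assumes \<sigma>: "\<sigma> \<in> Poly m UNIV"
  shows "\<exists>\<beta>\<in>Btn (k + 1) T. \<forall>q\<in>Poly k skew_matrices. l2i (lebesgue_on T) (\<lambda>x. \<sigma> x + \<beta> x) q = 0"
proof -
  let ?W = "Poly k skew_matrices :: (real^'n \<Rightarrow> real^'n^'n) set"
  let ?M = "lebesgue_on T"
  let ?A = "\<lambda>q q'. l2i ?M (bubble q) q'"
  have sub: "subspace ?W" by (rule subspace_Poly[OF subspace_skew])
  have qU: "q \<in> Poly k UNIV" if "q \<in> ?W" for q using Poly_mono[OF subspace_UNIV _ _ that, of k] by simp
  have skew: "q x \<in> skew_matrices" if "q \<in> ?W" for q x
    using PolyE[OF that] subspace_sum[OF subspace_skew] subspace_scale[OF subspace_skew] by (metis (no_types, lifting))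
  have cq: "continuous_on T q" if "q \<in> ?W" for q by (rule Poly_continuous[OF subspace_skew that])
  have cb: "continuous_on T (bubble q)" if "q \<in> ?W" for q
    by (rule Poly_continuous[OF subspace_traceless bubble_Poly[OF qU[OF that]]])
  have cs: "continuous_on T \<sigma>" by (rule Poly_continuous[OF subspace_UNIV \<sigma>])
  have sym: "?A q q' = ?A q' q" if "q \<in> ?W" "q' \<in> ?W" for q q'
    unfolding l2i_def bubble_inner[OF skew[OF that(1)]] bubble_inner[OF skew[OF that(2)]]
    by (simp add: mult.commute)
  have lr: "lin_on ?W (?A q)" if "q \<in> ?W" for q
    using l2i_lincomb_compact(2)[OF compact_cell cq cq cb] that
    by (intro lin_onI) (simp add: plus_fun_def scaleR_fun_def)
  have bil: "bilin_on ?W ?A" unfolding bilin_on_def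
  proof (intro ballI conjI)
    fix q assume q: "q \<in> ?W"
    show "lin_on ?W (?A q)" by (rule lr[OF q])
    show "lin_on ?W (\<lambda>y. ?A y q)"
    proof (rule lin_onI)
      fix x y a b assume xy: "x \<in> ?W" "y \<in> ?W"
      have "a *\<^sub>R x + b *\<^sub>R y \<in> ?W" using sub xy by (intro subspace_add subspace_scale)
      then show "?A (a *\<^sub>R x + b *\<^sub>R y) q = a * ?A x q + b * ?A y q"
        using lin_onD[OF lr[OF q] xy, of a b] sym q xy by simp
    qed
  qed
  have nondeg: "q = 0" if q: "q \<in> ?W" and z: "\<And>y. y \<in> ?W \<Longrightarrow> ?A q y = 0" for q
  proof -
    have e: "bubble q x \<bullet> q x = (\<Sum>b\<in>verts T. \<Sum>a\<in>verts T - {b}. bary T a x * (edge_coeff a b (q x))\<^sup>2)" for x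
      using bubble_inner[OF skew[OF q], of q x x] by (simp add: power2_eq_square)
    have c: "continuous_on T (\<lambda>x. bubble q x \<bullet> q x)" by (intro continuous_intros cb cq q)
    have nn: "0 \<le> bubble q x \<bullet> q x" if "x \<in> T" for x
      unfolding e using that mem_iff by (intro sum_nonneg mult_nonneg_nonneg) auto
    have i: "integral\<^sup>L ?M (\<lambda>x. bubble q x \<bullet> q x) = 0" using z[OF q] by (simp add: l2i_def)
    have "q = (\<lambda>x. 0)"
    proof (rule Poly_zero_on_open[OF subspace_skew q bary_pos(1,2)])
      fix x assume x: "x \<in> bary_pos"
      have "bubble q x \<bullet> q x = 0" using integral_zero_on_interior[OF compact_cell c nn i] bary_pos(3) x by blast
      then have s: "(\<Sum>b\<in>verts T. \<Sum>a\<in>verts T - {b}. bary T a x * (edge_coeff a b (q x))\<^sup>2) = 0" by (simp add: e)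
      have p: "0 < bary T a x" if "a \<in> verts T" for a using x that by (simp add: bary_pos_def)
      have nn2: "0 \<le> bary T a x * (edge_coeff a b (q x))\<^sup>2" if "a \<in> verts T" for a b using p[OF that] by simp
      show "q x = 0"
      proof (rule zero_if_edge_coeffs_zero[OF skew[OF q]])
        fix a b assume ab: "b \<in> verts T" "a \<in> verts T - {b}"
        have "(\<Sum>a\<in>verts T - {b}. bary T a x * (edge_coeff a b (q x))\<^sup>2) = 0"
          using s ab verts_props(1) nn2 by (subst (asm) sum_nonneg_eq_0_iff) (auto intro!: sum_nonneg)
        then have "bary T a x * (edge_coeff a b (q x))\<^sup>2 = 0"
          using ab verts_props(1) nn2 by (subst (asm) sum_nonneg_eq_0_iff) auto
        then show "edge_coeff a b (q x) = 0" using p[of a] ab by simp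
      qed
    qed
    then show ?thesis by (simp add: zero_fun_def)
  qed
  have "lin_on ?W (\<lambda>q. - l2i ?M \<sigma> q)"
    using l2i_lincomb_compact(2)[OF compact_cell cq cq cs]
    by (intro lin_onI) (simp add: plus_fun_def scaleR_fun_def)
  from symmetric_form_represents[OF sub fin_dim_Poly bil sym nondeg this]
  obtain q where q: "q \<in> ?W" "\<forall>y\<in>?W. ?A q y = - l2i ?M \<sigma> y" by blast
  have "l2i ?M (\<lambda>x. \<sigma> x + bubble q x) y = 0" if y: "y \<in> ?W" for y
    using l2i_lincomb_compact(1)[OF compact_cell cs cb[OF q(1)] cq[OF y], of 1 1] q(2) y by simp
  then show ?thesis using bubble_Btn[OF qU[OF q(1)]] by blast
qed

end

section \<open>Local stresses with prescribed traces\<close>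

text \<open>One cell with facet normals that agree with its outward normals up to sign.\<close>
locale stress_cell = cell T for T :: "(real^'n) set" +
  fixes nF :: "(real^'n) set \<Rightarrow> real^'n" and j :: "(real^'n) set \<Rightarrow> real^'n \<Rightarrow> real^'n"
  assumes nF_cases: "\<And>l. l \<in> verts T \<Longrightarrow> nF (opp T l) = out_normal T (opp T l) \<or> nF (opp T l) = - out_normal T (opp T l)"
    and j: "\<And>l. l \<in> verts T \<Longrightarrow> j T l \<in> verts T - {l}"
begin

lemma normE:
  assumes l: "l \<in> verts T"
  obtains s where "s \<noteq> 0" "nF (opp T l) = s *\<^sub>R bgrad T l"
proof -
  obtain s where s: "out_normal T (opp T l) = s *\<^sub>R bgrad T l" by (rule out_normal_scaled[OF l])
  have "s \<noteq> 0" using s norm_out_normal[OF l] by auto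
  then show ?thesis using nF_cases[OF l] s that[of s] that[of "- s"] by auto
qed

lemma norm_nF: "l \<in> verts T \<Longrightarrow> norm (nF (opp T l)) = 1"
  using nF_cases[of l] norm_out_normal[of l] by auto

text \<open>The matrix with prescribed tangential-normal part \<open>w\<close>, up to a factor, on the facet opposite to \<open>l\<close> and
  zero on the other facets. With \<open>w\<close> a rotation of the facet, it is the field \<open>Efun\<close>.\<close>
definition lift :: "real^'n \<Rightarrow> real^'n \<Rightarrow> real^'n^'n" where
  "lift l w = (\<Sum>i\<in>verts T - {l, j T l}. ((j T l - i) \<bullet> w) *\<^sub>R dev (outer (bgrad T i) (l - i)))"

lemma linear_lift: "linear (lift l)"
  unfolding lift_def
  by (rule linearI) (simp_all add: inner_add_right scaleR_add_left sum.distrib scaleR_sum_right)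

lemma lift_traceless: "lift l w \<in> traceless_matrices"
  unfolding lift_def by (intro subspace_sum subspace_scale subspace_traceless dev_traceless)

lemma Efun_lift: "l \<in> verts T \<Longrightarrow> Efun nF j T l A x = lift l (A *v xF nF (opp T l) x)"
  unfolding Efun_def lift_def tvec_def by (intro sum.cong refl) (simp add: grad_bary)

lemma lift_trace_other:
  assumes l: "l \<in> verts T" and m: "m \<in> verts T" "m \<noteq> l"
  shows "tn_part (nF (opp T m)) (lift l w) = 0"
proof -
  obtain s where s: "nF (opp T m) = s *\<^sub>R bgrad T m" using normE[OF m(1)] by blast
  have "((l - i) \<bullet> nF (opp T m)) *\<^sub>R tproj (nF (opp T m)) (bgrad T i) = 0" if "i \<in> verts T - {l, j T l}" for i
    using normal_inner_edge[OF m(1) s, of i l] tproj_bgrad[OF norm_nF[OF m(1)] s] that l m by (cases "i = m") auto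
  then have "((j T l - i) \<bullet> w) *\<^sub>R (((l - i) \<bullet> nF (opp T m)) *\<^sub>R tproj (nF (opp T m)) (bgrad T i)) = 0"
    if "i \<in> verts T - {l, j T l}" for i using that by simp
  then show ?thesis
    unfolding lift_def linear_sum[OF linear_tn] linear_scale[OF linear_tn] tn_dev_outer[OF norm_nF[OF m(1)]]
    by (intro sum.neutral ballI)
qed

text \<open>Every edge \<open>l - i\<close> has the same normal component on the facet opposite to \<open>l\<close>. What remains is the
  expansion of \<open>w\<close> in the gradients, from which the term of \<open>l\<close> drops out because its gradient is normal.\<close>
lemma lift_trace:
  assumes l: "l \<in> verts T" and s: "nF (opp T l) = s *\<^sub>R bgrad T l" and w: "w \<bullet> nF (opp T l) = 0"
  shows "tn_part (nF (opp T l)) (lift l w) = (- s) *\<^sub>R w"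
proof -
  let ?n = "nF (opp T l)" and ?j = "j T l"
  note lin = linear_tproj[of ?n]
  have jl: "?j \<in> verts T" "?j \<noteq> l" using j[OF l] by auto
  have "tn_part ?n (lift l w) = (\<Sum>i\<in>verts T - {l, ?j}. (((?j - i) \<bullet> w) * s) *\<^sub>R tproj ?n (bgrad T i))"
    unfolding lift_def
    using normal_inner_edge[OF l s] l
    by (simp add: linear_sum[OF linear_tn] linear_scale[OF linear_tn] tn_dev_outer[OF norm_nF[OF l]])
  also have "\<dots> = (\<Sum>i\<in>verts T. (((?j - i) \<bullet> w) * s) *\<^sub>R tproj ?n (bgrad T i))"
    by (rule sum.mono_neutral_left) (use verts_props(1) tproj_bgrad[OF norm_nF[OF l] s] in auto)
  also have "\<dots> = (- s) *\<^sub>R tproj ?n (\<Sum>i\<in>verts T. ((i - ?j) \<bullet> w) *\<^sub>R bgrad T i)"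
    unfolding linear_sum[OF lin] linear_scale[OF lin] scaleR_sum_right
    by (rule sum.cong[OF refl]) (simp add: inner_diff_left algebra_simps)
  also have "\<dots> = (- s) *\<^sub>R w" unfolding bgrad_dual_from using w by (simp add: tproj_eq inner_commute)
  finally show ?thesis .
qed

definition base_space :: "nat \<Rightarrow> (real^'n \<Rightarrow> real^'n^'n) set" where
  "base_space k = (if k = 0 then P0_plus nF j T else Poly k traceless_matrices)"

lemma Sigma_plus_alt: "Sigma_plus nF j k T =
  {\<tau> \<in> fplus (base_space k) (Btn (k + 1) T). \<forall>q\<in>Poly k skew_matrices. l2i (lebesgue_on T) \<tau> q = 0}"
  unfolding Sigma_plus_def base_space_def ..

lemma Efun_Poly: "l \<in> verts T \<Longrightarrow> Efun nF j T l A \<in> Poly 1 traceless_matrices"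
proof -
  assume l: "l \<in> verts T"
  have "linear (\<lambda>w. lift l (A *v w))"
    using linear_compose[OF matrix_vector_mul_linear linear_lift] by (simp add: o_def)
  then have "(\<lambda>x. lift l (A *v xF nF (opp T l) x)) \<in> Poly 1 traceless_matrices"
    by (rule Poly_map[OF _ _ Poly_xF]) (rule lift_traceless)
  then show ?thesis by (simp add: Efun_lift[OF l, abs_def])
qed

lemma base_space: "subspace (base_space k)" "base_space k \<subseteq> Poly (k + 1) traceless_matrices"
proof -
  note S = subspace_Poly[OF subspace_traceless]
  show "subspace (base_space k)"
    unfolding base_space_def P0_plus_def fspan_eq by (simp add: subspace_fplus S subspace_span)
  have "span {Efun nF j T l A | l A. l \<in> verts T \<and> A \<in> skew_facet (nF (opp T l))} \<subseteq> Poly 1 traceless_matrices"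
    by (rule span_minimal[OF _ S]) (use Efun_Poly in blast)
  moreover have "Poly 0 traceless_matrices \<subseteq> Poly 1 (traceless_matrices :: (real^'n^'n) set)"
    using Poly_mono[OF subspace_traceless] by blast
  ultimately have "P0_plus nF j T \<subseteq> Poly 1 traceless_matrices"
    unfolding P0_plus_def fspan_eq fplus_eq using subspace_add[OF S] by blast
  then show "base_space k \<subseteq> Poly (k + 1) traceless_matrices"
    unfolding base_space_def using Poly_mono[OF subspace_traceless, of k "k + 1" traceless_matrices] by auto
qed

lemma Sigma_plus_Poly: "Sigma_plus nF j k T \<subseteq> Poly (k + 1) traceless_matrices"
proof -
  have "Btn (k + 1) T \<subseteq> Poly (k + 1) traceless_matrices" by (auto simp: Btn_alt)
  then show ?thesis unfolding Sigma_plus_alt fplus_eq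
    using base_space(2) subspace_add[OF subspace_Poly[OF subspace_traceless]] by blast
qed

lemma subspace_Sigma_plus: "subspace (Sigma_plus nF j k T)"
proof -
  have F: "subspace (fplus (base_space k) (Btn (k + 1) T))" by (intro subspace_fplus base_space subspace_Btn)
  have P: "fplus (base_space k) (Btn (k + 1) T) \<subseteq> Poly (k + 1) traceless_matrices"
    unfolding fplus_eq Btn_alt using base_space(2) subspace_add[OF subspace_Poly[OF subspace_traceless]] by blast
  have lin: "l2i (lebesgue_on T) (a *\<^sub>R x + b *\<^sub>R y) q = a * l2i (lebesgue_on T) x q + b * l2i (lebesgue_on T) y q"
    if "x \<in> fplus (base_space k) (Btn (k + 1) T)" "y \<in> fplus (base_space k) (Btn (k + 1) T)" "q \<in> Poly k skew_matrices" for x y a b q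
    using l2i_lincomb_compact(1)[OF compact_cell Poly_continuous[OF subspace_traceless] Poly_continuous[OF subspace_traceless] Poly_continuous[OF subspace_skew that(3)], of x "k + 1" y "k + 1" a b] that P
    by (auto simp: plus_fun_def scaleR_fun_def)
  show ?thesis
  proof (rule subspaceI)
    show "0 \<in> Sigma_plus nF j k T" unfolding Sigma_plus_alt using subspace_0[OF F] by (auto simp: l2i_def)
    show "x + y \<in> Sigma_plus nF j k T" if "x \<in> Sigma_plus nF j k T" "y \<in> Sigma_plus nF j k T" for x y
      using that subspace_add[OF F] lin[of x y _ 1 1] unfolding Sigma_plus_alt by auto
    show "c *\<^sub>R x \<in> Sigma_plus nF j k T" if "x \<in> Sigma_plus nF j k T" for c x
      using that subspace_scale[OF F] lin[of x x _ c 0] unfolding Sigma_plus_alt by auto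
  qed
qed

lemma Btn_trace: 
  assumes "\<beta> \<in> Btn m T" "l \<in> verts T" "x \<in> opp T l" shows "tn_part (nF (opp T l)) (\<beta> x) = 0"
proof -
  have "tn_part (out_normal T (opp T l)) (\<beta> x) = 0" using assms by (auto simp: Btn_alt)
  then show ?thesis using nF_cases[OF assms(2)] tn_uminus[of "out_normal T (opp T l)" "\<beta> x"] by auto
qed

lemma skew_facet_tangential: "A \<in> skew_facet n \<Longrightarrow> (A *v w) \<bullet> n = 0"
  using skew_inner[of A n w] by (simp add: skew_facet_def inner_commute)

text \<open>Facet bubbles have no trace, polynomials of degree \<open>k\<close> have polynomial traces, and in the lowest-order
  case the additional fields are lifts of rotations of a single facet.\<close>
lemma trace_in_Rt:
  assumes \<tau>: "\<tau> \<in> Sigma_plus nF j k T" and l: "l \<in> verts T"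
  shows "frestrict (opp T l) (\<lambda>x. tn_part (nF (opp T l)) (\<tau> x)) \<in> Rt nF k (opp T l)"
proof -
  let ?F = "opp T l" let ?n = "nF ?F"
  define TR where "TR \<sigma> = frestrict ?F (\<lambda>x. tn_part ?n (\<sigma> x))" for \<sigma>
  have lin: "linear TR"
    by (rule linearI) (auto simp: TR_def frestrict_def fun_eq_iff linear_add[OF linear_tn] linear_scale[OF linear_tn])
  define S where "S = {\<sigma>. TR \<sigma> \<in> Rt nF k ?F}"
  have S: "subspace S" unfolding S_def
    using subspace_Rt[of nF k ?F] by (auto intro!: subspaceI simp: linear_0[OF lin] linear_add[OF lin] linear_scale[OF lin] subspace_0 subspace_add subspace_scale)
  have tang: "tn_part ?n M \<bullet> ?n = 0" for M unfolding tn_part_def by (rule tproj_tangential[OF norm_nF[OF l]])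
  have B: "Btn (k + 1) T \<subseteq> S"
  proof
    fix \<beta> assume "\<beta> \<in> Btn (k + 1) T"
    then have "TR \<beta> = 0" using Btn_trace[OF _ l] by (auto simp: TR_def frestrict_def fun_eq_iff)
    then show "\<beta> \<in> S" using subspace_0[OF subspace_Rt] by (simp add: S_def)
  qed
  have Pk: "(\<lambda>x. tn_part ?n (\<sigma> x)) \<in> Poly k {w. w \<bullet> ?n = 0}" if "\<sigma> \<in> Poly k traceless_matrices" for \<sigma>
    by (rule Poly_map[OF linear_tn _ that]) (simp add: tang)
  have "base_space k \<subseteq> S"
  proof (cases "k = 0")
    case False
    then show ?thesis using Pk unfolding base_space_def S_def TR_def Rt_def by auto
  next
    case True
    have Z: "(\<lambda>x. 0) \<in> Poly 0 {w. w \<bullet> ?n = 0}" using Poly_const[OF subspace_tangential, of 0] by simp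
    have R0: "frestrict ?F (\<lambda>x. a x + b x) \<in> Rt nF k ?F" if "a \<in> Poly 0 {w. w \<bullet> ?n = 0}" "b \<in> {\<lambda>x. A *v xF nF ?F x | A. A \<in> skew_facet ?n}" for a b
    proof -
      have "(\<lambda>x. a x + b x) \<in> fplus (Poly 0 {w. w \<bullet> ?n = 0}) {\<lambda>x. A *v xF nF ?F x | A. A \<in> skew_facet ?n}"
        unfolding fplus_def mem_Collect_eq using that by (intro exI[of _ a] exI[of _ b] conjI refl) simp_all
      then show ?thesis using True unfolding Rt_def by simp
    qed
    have rot0: "(\<lambda>x. 0) \<in> {\<lambda>x. A *v xF nF ?F x | A. A \<in> skew_facet ?n}"
      using subspace_0[OF subspace_rotations] by (simp add: zero_fun_def)
    have "Poly 0 traceless_matrices \<subseteq> S"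
    proof
      fix \<sigma> :: "real^'n \<Rightarrow> real^'n^'n" assume "\<sigma> \<in> Poly 0 traceless_matrices"
      then have "(\<lambda>x. tn_part ?n (\<sigma> x)) \<in> Poly 0 {w. w \<bullet> ?n = 0}" using Pk[of \<sigma>] True by simp
      then show "\<sigma> \<in> S" using R0[OF _ rot0] by (simp add: S_def TR_def)
    qed
    moreover have "Efun nF j T m A \<in> S" if m: "m \<in> verts T" and A: "A \<in> skew_facet (nF (opp T m))" for m A
    proof (cases "m = l")
      case False
      then have "TR (Efun nF j T m A) = 0"
        using lift_trace_other[OF m l] by (auto simp: TR_def frestrict_def fun_eq_iff Efun_lift[OF m])
      then show ?thesis using subspace_0[OF subspace_Rt] by (simp add: S_def)
    next
      case True
      obtain s where s: "nF (opp T l) = s *\<^sub>R bgrad T l" using normE[OF l] by blast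
      have A': "A \<in> skew_facet ?n" using A True by simp
      have "TR (Efun nF j T m A) = frestrict ?F (\<lambda>x. 0 + ((- s) *\<^sub>R A) *v xF nF ?F x)"
        using lift_trace[OF l s skew_facet_tangential[OF A']] True
        by (auto simp: TR_def frestrict_def fun_eq_iff Efun_lift[OF l] scaleR_matrix_vector_assoc)
      also have "\<dots> \<in> Rt nF k ?F"
        by (rule R0[OF Z]) (use subspace_scale[OF subspace_skew_facet A', of "- s"] in blast)
      finally show ?thesis by (simp add: S_def)
    qed
    then have "span {Efun nF j T l A | l A. l \<in> verts T \<and> A \<in> skew_facet (nF (opp T l))} \<subseteq> S"
      by (intro span_minimal[OF _ S]) blast
    ultimately show ?thesis
      unfolding base_space_def P0_plus_def fspan_eq fplus_eq using True subspace_add[OF S] by auto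
  qed
  then have "\<tau> \<in> S" using \<tau> B subspace_add[OF S] unfolding Sigma_plus_alt fplus_eq by blast
  then show ?thesis by (simp add: S_def TR_def)
qed

text \<open>Lift the trace, then restore weak symmetry by a bubble.\<close>
lemma trace_onto_Rt:
  assumes r: "r \<in> Rt nF k (opp T l)" and l: "l \<in> verts T"
  shows "\<exists>\<tau>\<in>Sigma_plus nF j k T. (\<forall>x\<in>opp T l. tn_part (nF (opp T l)) (\<tau> x) = r x) \<and>
    (\<forall>m\<in>verts T - {l}. \<forall>x\<in>opp T m. tn_part (nF (opp T m)) (\<tau> x) = 0)"
proof -
  let ?F = "opp T l" let ?n = "nF ?F"
  obtain s where s: "s \<noteq> 0" "?n = s *\<^sub>R bgrad T l" using normE[OF l] by blast
  define G where "G = (if k = 0 then fplus (Poly 0 {w. w \<bullet> ?n = 0}) {\<lambda>x. A *v xF nF ?F x | A. A \<in> skew_facet ?n} else Poly k {w. w \<bullet> ?n = 0})"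
  obtain p where p: "p \<in> G" "r = frestrict ?F p" using r unfolding Rt_def G_def by auto
  define \<sigma> where "\<sigma> x = lift l ((- 1 / s) *\<^sub>R p x)" for x
  have lin: "linear (\<lambda>w. lift l ((- 1 / s) *\<^sub>R w))"
    by (rule linearI) (simp_all only: scaleR_add_right linear_add[OF linear_lift] linear_scale[OF linear_lift] scaleR_left_commute)
  have p_tang: "p x \<bullet> ?n = 0" and base: "\<sigma> \<in> base_space k" for x
  proof -
    have P: "q x \<bullet> ?n = 0" if q: "q \<in> Poly m {w. w \<bullet> ?n = 0}" for q m x
    proof -
      have "(\<lambda>x. q x \<bullet> ?n) \<in> Poly m {0}"
        by (rule Poly_map[OF _ _ q]) (auto intro!: linearI simp: inner_add_left)
      then show ?thesis by (rule PolyE) (metis (no_types, lifting) scaleR_zero_right singletonD sum.neutral)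
    qed
    have "(\<forall>x. p x \<bullet> ?n = 0) \<and> \<sigma> \<in> base_space k"
    proof (cases "k = 0")
      case False
      then have "p \<in> Poly k {w. w \<bullet> ?n = 0}" using p(1) by (simp add: G_def)
      then have "\<sigma> \<in> Poly k traceless_matrices" unfolding \<sigma>_def[abs_def]
        by (rule Poly_map[OF lin lift_traceless])
      then have "\<sigma> \<in> base_space k" using False by (simp add: base_space_def)
      then show ?thesis using False P p(1) by (auto simp: G_def)
    next
      case True
      then obtain a A where aA: "a \<in> Poly 0 {w. w \<bullet> ?n = 0}" "A \<in> skew_facet ?n" "p = (\<lambda>x. a x + A *v xF nF ?F x)"
        using p(1) by (auto simp: G_def fplus_def)
      have "(\<lambda>x. lift l ((- 1 / s) *\<^sub>R a x)) \<in> Poly 0 traceless_matrices"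
        by (rule Poly_map[OF lin lift_traceless aA(1)])
      moreover have "Efun nF j T l ((- 1 / s) *\<^sub>R A) \<in> span {Efun nF j T l A | l A. l \<in> verts T \<and> A \<in> skew_facet (nF (opp T l))}"
        using l subspace_scale[OF subspace_skew_facet aA(2)] by (intro span_base) blast
      moreover have "\<sigma> = (\<lambda>x. lift l ((- 1 / s) *\<^sub>R a x)) + Efun nF j T l ((- 1 / s) *\<^sub>R A)"
        by (rule ext) (simp only: plus_fun_apply \<sigma>_def aA(3) Efun_lift[OF l] scaleR_add_right linear_add[OF linear_lift] scaleR_matrix_vector_assoc)
      ultimately have "\<sigma> \<in> base_space k"
        unfolding base_space_def P0_plus_def fspan_eq fplus_eq using True by auto
      then show ?thesis using P[OF aA(1)] skew_facet_tangential[OF aA(2)] by (simp add: aA(3) inner_add_left)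
    qed
    then show "p x \<bullet> ?n = 0" "\<sigma> \<in> base_space k" by auto
  qed
  have "\<sigma> \<in> Poly (k + 1) UNIV"
    using base base_space(2) Poly_mono[OF subspace_UNIV] by blast
  then obtain \<beta> where \<beta>: "\<beta> \<in> Btn (k + 1) T" "\<forall>q\<in>Poly k skew_matrices. l2i (lebesgue_on T) (\<lambda>x. \<sigma> x + \<beta> x) q = 0"
    using weak_symmetry_correction by blast
  define \<tau> where "\<tau> = (\<lambda>x. \<sigma> x + \<beta> x)"
  have "\<tau> \<in> Sigma_plus nF j k T"
    unfolding Sigma_plus_alt \<tau>_def fplus_def using \<beta> base by blast
  moreover have "tn_part ?n (\<tau> x) = r x" if "x \<in> ?F" for x
    using Btn_trace[OF \<beta>(1) l that] lift_trace[OF l s(2), of "(- 1 / s) *\<^sub>R p x"] p_tang p(2) that s(1)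
    by (simp add: \<tau>_def linear_add[OF linear_tn] \<sigma>_def frestrict_def)
  moreover have "tn_part (nF (opp T m)) (\<tau> x) = 0" if "m \<in> verts T - {l}" "x \<in> opp T m" for m x
    using Btn_trace[OF \<beta>(1) _ that(2)] lift_trace_other[OF l, of m] that(1)
    by (simp add: \<tau>_def linear_add[OF linear_tn] \<sigma>_def)
  ultimately show ?thesis by blast
qed

end

section \<open>Integrals under affine maps\<close>

lemma nn_integral_lborel_shift:
  fixes f :: "'a::euclidean_space \<Rightarrow> ennreal"
  assumes f: "f \<in> borel_measurable borel" and c: "\<bar>c\<bar> = 1"
  shows "(\<integral>\<^sup>+x. f (t + c *\<^sub>R x) \<partial>lborel) = (\<integral>\<^sup>+x. f x \<partial>lborel)"
proof -
  have c0: "c \<noteq> 0" using c by auto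
  have m: "(\<lambda>x::'a. t + c *\<^sub>R x) \<in> borel_measurable lborel" by measurable
  have "(\<integral>\<^sup>+x. f x \<partial>lborel) = (\<integral>\<^sup>+x. f x \<partial>(density (distr lborel borel (\<lambda>x. t + c *\<^sub>R x)) (\<lambda>_. 1)))"
    by (subst lborel_affine[OF c0, of t]) (simp add: c)
  also have "\<dots> = (\<integral>\<^sup>+x. f x \<partial>(distr lborel borel (\<lambda>x. t + c *\<^sub>R x)))" by (simp add: density_1)
  also have "\<dots> = (\<integral>\<^sup>+x. f (t + c *\<^sub>R x) \<partial>lborel)" using m f by (subst nn_integral_distr) auto
  finally show ?thesis by simp
qed

text \<open>An affine bijection multiplies Lebesgue integrals by a constant. Instead of a determinant, the
  constant is found by comparing two functions: in the double integral of \<open>f x * g (M y - x)\<close> the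
  inner integral over \<open>y\<close> does not depend on \<open>x\<close> by translation invariance, and the substitution of
  \<open>M y - x\<close> for \<open>x\<close> exchanges the roles of \<open>f\<close> and \<open>g\<close>. The map \<open>N\<close> is the inverse of the linear part
  of \<open>M\<close>.\<close>
lemma nn_integral_affine_exchange:
  fixes M :: "'a::euclidean_space \<Rightarrow> 'a" and f g :: "'a \<Rightarrow> ennreal"
  assumes M: "continuous_on UNIV M" and N: "\<And>x y. M (y - N x) = M y - x"
    and f: "f \<in> borel_measurable borel" and g: "g \<in> borel_measurable borel"
  shows "(\<integral>\<^sup>+x. f x \<partial>lborel) * (\<integral>\<^sup>+y. g (M y) \<partial>lborel) = (\<integral>\<^sup>+x. g x \<partial>lborel) * (\<integral>\<^sup>+y. f (M y) \<partial>lborel)"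
proof -
  have Mm [measurable]: "M \<in> borel_measurable borel" using M by (rule borel_measurable_continuous_onI)
  note f[measurable] g[measurable]
  have shift: "(\<integral>\<^sup>+y. h (M y - x) \<partial>lborel) = (\<integral>\<^sup>+y. h (M y) \<partial>lborel)" if h: "h \<in> borel_measurable borel" for h :: "'a \<Rightarrow> ennreal" and x
  proof -
    have hm: "(\<lambda>y. h (M y)) \<in> borel_measurable borel" using h Mm by measurable
    have "(\<integral>\<^sup>+y. h (M y - x) \<partial>lborel) = (\<integral>\<^sup>+y. h (M (- N x + 1 *\<^sub>R y)) \<partial>lborel)"
      using N[of _ x] by simp
    also have "\<dots> = (\<integral>\<^sup>+y. h (M y) \<partial>lborel)" by (rule nn_integral_lborel_shift[OF hm]) simp
    finally show ?thesis .
  qed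
  have "(\<integral>\<^sup>+x. f x \<partial>lborel) * (\<integral>\<^sup>+y. g (M y) \<partial>lborel) = (\<integral>\<^sup>+x. f x * (\<integral>\<^sup>+y. g (M y - x) \<partial>lborel) \<partial>lborel)"
    by (simp add: shift[OF g] nn_integral_multc)
  also have "\<dots> = (\<integral>\<^sup>+x. \<integral>\<^sup>+y. f x * g (M y - x) \<partial>lborel \<partial>lborel)"
    by (intro nn_integral_cong nn_integral_cmult[symmetric]) simp
  also have "\<dots> = (\<integral>\<^sup>+y. \<integral>\<^sup>+x. f x * g (M y - x) \<partial>lborel \<partial>lborel)"
    by (rule lborel_pair.Fubini'[symmetric]) simp
  also have "\<dots> = (\<integral>\<^sup>+y. \<integral>\<^sup>+x. f (M y - x) * g x \<partial>lborel \<partial>lborel)"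
  proof (rule nn_integral_cong)
    fix y
    have "(\<lambda>x. f x * g (M y - x)) \<in> borel_measurable borel" by measurable
    from nn_integral_lborel_shift[OF this, of "-1" "M y"]
    show "(\<integral>\<^sup>+x. f x * g (M y - x) \<partial>lborel) = (\<integral>\<^sup>+x. f (M y - x) * g x \<partial>lborel)" by simp
  qed
  also have "\<dots> = (\<integral>\<^sup>+x. \<integral>\<^sup>+y. f (M y - x) * g x \<partial>lborel \<partial>lborel)"
    by (rule lborel_pair.Fubini') simp
  also have "\<dots> = (\<integral>\<^sup>+x. (\<integral>\<^sup>+y. f (M y - x) \<partial>lborel) * g x \<partial>lborel)"
    by (intro nn_integral_cong nn_integral_multc) simp
  also have "\<dots> = (\<integral>\<^sup>+x. g x \<partial>lborel) * (\<integral>\<^sup>+y. f (M y) \<partial>lborel)"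
    unfolding shift[OF f] by (subst nn_integral_cmult) (simp_all add: mult.commute)
  finally show ?thesis .
qed

lemma nn_integral_indicator_compact:
  fixes h :: "'a::euclidean_space \<Rightarrow> real"
  assumes "compact S" "continuous_on S h" "\<And>x. x \<in> S \<Longrightarrow> 0 \<le> h x"
  shows "(\<integral>\<^sup>+x. ennreal (indicator S x * h x) \<partial>lborel) = ennreal (integral\<^sup>L (lebesgue_on S) h)"
    and "(\<lambda>x. ennreal (indicator S x * h x)) \<in> borel_measurable borel"
proof -
  have i: "integrable lborel (\<lambda>x. indicator S x * h x)" using borel_integrable_compact[OF assms(1,2)] by simp
  then show "(\<integral>\<^sup>+x. ennreal (indicator S x * h x) \<partial>lborel) = ennreal (integral\<^sup>L (lebesgue_on S) h)"
    using assms(3) by (subst nn_integral_eq_integral[OF i]) (auto simp: integral_lborel_compact[OF assms(1,2)] indicator_def)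
  show "(\<lambda>x. ennreal (indicator S x * h x)) \<in> borel_measurable borel"
    using borel_measurable_integrable[OF i] by measurable
qed

lemma integral_affine_nonneg:
  fixes h :: "'a::euclidean_space \<Rightarrow> real" and M :: "'a \<Rightarrow> 'a"
  assumes S: "compact S" "compact S'" and M: "continuous_on UNIV M" "\<And>x y. M (y - N x) = M y - x"
    and SS: "\<And>y. M y \<in> S' \<longleftrightarrow> y \<in> S" and h: "continuous_on S' h" "\<And>x. x \<in> S' \<Longrightarrow> 0 \<le> h x"
  shows "measure lebesgue S' * integral\<^sup>L (lebesgue_on S) (\<lambda>y. h (M y)) = measure lebesgue S * integral\<^sup>L (lebesgue_on S') h"
proof -
  have hM: "continuous_on S (\<lambda>y. h (M y))"
    by (rule continuous_on_compose2[OF h(1) continuous_on_subset[OF M(1)]]) (use SS in auto)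
  have ind: "indicator S' (M y) = (indicator S y :: real)" for y using SS[of y] by (simp add: indicator_def)
  have one: "continuous_on A (\<lambda>x. 1 :: real)" for A :: "'a set" by simp
  have meas: "integral\<^sup>L (lebesgue_on A) (\<lambda>x. 1 :: real) = measure lebesgue A" if "compact A" for A :: "'a set"
    using compact_sets_lebesgue[OF that] by (simp add: measure_restrict_space)
  have m1: "(\<lambda>x. ennreal (indicator S' x * (1::real))) \<in> borel_measurable borel"
    by (rule nn_integral_indicator_compact(2)[OF S(2) one]) simp
  have m2: "(\<lambda>x. ennreal (indicator S' x * h x)) \<in> borel_measurable borel"
    by (rule nn_integral_indicator_compact(2)[OF S(2) h])
  have "ennreal (measure lebesgue S') * ennreal (integral\<^sup>L (lebesgue_on S) (\<lambda>y. h (M y)))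
      = ennreal (integral\<^sup>L (lebesgue_on S') h) * ennreal (measure lebesgue S)"
    using nn_integral_affine_exchange[OF M m1 m2]
    unfolding ind nn_integral_indicator_compact(1)[OF S(2) one zero_le_one] nn_integral_indicator_compact(1)[OF S(1) one zero_le_one]
      nn_integral_indicator_compact(1)[OF S(2) h] meas[OF S(1)] meas[OF S(2)]
    using nn_integral_indicator_compact(1)[OF S(1) hM] nn_integral_indicator_compact(1)[OF S(2) h(1)] h(2) SS by simp
  moreover have "0 \<le> integral\<^sup>L (lebesgue_on S) (\<lambda>y. h (M y))" "0 \<le> integral\<^sup>L (lebesgue_on S') h"
    using h(2) SS by (auto intro!: Bochner_Integration.integral_nonneg_AE AE_I2)
  ultimately show ?thesis by (simp add: mult.commute flip: ennreal_mult)
qed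

text \<open>Adding a constant reduces the claim to nonnegative integrands.\<close>
lemma integral_affine:
  fixes h :: "'a::euclidean_space \<Rightarrow> real" and M :: "'a \<Rightarrow> 'a"
  assumes S: "compact S" "compact S'" and M: "continuous_on UNIV M" "\<And>x y. M (y - N x) = M y - x"
    and SS: "\<And>y. M y \<in> S' \<longleftrightarrow> y \<in> S" and h: "continuous_on S' h"
  shows "measure lebesgue S' * integral\<^sup>L (lebesgue_on S) (\<lambda>y. h (M y)) = measure lebesgue S * integral\<^sup>L (lebesgue_on S') h"
proof -
  obtain K where K: "\<And>x. x \<in> S' \<Longrightarrow> \<bar>h x\<bar> \<le> K"
    using compact_imp_bounded[OF compact_continuous_image[OF h S(2)]] by (auto simp: bounded_iff)
  have hM: "continuous_on S (\<lambda>y. h (M y))"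
    by (rule continuous_on_compose2[OF h continuous_on_subset[OF M(1)]]) (use SS in auto)
  have "measure lebesgue S' * integral\<^sup>L (lebesgue_on S) (\<lambda>y. h (M y) + K) = measure lebesgue S * integral\<^sup>L (lebesgue_on S') (\<lambda>x. h x + K)"
  proof (rule integral_affine_nonneg[OF S M SS])
    show "continuous_on S' (\<lambda>x. h x + K)" using h by (intro continuous_intros)
    show "0 \<le> h x + K" if "x \<in> S'" for x using K[OF that] by auto
  qed
  moreover have "integral\<^sup>L (lebesgue_on S) (\<lambda>y. h (M y) + K) = integral\<^sup>L (lebesgue_on S) (\<lambda>y. h (M y)) + K * measure lebesgue S"
    by (subst Bochner_Integration.integral_add) (auto intro!: integrable_compact S hM simp: measure_restrict_space compact_sets_lebesgue[OF S(1)])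
  moreover have "integral\<^sup>L (lebesgue_on S') (\<lambda>y. h y + K) = integral\<^sup>L (lebesgue_on S') h + K * measure lebesgue S'"
    by (subst Bochner_Integration.integral_add) (auto intro!: integrable_compact S h simp: measure_restrict_space compact_sets_lebesgue[OF S(2)])
  ultimately show ?thesis by (simp add: algebra_simps)
qed

lemma integral_lborel_affine:
  fixes f :: "'a::euclidean_space \<Rightarrow> real"
  assumes f: "f \<in> borel_measurable borel" and c: "c > 0"
  shows "(\<integral>x. f (t + c *\<^sub>R x) \<partial>lborel) = inverse (c ^ DIM('a)) * (\<integral>x. f x \<partial>lborel)"
proof -
  have c0: "c \<noteq> 0" using c by auto
  have m: "(\<lambda>x::'a. t + c *\<^sub>R x) \<in> borel_measurable lborel" by measurable
  have "(\<integral>x. f x \<partial>lborel) = (\<integral>x. f x \<partial>(density (distr lborel borel (\<lambda>x. t + c *\<^sub>R x)) (\<lambda>_. \<bar>c\<bar> ^ DIM('a))))"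
    by (subst lborel_affine[OF c0, of t]) simp
  also have "\<dots> = (\<integral>x. \<bar>c\<bar> ^ DIM('a) *\<^sub>R f x \<partial>(distr lborel borel (\<lambda>x. t + c *\<^sub>R x)))"
    using f by (subst integral_density) auto
  also have "\<dots> = (\<integral>x. \<bar>c\<bar> ^ DIM('a) *\<^sub>R f (t + c *\<^sub>R x) \<partial>lborel)"
    using m f by (subst integral_distr) auto
  also have "\<dots> = c ^ DIM('a) * (\<integral>x. f (t + c *\<^sub>R x) \<partial>lborel)" using c by simp
  finally show ?thesis using c by (simp add: field_simps)
qed

section \<open>Integration by parts along flows\<close>

definition C1 :: "('a::euclidean_space \<Rightarrow> real) \<Rightarrow> ('a \<Rightarrow> 'a) \<Rightarrow> bool" where
  "C1 \<psi> G \<longleftrightarrow> (\<forall>x. (\<psi> has_derivative (\<lambda>h. G x \<bullet> h)) (at x)) \<and> continuous_on UNIV G"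

lemma C1_continuous: "C1 \<psi> G \<Longrightarrow> continuous_on S \<psi>"
  by (auto simp: C1_def intro!: continuous_at_imp_continuous_on intro: has_derivative_continuous)

lemma C1_grad_continuous: "C1 \<psi> G \<Longrightarrow> continuous_on S G"
  using continuous_on_subset by (auto simp: C1_def)

lemma C1_mult: "C1 f F \<Longrightarrow> C1 g G \<Longrightarrow> C1 (\<lambda>x. f x * g x) (\<lambda>x. f x *\<^sub>R G x + g x *\<^sub>R F x)"
  using C1_continuous[of f F UNIV] C1_continuous[of g G UNIV] unfolding C1_def
  by (auto intro!: continuous_intros derivative_eq_intros simp: inner_add_left algebra_simps)

lemma C1_diff: "C1 f F \<Longrightarrow> C1 g G \<Longrightarrow> C1 (\<lambda>x. f x - g x) (\<lambda>x. F x - G x)"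
  unfolding C1_def by (auto intro!: continuous_intros derivative_eq_intros simp: inner_diff_left)

lemma C1_lipschitz:
  assumes C: "C1 \<psi> G" and T: "compact T" "convex T"
  shows "\<exists>L\<ge>0. \<forall>x\<in>T. \<forall>y\<in>T. \<bar>\<psi> x - \<psi> y\<bar> \<le> L * norm (x - y)"
proof -
  obtain L where L: "\<And>x. x \<in> T \<Longrightarrow> norm (G x) \<le> L"
    using compact_imp_bounded[OF compact_continuous_image[OF C1_grad_continuous[OF C] T(1)]] by (auto simp: bounded_iff)
  have "norm (\<psi> x - \<psi> y) \<le> max L 0 * norm (x - y)" if "x \<in> T" "y \<in> T" for x y
  proof (rule differentiable_bound[OF T(2), of \<psi> "\<lambda>x h. G x \<bullet> h"])
    show "(\<psi> has_derivative (\<lambda>h. G x \<bullet> h)) (at x within T)" if "x \<in> T" for x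
    proof (rule has_derivative_at_withinI)
      show "(\<psi> has_derivative (\<lambda>h. G x \<bullet> h)) (at x)" using C by (simp add: C1_def)
    qed
    show "onorm (\<lambda>h. G x \<bullet> h) \<le> max L 0" if "x \<in> T" for x
    proof (rule onorm_bound)
      fix h
      have "norm (G x \<bullet> h) \<le> norm (G x) * norm h" using Cauchy_Schwarz_ineq2[of "G x" h] by simp
      also have "\<dots> \<le> max L 0 * norm h" using L[OF that] by (intro mult_right_mono) auto
      finally show "norm (G x \<bullet> h) \<le> max L 0 * norm h" .
    qed simp
  qed (use that in auto)
  then show ?thesis by (intro exI[of _ "max L 0"]) auto
qed

lemma difference_quotient_limit:
  assumes "(g has_field_derivative D) (at (0::real))" "\<And>n. s n \<noteq> 0" "s \<longlonglongrightarrow> 0"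
  shows "(\<lambda>n. (g (s n) - g 0) / s n) \<longlonglongrightarrow> D"
proof -
  have "((\<lambda>h. (g (0 + h) - g 0) / h) \<longlongrightarrow> D) (at 0)" using assms(1) by (simp add: DERIV_def)
  moreover have "filterlim s (at 0) sequentially" using assms by (simp add: filterlim_at)
  ultimately show ?thesis using filterlim_compose[of "\<lambda>h. (g (0 + h) - g 0) / h" "nhds D" "at 0" s sequentially] by simp
qed

text \<open>For the vector field \<open>v x = \<beta> *\<^sub>R x + c\<close> the maps \<open>x \<mapsto> x + s *\<^sub>R v x\<close> are dilations or translations, under
  which the integral of the function \<open>\<psi>\<close>, cut off outside \<open>T\<close>, changes by the factor
  \<open>(1 + s * \<beta>) ^ -d\<close>. The derivative at \<open>s = 0\<close> is the divergence theorem for \<open>\<psi> v\<close> without boundary term. By the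
  exit condition \<open>\<psi>\<close> has a zero wherever an orbit leaves \<open>T\<close>; so the cut-off function is Lipschitz
  along the orbits and the limit may be taken under the integral.\<close>
lemma flow_gauss:
  fixes \<psi> :: "'a::euclidean_space \<Rightarrow> real" and T :: "'a set" and \<beta> :: real
  assumes T: "compact T" "convex T" and C: "C1 \<psi> G" and \<beta>: "0 \<le> \<beta>" "\<beta> \<le> 1"
    and exit: "\<And>x s. x \<in> T \<Longrightarrow> \<bar>s\<bar> < 1 \<Longrightarrow> x + s *\<^sub>R (\<beta> *\<^sub>R x + c) \<notin> T \<Longrightarrow>
        \<exists>z\<in>T \<inter> closed_segment x (x + s *\<^sub>R (\<beta> *\<^sub>R x + c)). \<psi> z = 0"
  shows "integral\<^sup>L (lebesgue_on T) (\<lambda>x. G x \<bullet> (\<beta> *\<^sub>R x + c) + DIM('a) * \<beta> * \<psi> x) = 0"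
proof -
  define v where "v x = \<beta> *\<^sub>R x + c" for x
  define w where "w x = indicator T x * \<psi> x" for x
  \<comment> \<open>Steps below one, so that the maps are invertible and the exit condition applies to their inverses.\<close>
  define s where "s n = 1 / (real n + 2)" for n
  define \<Phi> where "\<Phi> n x = x + s n *\<^sub>R v x" for n x
  have s: "0 < s n" "s n < 1" for n by (simp_all add: s_def)
  have s0: "s \<longlonglongrightarrow> 0" unfolding s_def
    using LIMSEQ_ignore_initial_segment[OF lim_1_over_n[where 'a = real], of 2] by (simp add: add.commute)
  have cT: "continuous_on T \<psi>" using C1_continuous[OF C] .
  have wi: "integrable lborel w" unfolding w_def using borel_integrable_compact[OF T(1) cT] by simp
  have wm: "w \<in> borel_measurable borel" using borel_measurable_integrable[OF wi] by simp
  have \<Phi>eq: "\<Phi> n x = s n *\<^sub>R c + (1 + s n * \<beta>) *\<^sub>R x" for n x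
    by (simp add: \<Phi>_def v_def algebra_simps)
  have pos: "0 < 1 + s n * \<beta>" for n using s[of n] \<beta> by (simp add: add_pos_nonneg)
  have int\<Phi>: "(\<integral>x. w (\<Phi> n x) \<partial>lborel) = inverse ((1 + s n * \<beta>) ^ DIM('a)) * (\<integral>x. w x \<partial>lborel)" for n
    unfolding \<Phi>eq by (rule integral_lborel_affine[OF wm pos])
  obtain L where L: "L \<ge> 0" "\<And>x y. x \<in> T \<Longrightarrow> y \<in> T \<Longrightarrow> \<bar>\<psi> x - \<psi> y\<bar> \<le> L * norm (x - y)"
    using C1_lipschitz[OF C T] by blast
  obtain R0 where R0: "\<And>x. x \<in> T \<Longrightarrow> norm x \<le> R0" using compact_imp_bounded[OF T(1)] by (auto simp: bounded_iff)
  define R where "R = R0 + norm c"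
  have seg: "norm (x - z) \<le> norm (y - x)" "norm (y - z) \<le> norm (y - x)" if "z \<in> closed_segment x y" for x y z :: 'a
    using segment_bound[OF that] by (simp_all add: norm_minus_commute)
  have lip: "\<bar>w (\<Phi> n x) - w x\<bar> \<le> L * (s n * norm (v x))" for n x
  proof -
    have d: "norm (\<Phi> n x - x) = s n * norm (v x)" using s[of n] by (simp add: \<Phi>_def)
    consider "x \<in> T" "\<Phi> n x \<in> T" | "x \<in> T" "\<Phi> n x \<notin> T" | "x \<notin> T" "\<Phi> n x \<in> T" | "x \<notin> T" "\<Phi> n x \<notin> T" by blast
    then show ?thesis
    proof cases
      case 1
      then show ?thesis using L(2)[OF 1(2,1)] d by (simp add: w_def)
    next
      case 2
      have "x + s n *\<^sub>R (\<beta> *\<^sub>R x + c) \<notin> T" using 2 by (simp add: \<Phi>_def v_def)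
      then obtain z where z: "z \<in> T" "z \<in> closed_segment x (\<Phi> n x)" "\<psi> z = 0"
        using exit[OF 2(1), of "s n"] s[of n] by (auto simp: \<Phi>_def v_def)
      have "\<bar>\<psi> x - \<psi> z\<bar> \<le> L * norm (x - z)" by (rule L(2)[OF 2(1) z(1)])
      also have "\<dots> \<le> L * norm (\<Phi> n x - x)" using seg(1)[OF z(2)] L(1) by (intro mult_left_mono)
      finally show ?thesis using 2 z d by (simp add: w_def)
    next
      case 3
      define y where "y = \<Phi> n x"
      \<comment> \<open>The inverse map is a step of size \<open>s'\<close> from the image point.\<close>
      define s' where "s' = - s n / (1 + s n * \<beta>)"
      have "v y = (1 + s n * \<beta>) *\<^sub>R v x" by (simp add: y_def \<Phi>_def v_def algebra_simps)
      then have "s' *\<^sub>R v y = - s n *\<^sub>R v x" using pos[of n] by (simp add: s'_def)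
      then have xy: "y + s' *\<^sub>R v y = x" by (simp add: y_def \<Phi>_def)
      have "\<bar>s'\<bar> \<le> s n" using pos[of n] s[of n] \<beta> by (simp add: s'_def divide_le_eq_1 pos_divide_le_eq algebra_simps)
      then have s': "\<bar>s'\<bar> < 1" using s(2)[of n] by simp
      have "y + s' *\<^sub>R (\<beta> *\<^sub>R y + c) \<notin> T" using xy 3 by (simp add: v_def)
      then obtain z where z: "z \<in> T" "z \<in> closed_segment y x" "\<psi> z = 0"
        using exit[of y s'] s' 3 xy by (auto simp: y_def v_def)
      have "\<bar>\<psi> y - \<psi> z\<bar> \<le> L * norm (y - z)" using L(2) 3 z(1) by (simp add: y_def)
      also have "\<dots> \<le> L * norm (\<Phi> n x - x)" using seg(1)[OF z(2)] L(1) by (intro mult_left_mono) (simp_all add: y_def norm_minus_commute)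
      finally show ?thesis using 3 z d by (simp add: w_def y_def)
    next
      case 4
      then show ?thesis using L(1) s[of n] by (simp add: w_def)
    qed
  qed
  define K where "K = L * (R + norm c)"
  have bound: "norm ((w (\<Phi> n x) - w x) / s n) \<le> indicator (cball 0 R) x * K" for n x
  proof (cases "x \<in> T \<or> \<Phi> n x \<in> T")
    case True
    have "norm x \<le> R"
    proof (cases "x \<in> T")
      case True then show ?thesis using R0[of x] by (simp add: R_def add_increasing2)
    next
      case False
      have e: "(1 + s n * \<beta>) *\<^sub>R x = \<Phi> n x - s n *\<^sub>R c" by (simp add: \<Phi>eq)
      have "norm x \<le> (1 + s n * \<beta>) * norm x" using s[of n] \<beta> by (simp add: mult_le_cancel_right1 distrib_right)
      also have "\<dots> = norm (\<Phi> n x - s n *\<^sub>R c)" using arg_cong[OF e, of norm] pos[of n] by simp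
      also have "\<dots> \<le> norm (\<Phi> n x) + s n * norm c" using norm_triangle_ineq4[of "\<Phi> n x" "s n *\<^sub>R c"] s(1)[of n] by simp
      also have "\<dots> \<le> R0 + 1 * norm c" using R0[of "\<Phi> n x"] False \<open>x \<in> T \<or> \<Phi> n x \<in> T\<close> s[of n] by (intro add_mono mult_right_mono) auto
      finally show ?thesis by (simp add: R_def)
    qed
    have "norm (v x) \<le> \<beta> * norm x + norm c" unfolding v_def using norm_triangle_ineq[of "\<beta> *\<^sub>R x" c] \<beta> by simp
    also have "\<dots> \<le> 1 * R + norm c" using \<beta> \<open>norm x \<le> R\<close> by (intro add_mono mult_mono) auto
    finally have "norm (v x) \<le> R + norm c" by simp
    then have "L * norm (v x) \<le> K" unfolding K_def using L(1) by (intro mult_left_mono)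
    moreover have "norm ((w (\<Phi> n x) - w x) / s n) \<le> L * norm (v x)"
      using lip[of n x] s(1)[of n] by (simp add: pos_divide_le_eq algebra_simps)
    ultimately show ?thesis using \<open>norm x \<le> R\<close> by simp
  next
    case False
    then have "w (\<Phi> n x) - w x = 0" by (simp add: w_def)
    moreover have "0 \<le> K" if "norm x \<le> R"
      unfolding K_def using L(1) order_trans[OF norm_ge_zero that] by simp
    ultimately show ?thesis by (cases "norm x \<le> R") auto
  qed
  have "AE x in lebesgue. x \<notin> frontier T"
    using negligible_convex_frontier[OF T(2)] by (auto simp: negligible_iff_null_sets intro: AE_not_in)
  then have aeF: "AE x in lborel. x \<notin> frontier T" by (simp add: AE_completion_iff)
  have lim: "(\<lambda>n. (w (\<Phi> n x) - w x) / s n) \<longlonglongrightarrow> indicator T x * (G x \<bullet> v x)" if x: "x \<notin> frontier T" for x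
  proof -
    have \<Phi>lim: "(\<lambda>n. \<Phi> n x) \<longlonglongrightarrow> x" unfolding \<Phi>_def
      using tendsto_add[OF tendsto_const[of x] tendsto_scaleR[OF s0 tendsto_const[of "v x"]]] by simp
    show ?thesis
    proof (cases "x \<in> T")
      case True
      then have xi: "x \<in> interior T" using x closure_subset[of T] by (auto simp: frontier_def)
      then have ev: "\<forall>\<^sub>F n in sequentially. \<Phi> n x \<in> interior T"
        using topological_tendstoD[OF \<Phi>lim open_interior] by blast
      have "((\<lambda>t. \<psi> (x + t *\<^sub>R v x)) has_derivative (\<lambda>h. G x \<bullet> (h *\<^sub>R v x))) (at 0)"
      proof -
        have "((\<lambda>t. x + t *\<^sub>R v x) has_derivative (\<lambda>h. h *\<^sub>R v x)) (at (0::real))" by (auto intro!: derivative_eq_intros)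
        moreover have "(\<psi> has_derivative (\<lambda>h. G x \<bullet> h)) (at (x + 0 *\<^sub>R v x))" using C by (simp add: C1_def)
        ultimately show ?thesis by (rule has_derivative_compose)
      qed
      then have "((\<lambda>t. \<psi> (x + t *\<^sub>R v x)) has_field_derivative (G x \<bullet> v x)) (at 0)"
      proof -
        have e: "(\<lambda>h. G x \<bullet> (h *\<^sub>R v x)) = (*) (G x \<bullet> v x)" by (auto simp: fun_eq_iff mult.commute)
        assume "((\<lambda>t. \<psi> (x + t *\<^sub>R v x)) has_derivative (\<lambda>h. G x \<bullet> (h *\<^sub>R v x))) (at 0)"
        then show ?thesis unfolding has_field_derivative_def e .
      qed
      from difference_quotient_limit[OF this, of s] s0 s(1)
      have "(\<lambda>n. (\<psi> (\<Phi> n x) - \<psi> x) / s n) \<longlonglongrightarrow> G x \<bullet> v x" by (simp add: \<Phi>_def less_imp_neq[symmetric] less_imp_neq)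
      moreover have "\<forall>\<^sub>F n in sequentially. (\<psi> (\<Phi> n x) - \<psi> x) / s n = (w (\<Phi> n x) - w x) / s n"
        using ev
      proof (rule eventually_mono)
        fix n assume "\<Phi> n x \<in> interior T"
        then have "\<Phi> n x \<in> T" using interior_subset by blast
        then show "(\<psi> (\<Phi> n x) - \<psi> x) / s n = (w (\<Phi> n x) - w x) / s n" using True by (simp add: w_def)
      qed
      ultimately show ?thesis using True by (auto intro: Lim_transform_eventually)
    next
      case False
      then have "x \<in> - T" by simp
      then have ev: "\<forall>\<^sub>F n in sequentially. \<Phi> n x \<in> - T"
        using topological_tendstoD[OF \<Phi>lim, of "- T"] compact_imp_closed[OF T(1)] by blast
      have "\<forall>\<^sub>F n in sequentially. 0 = (w (\<Phi> n x) - w x) / s n"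
        using ev by (rule eventually_mono) (use False in \<open>auto simp: w_def\<close>)
      then show ?thesis using False by (auto intro: Lim_transform_eventually[OF tendsto_const])
    qed
  qed
  have cG: "continuous_on T (\<lambda>x. G x \<bullet> v x)" unfolding v_def
    by (intro continuous_intros C1_grad_continuous[OF C])
  have iG: "integrable lborel (\<lambda>x. indicator T x * (G x \<bullet> v x))" using borel_integrable_compact[OF T(1) cG] by simp
  have \<Phi>m: "(\<lambda>x. w (\<Phi> n x)) \<in> borel_measurable lborel" for n unfolding \<Phi>eq using wm by measurable
  have lim1: "(\<lambda>n. \<integral>x. (w (\<Phi> n x) - w x) / s n \<partial>lborel) \<longlonglongrightarrow> (\<integral>x. indicator T x * (G x \<bullet> v x) \<partial>lborel)"
  proof (rule integral_dominated_convergence[where w = "\<lambda>x. indicator (cball 0 R) x * K"])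
    show "integrable lborel (\<lambda>x. indicator (cball 0 R) x * K)"
      using borel_integrable_compact[OF compact_cball, of 0 R "\<lambda>_. K"] by simp
    show "AE x in lborel. (\<lambda>n. (w (\<Phi> n x) - w x) / s n) \<longlonglongrightarrow> indicator T x * (G x \<bullet> v x)"
      using aeF by (rule eventually_mono) (rule lim)
  qed (use bound \<Phi>m wm borel_measurable_integrable[OF iG] in \<open>auto intro!: borel_measurable_divide borel_measurable_diff\<close>)
  have eq: "(\<integral>x. (w (\<Phi> n x) - w x) / s n \<partial>lborel) = (inverse ((1 + s n * \<beta>) ^ DIM('a)) - inverse ((1 + 0 * \<beta>) ^ DIM('a))) / s n * (\<integral>x. w x \<partial>lborel)" for n
  proof -
    have "integrable lborel (\<lambda>x. w (\<Phi> n x))"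
    proof -
      have e: "(\<lambda>x. w (\<Phi> n x)) = (\<lambda>x. (w (\<Phi> n x) - w x) / s n * s n + w x)" using s(1)[of n] by (auto simp: fun_eq_iff)
      have "integrable lborel (\<lambda>x. (w (\<Phi> n x) - w x) / s n)"
      proof (rule Bochner_Integration.integrable_bound)
        show "integrable lborel (\<lambda>x. indicator (cball 0 R) x * K)"
          using borel_integrable_compact[OF compact_cball, of 0 R "\<lambda>_. K"] by simp
        show "AE x in lborel. norm ((w (\<Phi> n x) - w x) / s n) \<le> norm (indicator (cball 0 R) x * K)"
          using bound[of n] by (intro AE_I2) (auto intro: order_trans[OF _ abs_ge_self])
      qed (use \<Phi>m wm in auto)
      then show ?thesis unfolding e by (intro Bochner_Integration.integrable_add integrable_mult_left wi)
    qed
    then show ?thesis using wi s(1)[of n] by (simp add: int\<Phi> left_diff_distrib diff_divide_distrib)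
  qed
  have lim2: "(\<lambda>n. (inverse ((1 + s n * \<beta>) ^ DIM('a)) - inverse ((1 + 0 * \<beta>) ^ DIM('a))) / s n) \<longlonglongrightarrow> - (DIM('a) * \<beta>)"
  proof (rule difference_quotient_limit[OF _ _ s0])
    show "((\<lambda>t. inverse ((1 + t * \<beta>) ^ DIM('a))) has_field_derivative - (DIM('a) * \<beta>)) (at 0)"
      by (auto intro!: derivative_eq_intros)
  qed (use s(1) in \<open>simp add: less_imp_neq[symmetric] less_imp_neq\<close>)
  have "(\<integral>x. indicator T x * (G x \<bullet> v x) \<partial>lborel) = - (DIM('a) * \<beta>) * (\<integral>x. w x \<partial>lborel)"
    by (rule LIMSEQ_unique[OF lim1]) (unfold eq, rule tendsto_mult_right[OF lim2])
  then have "integral\<^sup>L (lebesgue_on T) (\<lambda>x. G x \<bullet> v x) + DIM('a) * \<beta> * integral\<^sup>L (lebesgue_on T) \<psi> = 0"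
    using integral_lborel_compact[OF T(1) cG] integral_lborel_compact[OF T(1) cT] by (simp add: w_def)
  moreover have "integral\<^sup>L (lebesgue_on T) (\<lambda>x. G x \<bullet> v x + DIM('a) * \<beta> * \<psi> x) = integral\<^sup>L (lebesgue_on T) (\<lambda>x. G x \<bullet> v x) + DIM('a) * \<beta> * integral\<^sup>L (lebesgue_on T) \<psi>"
    using integrable_compact[OF T(1) cG] integrable_compact[OF T(1) cT] by simp
  ultimately show ?thesis by (simp add: v_def)
qed

section \<open>Smooth functions, polynomials and divergences\<close>

lemma frechet_derivative_grad:
  assumes "(f has_derivative f') (at x)"
  shows "f' h = grad f x \<bullet> h"
proof -
  have l: "linear f'" using assms has_derivative_linear by blast
  have g: "grad f x $ i = f' (axis i 1)" for i
    using frechet_derivative_at[OF assms] by (simp add: grad_def)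
  have "f' h = f' (\<Sum>i\<in>UNIV. h $ i *\<^sub>R axis i 1)"
    using basis_expansion[of h] by (simp add: scalar_mult_eq_scaleR)
  also have "\<dots> = (\<Sum>i\<in>UNIV. h $ i * f' (axis i 1))" by (simp add: linear_sum[OF l] linear_scale[OF l])
  finally show ?thesis by (simp add: g inner_vec_def mult.commute)
qed

lemma C1_smooth: assumes "smooth \<phi>" shows "C1 \<phi> (grad \<phi>)"
proof -
  have "Ck (Suc 0) \<phi>" using assms by (simp add: smooth_def)
  then have d: "\<phi> differentiable (at x)" and c: "continuous_on UNIV (\<lambda>x. grad \<phi> x $ i)" for x i by auto
  have "(\<phi> has_derivative (\<lambda>h. grad \<phi> x \<bullet> h)) (at x)" for x
  proof -
    have h: "(\<phi> has_derivative frechet_derivative \<phi> (at x)) (at x)" using d frechet_derivative_works by blast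
    then show ?thesis using frechet_derivative_grad[OF h] by (metis (no_types, lifting) ext)
  qed
  moreover have "continuous_on UNIV (grad \<phi>)" using continuous_on_vec_lambda[of UNIV "\<lambda>i x. grad \<phi> x $ i", OF c] by simp
  ultimately show ?thesis by (simp add: C1_def)
qed

lemma C1_Poly: assumes p: "p \<in> Poly m (UNIV :: real set)" shows "C1 p (grad p)"
proof -
  note h = Poly_has_derivative[OF subspace_UNIV p]
  have e: "frechet_derivative p (at x) = (\<lambda>h. grad p x \<bullet> h)" for x
    by (rule ext) (rule frechet_derivative_grad[OF h])
  have "(p has_derivative (\<lambda>h. grad p x \<bullet> h)) (at x)" for x using h[of x] unfolding e .
  moreover have "continuous_on UNIV (\<lambda>x. grad p x $ i)" for i
    unfolding grad_def using Poly_continuous[OF subspace_UNIV Poly_frechet_derivative[OF subspace_UNIV p]] by simp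
  then have "continuous_on UNIV (grad p)" using continuous_on_vec_lambda[of UNIV "\<lambda>i x. grad p x $ i"] by simp
  ultimately show ?thesis by (simp add: C1_def)
qed

lemma grad_Poly_direction: "p \<in> Poly m (UNIV :: real set) \<Longrightarrow> grad p x \<bullet> h = frechet_derivative p (at x) h"
  using frechet_derivative_grad[OF Poly_has_derivative[OF subspace_UNIV]] by metis

lemma vdiv_scaled_const:
  assumes "C1 w W" shows "vdiv (\<lambda>x. w x *\<^sub>R t) x = W x \<bullet> t"
proof -
  have "((\<lambda>x. w x *\<^sub>R t) has_derivative (\<lambda>h. (W x \<bullet> h) *\<^sub>R t)) (at x)"
    using assms unfolding C1_def by (auto intro!: derivative_eq_intros)
  then have "frechet_derivative (\<lambda>x. w x *\<^sub>R t) (at x) = (\<lambda>h. (W x \<bullet> h) *\<^sub>R t)"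
    by (rule frechet_derivative_at[symmetric])
  then have "vdiv (\<lambda>x. w x *\<^sub>R t) x = (\<Sum>i\<in>UNIV. W x $ i * t $ i)" by (simp add: vdiv_def inner_axis)
  then show ?thesis by (simp add: inner_vec_def)
qed

lemma vdiv_dilation:
  fixes a :: "real^'n" and r :: real
  shows "vdiv (\<lambda>x. r *\<^sub>R (x - a)) x = CARD('n) * r"
proof -
  have "((\<lambda>x. r *\<^sub>R (x - a)) has_derivative (\<lambda>h. r *\<^sub>R h)) (at x)" by (auto intro!: derivative_eq_intros)
  then have "frechet_derivative (\<lambda>x. r *\<^sub>R (x - a)) (at x) = (\<lambda>h. r *\<^sub>R h)"
    by (rule frechet_derivative_at[symmetric])
  then show ?thesis by (simp add: vdiv_def axis_def)
qed

lemma vdiv_zero: "vdiv (\<lambda>x. 0) x = 0"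
proof -
  have "frechet_derivative (\<lambda>x. 0) (at x) = (\<lambda>h. 0)" for x :: "real^'n" by (rule frechet_derivative_at[symmetric]) simp
  then show ?thesis by (simp add: vdiv_def)
qed

section \<open>Integration by parts on a simplex\<close>

context cell begin

lemma bary_segment: "m \<in> verts T \<Longrightarrow> bary T m (x + t *\<^sub>R (y - x)) = (1 - t) * bary T m x + t * bary T m y"
  unfolding bary_add inner_scaleR_right bary_diff[symmetric] by (simp add: algebra_simps)

lemma segment_zero:
  assumes "a \<in> verts T" "0 \<le> bary T a x" "bary T a y < 0"
  shows "\<exists>t. 0 \<le> t \<and> t \<le> 1 \<and> bary T a (x + t *\<^sub>R (y - x)) = 0"
proof (intro exI conjI)
  let ?t = "bary T a x / (bary T a x - bary T a y)"
  show "0 \<le> ?t" "?t \<le> 1" using assms(2,3) by (auto simp: divide_simps)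
  show "bary T a (x + ?t *\<^sub>R (y - x)) = 0"
    unfolding bary_segment[OF assms(1)] using assms(2,3) by (simp add: divide_simps)
qed

lemma in_segment: "0 \<le> t \<Longrightarrow> t \<le> 1 \<Longrightarrow> x + t *\<^sub>R (y - x) \<in> closed_segment x y"
  unfolding closed_segment_def by (auto simp: algebra_simps intro!: exI[of _ t])

text \<open>The orbits of the dilation about \<open>a\<close> stay in the facets that contain \<open>a\<close> and leave the simplex only
  through the facet opposite to \<open>a\<close>.\<close>
lemma gauss_dilation:
  fixes \<psi> :: "real^'n \<Rightarrow> real"
  assumes a: "a \<in> verts T" and C: "C1 \<psi> G" and z: "\<And>x. x \<in> opp T a \<Longrightarrow> \<psi> x = 0"
  shows "integral\<^sup>L (lebesgue_on T) (\<lambda>x. G x \<bullet> (x - a) + CARD('n) * \<psi> x) = 0"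
proof -
  have "integral\<^sup>L (lebesgue_on T) (\<lambda>x. G x \<bullet> (1 *\<^sub>R x + (- a)) + real (DIM(real^'n)) * 1 * \<psi> x) = 0"
  proof (rule flow_gauss[OF compact_cell convex_cell C])
    fix x s assume x: "x \<in> T" and s: "\<bar>s::real\<bar> < 1" and out: "x + s *\<^sub>R (1 *\<^sub>R x + - a) \<notin> T"
    let ?y = "x + s *\<^sub>R (1 *\<^sub>R x + - a)"
    have yb: "bary T m ?y = (1 + s) * bary T m x - s * (if m = a then 1 else 0)" if m: "m \<in> verts T" for m
    proof -
      have "?y = x + s *\<^sub>R (x - a)" by simp
      then have "bary T m ?y = bary T m x + s * (bary T m x - bary T m a)"
        by (simp only: bary_add[OF m] inner_scaleR_right bary_diff[OF m, symmetric])
      then show ?thesis by (simp only: bary_vertex[OF m a]) (auto simp: algebra_simps)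
    qed
    have x0: "0 \<le> bary T m x" if "m \<in> verts T" for m using x mem_iff that by blast
    have y0: "0 \<le> bary T m ?y" if "m \<in> verts T" "m \<noteq> a" for m
      using yb[OF that(1)] that(2) x0[OF that(1)] s by simp
    obtain m where m: "m \<in> verts T" "bary T m ?y < 0" using out mem_iff by (meson not_le)
    then have "m = a" using y0[of m] by fastforce
    then have ya: "bary T a ?y < 0" using m by simp
    then obtain t where t: "0 \<le> t" "t \<le> 1" "bary T a (x + t *\<^sub>R (?y - x)) = 0"
      using segment_zero[OF a x0[OF a]] by blast
    let ?z = "x + t *\<^sub>R (?y - x)"
    have "0 \<le> bary T m ?z" if m: "m \<in> verts T" for m
    proof (cases "m = a")
      case False
      then show ?thesis unfolding bary_segment[OF m] using x0[OF m] y0[OF m] t by simp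
    qed (use t in simp)
    then have zT: "?z \<in> T" using mem_iff by blast
    then have "\<psi> ?z = 0" using z opp_iff[OF a] t(3) by blast
    then show "\<exists>z\<in>T \<inter> closed_segment x ?y. \<psi> z = 0" using zT in_segment[OF t(1,2)] by blast
  qed auto
  then show ?thesis by simp
qed

text \<open>Along the edge direction only the coordinates of \<open>a\<close> and \<open>b\<close> change, so the orbits leave the simplex
  only through the two facets opposite to \<open>a\<close> and \<open>b\<close>.\<close>
lemma gauss_edge:
  fixes \<psi> :: "real^'n \<Rightarrow> real"
  assumes ab: "a \<in> verts T" "b \<in> verts T" "a \<noteq> b" and C: "C1 \<psi> G"
    and z: "\<And>x. x \<in> opp T a \<Longrightarrow> \<psi> x = 0" "\<And>x. x \<in> opp T b \<Longrightarrow> \<psi> x = 0"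
  shows "integral\<^sup>L (lebesgue_on T) (\<lambda>x. G x \<bullet> (b - a)) = 0"
proof -
  have "integral\<^sup>L (lebesgue_on T) (\<lambda>x. G x \<bullet> (0 *\<^sub>R x + (b - a)) + real (DIM(real^'n)) * 0 * \<psi> x) = 0"
  proof (rule flow_gauss[OF compact_cell convex_cell C])
    fix x s assume x: "x \<in> T" and out: "x + s *\<^sub>R (0 *\<^sub>R x + (b - a)) \<notin> T"
    let ?y = "x + s *\<^sub>R (0 *\<^sub>R x + (b - a))"
    have yb: "bary T m ?y = bary T m x + s * ((if b = m then 1 else 0) - (if a = m then 1 else 0))" if m: "m \<in> verts T" for m
    proof -
      have "?y = x + s *\<^sub>R (b - a)" by simp
      then show ?thesis by (simp only: bary_add[OF m] inner_scaleR_right bgrad_edge[OF m ab(1,2)])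
    qed
    have x0: "0 \<le> bary T m x" if "m \<in> verts T" for m using x mem_iff that by blast
    have y0: "bary T m ?y = bary T m x" if "m \<in> verts T" "m \<noteq> a" "m \<noteq> b" for m
      using yb[OF that(1)] that(2,3) by simp
    have *: "\<exists>z\<in>T \<inter> closed_segment x ?y. \<psi> z = 0" if c: "bary T c ?y < 0" "c = a \<or> c = b" for c
    proof -
      have cv: "c \<in> verts T" using c ab by auto
      obtain t where t: "0 \<le> t" "t \<le> 1" "bary T c (x + t *\<^sub>R (?y - x)) = 0"
        using segment_zero[OF cv x0[OF cv] c(1)] by blast
      let ?z = "x + t *\<^sub>R (?y - x)"
      have sum: "bary T a ?z + bary T b ?z = bary T a x + bary T b x"
        unfolding bary_segment[OF ab(1)] bary_segment[OF ab(2)] yb[OF ab(1)] yb[OF ab(2)] using ab(3) by (simp add: algebra_simps)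
      have "0 \<le> bary T m ?z" if m: "m \<in> verts T" for m
      proof (cases "m = a \<or> m = b")
        case False
        then show ?thesis unfolding bary_segment[OF m] using x0[OF m] y0[OF m] t by simp
      next
        case True
        then show ?thesis using sum t(3) c(2) x0[OF ab(1)] x0[OF ab(2)] by auto
      qed
      then have zT: "?z \<in> T" using mem_iff by blast
      then have "\<psi> ?z = 0" using z opp_iff[OF cv] t(3) c(2) by blast
      then show ?thesis using zT in_segment[OF t(1,2)] by blast
    qed
    obtain m where m: "m \<in> verts T" "bary T m ?y < 0" using out mem_iff by (meson not_le)
    then have "m = a \<or> m = b" using y0[of m] x0[of m] by fastforce
    then show "\<exists>z\<in>T \<inter> closed_segment x ?y. \<psi> z = 0" using * m by blast
  qed auto
  then show ?thesis by simp
qed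

lemma measure_pos: "0 < measure lebesgue T"
proof -
  have "measure lebesgue (interior T) \<le> measure lebesgue T"
    using compact_cell by (intro measure_mono_fmeasurable interior_subset) (auto intro: lmeasurable_compact)
  moreover have "measure lebesgue (interior T) \<noteq> 0"
  proof
    assume "measure lebesgue (interior T) = 0"
    moreover have "interior T \<in> lmeasurable"
      using compact_imp_bounded[OF compact_cell] by (intro lmeasurable_open bounded_interior) auto
    ultimately have "negligible (interior T)" by (simp add: negligible_iff_measure)
    then show False using open_not_negligible[OF open_interior interior_nonempty] by blast
  qed
  ultimately show ?thesis using measure_nonneg[of lebesgue "interior T"] by linarith
qed

text \<open>An affine function that vanishes at all vertices but one is a multiple of a barycentric coordinate.\<close>
lemma affine_functional_eq_bary:
  assumes "m \<in> verts T" "\<And>x. f x = a \<bullet> x + c" "\<And>w. w \<in> verts T \<Longrightarrow> f w = (if w = m then r else 0)"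
  shows "f x = r * bary T m x" "a = r *\<^sub>R bgrad T m"
proof -
  have "a \<bullet> w + c = (r *\<^sub>R bgrad T m) \<bullet> w + r * bary T m 0" if "w \<in> verts T" for w
  proof -
    have "(r *\<^sub>R bgrad T m) \<bullet> w + r * bary T m 0 = r * bary T m w"
      by (subst bary_eq[OF assms(1), of w]) (simp add: distrib_left)
    then show ?thesis using assms(3)[OF that] assms(2)[of w] bary_vertex[OF assms(1) that] by simp
  qed
  note u = affine_functional_unique[OF this]
  show "a = r *\<^sub>R bgrad T m" by (rule u(1))
  show "f x = r * bary T m x"
    by (subst bary_eq[OF assms(1), of x]) (simp add: assms(2) u distrib_left)
qed

end

section \<open>Matching fluxes of two cells\<close>

text \<open>Both sides are the flux of \<open>\<phi>\<close> times a lowest-order Raviart-Thomas field through the common facet, and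
  the scaling by the volumes makes the two normal components equal. They are compared without a surface
  integral: the affine map \<open>M\<close> that fixes the facet and sends \<open>a1\<close> to \<open>a2\<close> carries one cell to the other
  and one field to the other, and \<open>\<phi> \<circ> M - \<phi>\<close> vanishes on the facet, so that \<open>gauss_dilation\<close> applies
  to it.\<close>
lemma flux_match:
  fixes T1 T2 :: "(real^'n) set" and \<phi> :: "real^'n \<Rightarrow> real"
  assumes "cell T1" "cell T2" and a: "a1 \<in> verts T1" "a2 \<in> verts T2" and F: "opp T1 a1 = opp T2 a2" and C: "C1 \<phi> G"
  shows "measure lebesgue T2 * integral\<^sup>L (lebesgue_on T1) (\<lambda>x. G x \<bullet> (x - a1) + CARD('n) * \<phi> x)
       = measure lebesgue T1 * integral\<^sup>L (lebesgue_on T2) (\<lambda>x. G x \<bullet> (x - a2) + CARD('n) * \<phi> x)"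
proof -
  interpret T1: cell T1 by fact
  interpret T2: cell T2 by fact
  define V where "V = verts T1 - {a1}"
  have V: "verts T1 = insert a1 V" "verts T2 = insert a2 V" "a1 \<notin> V" "a2 \<notin> V"
    using T1.verts_opp[OF a(1)] T2.verts_opp[OF a(2)] F a by (auto simp: V_def)
  define l1 where "l1 = bary T1 a1"
  define g1 where "g1 = bgrad T1 a1"
  have l1_eq: "l1 x = g1 \<bullet> x + l1 0" for x unfolding l1_def g1_def by (rule T1.bary_eq[OF a(1)])
  have l1V: "l1 w = 0" if "w \<in> V" for w using T1.bary_vertex[OF a(1), of w] that V by (auto simp: l1_def)
  define e where "e = a2 - a1"
  define M where "M x = x + l1 x *\<^sub>R e" for x
  define N where "N x = x - (bgrad T2 a2 \<bullet> x) *\<^sub>R e" for x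
  have Ma: "M a1 = a2" using T1.bary_vertex[OF a(1) a(1)] by (simp add: M_def e_def l1_def)
  have MV: "M w = w" if "w \<in> V" for w using l1V[OF that] by (simp add: M_def)
  have l1_T2: "l1 w = (if w = a2 then l1 a2 else 0)" if "w \<in> verts T2" for w using that V l1V by auto
  have g1: "g1 = l1 a2 *\<^sub>R bgrad T2 a2"
    by (rule T2.affine_functional_eq_bary(2)[OF a(2) l1_eq l1_T2])
  have g1e: "g1 \<bullet> e = l1 a2 - 1"
    using l1_eq[of a2] l1_eq[of a1] T1.bary_vertex[OF a(1) a(1)] by (simp add: e_def inner_diff_right l1_def)
  have MN: "M (y - N x) = M y - x" for x y
  proof -
    have "l1 (y - N x) = l1 y - g1 \<bullet> N x" using l1_eq[of "y - N x"] l1_eq[of y] by (simp add: inner_diff_right)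
    moreover have "g1 \<bullet> N x = bgrad T2 a2 \<bullet> x"
    proof -
      have "g1 \<bullet> N x = g1 \<bullet> x - (bgrad T2 a2 \<bullet> x) * (g1 \<bullet> e)" by (simp add: N_def inner_diff_right)
      also have "\<dots> = l1 a2 * (bgrad T2 a2 \<bullet> x) - (bgrad T2 a2 \<bullet> x) * (l1 a2 - 1)"
        unfolding g1e by (simp add: g1)
      finally show ?thesis by (simp add: algebra_simps)
    qed
    ultimately have "M (y - N x) = (y - N x) + (l1 y - bgrad T2 a2 \<bullet> x) *\<^sub>R e" by (simp add: M_def)
    then show ?thesis by (simp add: N_def M_def[of y] algebra_simps)
  qed
  have cM: "continuous_on S M" for S unfolding M_def l1_def by (intro continuous_intros T1.continuous_bary a)
  have baryM: "bary T2 m (M x) = (bgrad T2 m + (bgrad T2 m \<bullet> e) *\<^sub>R g1) \<bullet> x + bary T2 m (M 0)" if m: "m \<in> verts T2" for m x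
    using T2.bary_add[OF m, of x "l1 x *\<^sub>R e"] T2.bary_add[OF m, of 0 "l1 0 *\<^sub>R e"] T2.bary_eq[OF m, of x] l1_eq[of x]
    by (simp add: M_def inner_add_left algebra_simps)
  have bV: "bary T2 m (M x) = bary T1 m x" if m: "m \<in> V" for m x
  proof -
    have m2: "m \<in> verts T2" and m1: "m \<in> verts T1" using m V by auto
    have "bary T2 m (M w) = (if w = m then 1 else 0)" if w: "w \<in> verts T1" for w
      using w V m Ma MV T2.bary_vertex[OF m2] by auto
    from T1.affine_functional_eq_bary(1)[OF m1 baryM[OF m2] this] show ?thesis by simp
  qed
  have ba: "bary T2 a2 (M x) = bary T1 a1 x" for x
  proof -
    have "bary T2 a2 (M w) = (if w = a1 then 1 else 0)" if w: "w \<in> verts T1" for w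
      using w V a Ma MV T2.bary_vertex[OF a(2)] by auto
    from T1.affine_functional_eq_bary(1)[OF a(1) baryM[OF a(2)] this] show ?thesis by simp
  qed
  have MT: "M y \<in> T2 \<longleftrightarrow> y \<in> T1" for y
    unfolding T1.mem_iff T2.mem_iff V using bV ba by auto
  define H where "H y = G y \<bullet> (y - a2) + CARD('n) * \<phi> y" for y
  have cG: "continuous_on S G" for S by (rule C1_grad_continuous[OF C])
  have c\<phi>: "continuous_on S \<phi>" for S by (rule C1_continuous[OF C])
  have cH: "continuous_on S H" for S unfolding H_def by (intro continuous_intros cG c\<phi>)
  have 1: "measure lebesgue T2 * integral\<^sup>L (lebesgue_on T1) (\<lambda>y. H (M y)) = measure lebesgue T1 * integral\<^sup>L (lebesgue_on T2) H"
    by (rule integral_affine[OF T1.compact_cell T2.compact_cell cM MN MT cH])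
  define GM where "GM x = G (M x) + (G (M x) \<bullet> e) *\<^sub>R g1" for x
  have CM: "C1 (\<lambda>x. \<phi> (M x)) GM"
    unfolding C1_def
  proof (intro conjI allI)
    fix x
    have dM: "(M has_derivative (\<lambda>h. h + (g1 \<bullet> h) *\<^sub>R e)) (at x)"
      unfolding M_def l1_def g1_def
      by (intro derivative_intros has_derivative_scaleR_left T1.bary_has_derivative a)
    have d\<phi>: "(\<phi> has_derivative (\<lambda>h. G (M x) \<bullet> h)) (at (M x))" using C by (simp add: C1_def)
    from has_derivative_compose[OF dM d\<phi>]
    show "((\<lambda>x. \<phi> (M x)) has_derivative (\<lambda>h. GM x \<bullet> h)) (at x)"
      by (simp add: GM_def inner_add_left inner_add_right mult.commute)
    show "continuous_on UNIV GM" unfolding GM_def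
      by (intro continuous_intros continuous_on_compose2[OF cG cM]) auto
  qed
  have "integral\<^sup>L (lebesgue_on T1) (\<lambda>x. (GM x - G x) \<bullet> (x - a1) + CARD('n) * (\<phi> (M x) - \<phi> x)) = 0"
  proof (rule T1.gauss_dilation[OF a(1) C1_diff[OF CM C]])
    fix x assume "x \<in> opp T1 a1"
    then have "l1 x = 0" using T1.opp_iff[OF a(1)] by (simp add: l1_def)
    then show "\<phi> (M x) - \<phi> x = 0" by (simp add: M_def)
  qed
  moreover have "GM x \<bullet> (x - a1) = G (M x) \<bullet> (M x - a2)" for x
  proof -
    have "g1 \<bullet> (x - a1) = l1 x - 1"
      using l1_eq[of x] l1_eq[of a1] T1.bary_vertex[OF a(1) a(1)] by (simp add: inner_diff_right l1_def)
    then have "GM x \<bullet> (x - a1) = G (M x) \<bullet> (x - a1) + (G (M x) \<bullet> e) * (l1 x - 1)" by (simp add: GM_def inner_add_left)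
    moreover have "M x - a2 = (x - a1) + (l1 x - 1) *\<^sub>R e" by (simp add: M_def e_def algebra_simps)
    ultimately show ?thesis by (simp add: inner_add_right mult.commute)
  qed
  then have "(GM x - G x) \<bullet> (x - a1) + CARD('n) * (\<phi> (M x) - \<phi> x) = H (M x) - (G x \<bullet> (x - a1) + CARD('n) * \<phi> x)" for x
    by (simp add: H_def inner_diff_left algebra_simps)
  moreover have "integral\<^sup>L (lebesgue_on T1) (\<lambda>x. H (M x) - (G x \<bullet> (x - a1) + CARD('n) * \<phi> x))
     = integral\<^sup>L (lebesgue_on T1) (\<lambda>x. H (M x)) - integral\<^sup>L (lebesgue_on T1) (\<lambda>x. G x \<bullet> (x - a1) + CARD('n) * \<phi> x)"
    by (intro Bochner_Integration.integral_diff integrable_compact T1.compact_cell continuous_on_compose2[OF cH cM] continuous_intros cG c\<phi>) auto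
  ultimately have "integral\<^sup>L (lebesgue_on T1) (\<lambda>x. G x \<bullet> (x - a1) + CARD('n) * \<phi> x) = integral\<^sup>L (lebesgue_on T1) (\<lambda>x. H (M x))" by simp
  then show ?thesis using 1 by (simp add: H_def[abs_def])
qed

section \<open>Discrete fields with zero normal trace and the pressure\<close>

context mesh begin

lemma grad_in_L2: "C1 \<phi> G \<Longrightarrow> G \<in> L2 \<Omega>"
  by (intro continuous_in_L2 C1_grad_continuous bounded_domain domain_lebesgue)

lemma l2i_pw:
  fixes v :: "(real^'n) set \<Rightarrow> real^'n \<Rightarrow> 'b::euclidean_space"
  assumes v: "\<And>T. T \<in> Th \<Longrightarrow> continuous_on T (v T)" and g: "continuous_on UNIV g"
  shows "l2i (lebesgue_on \<Omega>) (pw Th v) g = (\<Sum>T\<in>Th. l2i (lebesgue_on T) (v T) g)"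
proof -
  have "pw Th v x \<bullet> g x = (\<Sum>T\<in>Th. indicator (interior T) x * (v T x \<bullet> g x))" for x
    by (simp add: pw_def inner_sum_left)
  then show ?thesis unfolding l2i_def
    by (simp only:) (intro integral_pieces integrable_inner_compact compact_cell v continuous_on_subset[OF g] subset_UNIV)
qed

text \<open>The cellwise divergence serves as weak divergence. Test functions with compact support in the domain
  are particular test functions for the normal trace.\<close>
lemma H0_divI:
  assumes v: "\<And>T. T \<in> Th \<Longrightarrow> v T \<in> Poly m UNIV"
    and z: "\<And>\<phi> G. C1 \<phi> G \<Longrightarrow> (\<Sum>T\<in>Th. integral\<^sup>L (lebesgue_on T) (\<lambda>x. v T x \<bullet> G x + vdiv (v T) x * \<phi> x)) = 0"
  shows "pw Th v \<in> H0_div \<Omega>"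
proof -
  have cv: "continuous_on S (v T)" if "T \<in> Th" for S T using Poly_continuous[OF subspace_UNIV v[OF that]] .
  have cd: "continuous_on S (pdiv v T)" if "T \<in> Th" for S T
    unfolding pdiv_def using Poly_continuous[OF subspace_UNIV Poly_vdiv[OF v[OF that]]] .
  have key: "l2i (lebesgue_on \<Omega>) (pw Th v) (grad \<phi>) + l2i (lebesgue_on \<Omega>) (pw Th (pdiv v)) \<phi> = 0" if "smooth \<phi>" for \<phi>
  proof -
    have C: "C1 \<phi> (grad \<phi>)" using C1_smooth[OF that] .
    note cg = C1_grad_continuous[OF C] and cp = C1_continuous[OF C]
    have "l2i (lebesgue_on \<Omega>) (pw Th v) (grad \<phi>) + l2i (lebesgue_on \<Omega>) (pw Th (pdiv v)) \<phi>
        = (\<Sum>T\<in>Th. l2i (lebesgue_on T) (v T) (grad \<phi>) + l2i (lebesgue_on T) (pdiv v T) \<phi>)"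
      by (simp add: l2i_pw[OF cv cg] l2i_pw[OF cd cp] sum.distrib)
    also have "\<dots> = (\<Sum>T\<in>Th. integral\<^sup>L (lebesgue_on T) (\<lambda>x. v T x \<bullet> grad \<phi> x + vdiv (v T) x * \<phi> x))"
    proof (rule sum.cong[OF refl])
      fix T assume T: "T \<in> Th"
      show "l2i (lebesgue_on T) (v T) (grad \<phi>) + l2i (lebesgue_on T) (pdiv v T) \<phi> = integral\<^sup>L (lebesgue_on T) (\<lambda>x. v T x \<bullet> grad \<phi> x + vdiv (v T) x * \<phi> x)"
        using integrable_inner_compact[OF compact_cell[OF T] cv[OF T] cg] integrable_inner_compact[OF compact_cell[OF T] cd[OF T] cp]
        by (simp add: l2i_def pdiv_def)
    qed
    also have "\<dots> = 0" by (rule z[OF C])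
    finally show ?thesis .
  qed
  have "weak_div \<Omega> (pw Th v) (pw Th (pdiv v))" unfolding weak_div_def using key by (simp add: eq_neg_iff_add_eq_0)
  moreover have "zero_normal_trace \<Omega> (pw Th v) (pw Th (pdiv v))" unfolding zero_normal_trace_def using key by blast
  moreover have "pw Th v \<in> L2 \<Omega>" "pw Th (pdiv v) \<in> L2 \<Omega>" by (intro pw_L2 cv cd; assumption)+
  ultimately show ?thesis unfolding H0_div_def by blast
qed

lemma Poly_zero_fun: "(\<lambda>x. 0) \<in> Poly m UNIV"
  using Poly_const[OF subspace_UNIV UNIV_I] .

lemma V_h_I:
  assumes v: "\<And>T. T \<in> Th \<Longrightarrow> v T \<in> Poly (k + 1) UNIV" "\<And>T. T \<notin> Th \<Longrightarrow> v T = (\<lambda>x. 0)"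
    and z: "\<And>\<phi> G. C1 \<phi> G \<Longrightarrow> (\<Sum>T\<in>Th. integral\<^sup>L (lebesgue_on T) (\<lambda>x. v T x \<bullet> G x + vdiv (v T) x * \<phi> x)) = 0"
  shows "v \<in> V_h \<Omega> Th k"
  unfolding V_h_def broken_def using H0_divI[OF v(1) z] v by blast

lemma Q_h_Poly: "p \<in> Q_h \<Omega> Th k \<Longrightarrow> T \<in> Th \<Longrightarrow> p T \<in> Poly k UNIV"
  by (simp add: Q_h_def broken_def)

lemma V_h_Poly: "v \<in> V_h \<Omega> Th k \<Longrightarrow> T \<in> Th \<Longrightarrow> v T \<in> Poly (k + 1) UNIV"
  by (simp add: V_h_def broken_def)

lemma ip_pdiv:
  assumes v: "v \<in> V_h \<Omega> Th k" and p: "p \<in> Q_h \<Omega> Th k"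
  shows "ip \<Omega> Th (pdiv v) p = (\<Sum>T\<in>Th. integral\<^sup>L (lebesgue_on T) (\<lambda>x. vdiv (v T) x * p T x))"
proof -
  have "ip \<Omega> Th (pdiv v) p = (\<Sum>T\<in>Th. l2i (lebesgue_on T) (pdiv v T) (p T))"
    by (rule ip_eq) (auto simp: pdiv_def intro!: Poly_continuous[OF subspace_UNIV] Poly_vdiv V_h_Poly[OF v] Q_h_Poly[OF p])
  then show ?thesis by (simp add: l2i_def pdiv_def)
qed

text \<open>Let \<open>D\<close> be the derivative of the pressure in the direction of the edge. The field
  \<open>bary T a * bary T b * D\<close> times the edge has degree \<open>k + 1\<close> and no flux through the boundary of \<open>T\<close>, so it
  is an admissible velocity. Integration by parts turns the pairing of its divergence with the pressure
  into a weighted integral of \<open>D\<^sup>2\<close>.\<close>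
lemma pressure_direction_derivative:
  assumes p: "p \<in> Q_h \<Omega> Th k" and z: "\<And>v. v \<in> V_h \<Omega> Th k \<Longrightarrow> ip \<Omega> Th (pdiv v) p = 0"
    and T: "T \<in> Th" and ab: "a \<in> verts T" "b \<in> verts T" "a \<noteq> b"
  shows "frechet_derivative (p T) (at x) (b - a) = 0"
proof (cases "k = 0")
  case True
  then obtain c where "p T = (\<lambda>x. c)" using Q_h_Poly[OF p T] by (auto simp: Poly_0_iff)
  then show ?thesis using frechet_derivative_at[OF has_derivative_const, of c x] by (metis (no_types))
next
  case False
  interpret T: cell T by (rule cell[OF T])
  let ?q = "p T" and ?t = "b - a"
  define D where "D x = frechet_derivative ?q (at x) ?t" for x
  have q: "?q \<in> Poly k UNIV" by (rule Q_h_Poly[OF p T])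
  have D: "D \<in> Poly (k - 1) UNIV" unfolding D_def[abs_def] by (rule Poly_frechet_derivative[OF subspace_UNIV q])
  have Dg: "grad ?q x \<bullet> ?t = D x" for x unfolding D_def by (rule grad_Poly_direction[OF q])
  define w where "w x = bary T a x * (bary T b x * D x)" for x
  have w: "w \<in> Poly (k + 1) UNIV"
    using T.Poly_bary_mult[OF subspace_UNIV T.Poly_bary_mult[OF subspace_UNIV D ab(2)] ab(1)] False
    by (simp add: w_def[abs_def])
  note CW = C1_Poly[OF w]
  have w0: "w x = 0" if "x \<in> opp T a \<or> x \<in> opp T b" for x
    using that T.opp_iff[OF ab(1)] T.opp_iff[OF ab(2)] by (auto simp: w_def)
  have gauss: "integral\<^sup>L (lebesgue_on T) (\<lambda>x. (w x *\<^sub>R ?t) \<bullet> G x + vdiv (\<lambda>x. w x *\<^sub>R ?t) x * \<phi> x) = 0" if C: "C1 \<phi> G" for \<phi> G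
  proof -
    have "integral\<^sup>L (lebesgue_on T) (\<lambda>x. (w x *\<^sub>R G x + \<phi> x *\<^sub>R grad w x) \<bullet> ?t) = 0"
      by (rule T.gauss_edge[OF ab C1_mult[OF CW C]]) (simp_all add: w0)
    moreover have "(w x *\<^sub>R G x + \<phi> x *\<^sub>R grad w x) \<bullet> ?t = (w x *\<^sub>R ?t) \<bullet> G x + vdiv (\<lambda>x. w x *\<^sub>R ?t) x * \<phi> x" for x
      unfolding vdiv_scaled_const[OF CW] by (simp add: inner_add_left inner_commute[of ?t] mult.commute)
    ultimately show ?thesis by simp
  qed
  define v where "v S = (if S = T then (\<lambda>x. w x *\<^sub>R ?t) else (\<lambda>x. 0))" for S
  have wt: "(\<lambda>x. w x *\<^sub>R ?t) \<in> Poly (k + 1) UNIV"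
    by (rule Poly_map[OF _ UNIV_I w]) (auto intro!: linearI simp: scaleR_add_left)
  have single: "(\<Sum>S\<in>Th. integral\<^sup>L (lebesgue_on S) (\<lambda>x. v S x \<bullet> G S x + vdiv (v S) x * \<phi> S x))
     = integral\<^sup>L (lebesgue_on T) (\<lambda>x. (w x *\<^sub>R ?t) \<bullet> G T x + vdiv (\<lambda>x. w x *\<^sub>R ?t) x * \<phi> T x)" for G \<phi>
    by (subst sum.remove[OF finite_Th T]) (simp add: v_def vdiv_zero)
  have vV: "v \<in> V_h \<Omega> Th k"
  proof (rule V_h_I)
    show "v S \<in> Poly (k + 1) UNIV" for S unfolding v_def using wt by (auto intro: Poly_zero_fun)
    show "v S = (\<lambda>x. 0)" if "S \<notin> Th" for S using that T by (auto simp: v_def)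
    show "(\<Sum>S\<in>Th. integral\<^sup>L (lebesgue_on S) (\<lambda>x. v S x \<bullet> G x + vdiv (v S) x * \<phi> x)) = 0" if "C1 \<phi> G" for \<phi> G
      using single[of "\<lambda>_. G" "\<lambda>_. \<phi>"] gauss[OF that] by simp
  qed
  have "integral\<^sup>L (lebesgue_on T) (\<lambda>x. vdiv (\<lambda>x. w x *\<^sub>R ?t) x * ?q x) = 0"
    using z[OF vV] single[of "\<lambda>_ _. 0" p] unfolding ip_pdiv[OF vV p] by simp
  moreover have "integral\<^sup>L (lebesgue_on T) (\<lambda>x. (w x *\<^sub>R ?t) \<bullet> grad ?q x + vdiv (\<lambda>x. w x *\<^sub>R ?t) x * ?q x)
     = integral\<^sup>L (lebesgue_on T) (\<lambda>x. (w x *\<^sub>R ?t) \<bullet> grad ?q x) + integral\<^sup>L (lebesgue_on T) (\<lambda>x. vdiv (\<lambda>x. w x *\<^sub>R ?t) x * ?q x)"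
    by (intro Bochner_Integration.integral_add integrable_compact T.compact_cell continuous_intros C1_grad_continuous[OF C1_Poly[OF q]]
      Poly_continuous[OF subspace_UNIV wt] Poly_continuous[OF subspace_UNIV Poly_vdiv[OF wt]] Poly_continuous[OF subspace_UNIV q] Poly_continuous[OF subspace_UNIV w])
  ultimately have "integral\<^sup>L (lebesgue_on T) (\<lambda>x. (w x *\<^sub>R ?t) \<bullet> grad ?q x) = 0"
    using gauss[OF C1_Poly[OF q]] by simp
  moreover have e: "(w x *\<^sub>R ?t) \<bullet> grad ?q x = bary T a x * bary T b x * (D x)\<^sup>2" for x
    using Dg[of x] by (simp add: w_def inner_commute power2_eq_square)
  ultimately have i: "integral\<^sup>L (lebesgue_on T) (\<lambda>x. bary T a x * bary T b x * (D x)\<^sup>2) = 0" by simp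
  have c: "continuous_on T (\<lambda>x. bary T a x * bary T b x * (D x)\<^sup>2)"
    by (intro continuous_intros T.continuous_bary ab Poly_continuous[OF subspace_UNIV D])
  have nn: "0 \<le> bary T a x * bary T b x * (D x)\<^sup>2" if "x \<in> T" for x
    using that ab T.mem_iff by simp
  have "D = (\<lambda>x. 0)"
  proof (rule Poly_zero_on_open[OF subspace_UNIV D T.bary_pos(1,2)])
    fix x assume x: "x \<in> T.bary_pos"
    then have "x \<in> interior T" using T.bary_pos(3) by blast
    from integral_zero_on_interior[OF T.compact_cell c nn i this]
    show "D x = 0" using x ab by (auto simp: T.bary_pos_def)
  qed
  then show ?thesis by (simp add: D_def fun_eq_iff)
qed

lemma pressure_cellwise_constant:
  assumes p: "p \<in> Q_h \<Omega> Th k" and z: "\<And>v. v \<in> V_h \<Omega> Th k \<Longrightarrow> ip \<Omega> Th (pdiv v) p = 0" and T: "T \<in> Th"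
  shows "\<exists>c. p T = (\<lambda>x. c)"
proof -
  interpret T: cell T by (rule cell[OF T])
  have q: "p T \<in> Poly k UNIV" by (rule Q_h_Poly[OF p T])
  note h = Poly_has_derivative[OF subspace_UNIV q]
  obtain a where a: "a \<in> verts T" using T.verts_props(3) by (metis card_eq_0_iff all_not_in_conv add_is_0 zero_neq_one)
  have "frechet_derivative (p T) (at x) = (\<lambda>h. 0)" for x
  proof
    fix u
    have l: "linear (frechet_derivative (p T) (at x))" using h has_derivative_linear by blast
    have "frechet_derivative (p T) (at x) u = frechet_derivative (p T) (at x) (\<Sum>v\<in>verts T. (bgrad T v \<bullet> u) *\<^sub>R (v - a))"
      by (simp add: T.bgrad_repr_from)
    also have "\<dots> = (\<Sum>v\<in>verts T. (bgrad T v \<bullet> u) * frechet_derivative (p T) (at x) (v - a))"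
      by (simp add: linear_sum[OF l] linear_scale[OF l])
    also have "\<dots> = 0"
    proof (rule sum.neutral, rule ballI)
      fix v assume v: "v \<in> verts T"
      show "(bgrad T v \<bullet> u) * frechet_derivative (p T) (at x) (v - a) = 0"
        using pressure_direction_derivative[OF p z T a v] linear_0[OF l] by (cases "a = v") auto
    qed
    finally show "frechet_derivative (p T) (at x) u = 0" .
  qed
  then have "(p T has_derivative (\<lambda>h. 0)) (at x within UNIV)" for x using h[of x] by simp
  then obtain c where "\<And>x. x \<in> UNIV \<Longrightarrow> p T x = c" using has_derivative_zero_constant[of UNIV "p T"] by auto
  then show ?thesis by (intro exI[of _ c]) auto
qed

text \<open>The pair of Raviart-Thomas fields of \<open>flux_match\<close>, with opposite signs in the two cells, is an
  admissible velocity whose divergence tests the difference of the two constants.\<close>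
lemma pressure_neighbours:
  assumes p: "p \<in> Q_h \<Omega> Th k" and z: "\<And>v. v \<in> V_h \<Omega> Th k \<Longrightarrow> ip \<Omega> Th (pdiv v) p = 0"
    and T: "T1 \<in> Th" "T2 \<in> Th" "F \<in> facets_of T1" "F \<in> facets_of T2"
  shows "p T1 = p T2"
proof (cases "T1 = T2")
  case False
  interpret T1: cell T1 by (rule cell[OF T(1)])
  interpret T2: cell T2 by (rule cell[OF T(2)])
  obtain a1 where a1: "a1 \<in> verts T1" "F = opp T1 a1" using facetE[OF T(1,3)] by blast
  obtain a2 where a2: "a2 \<in> verts T2" "F = opp T2 a2" using facetE[OF T(2,4)] by blast
  obtain c1 c2 where c: "p T1 = (\<lambda>x. c1)" "p T2 = (\<lambda>x. c2)"
    using pressure_cellwise_constant[OF p z T(1)] pressure_cellwise_constant[OF p z T(2)] by blast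
  define m1 m2 where "m1 = measure lebesgue T1" and "m2 = measure lebesgue T2"
  have m: "m1 > 0" "m2 > 0" using T1.measure_pos T2.measure_pos by (simp_all add: m1_def m2_def)
  define v where "v S = (if S = T1 then (\<lambda>x. (1 / m1) *\<^sub>R (x - a1)) else if S = T2 then (\<lambda>x. (- 1 / m2) *\<^sub>R (x - a2)) else (\<lambda>x. 0))" for S
  have Pid: "(\<lambda>x. r *\<^sub>R (x - a)) \<in> Poly (k + 1) (UNIV :: (real^'n) set)" for r a
  proof -
    have "(\<lambda>x. r *\<^sub>R x + (- r) *\<^sub>R a) \<in> Poly 1 (UNIV :: (real^'n) set)"
      by (intro Poly_add Poly_scale Poly_id subspace_UNIV Poly_const) simp
    then have *: "(\<lambda>x. r *\<^sub>R (x - a)) \<in> Poly 1 (UNIV :: (real^'n) set)" by (simp add: scaleR_diff_right)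
    show ?thesis by (rule Poly_mono[OF subspace_UNIV _ subset_UNIV *]) simp
  qed
  have pair: "(\<Sum>S\<in>Th. integral\<^sup>L (lebesgue_on S) (\<lambda>x. v S x \<bullet> G S x + vdiv (v S) x * \<phi> S x))
     = integral\<^sup>L (lebesgue_on T1) (\<lambda>x. (1 / m1) * (G T1 x \<bullet> (x - a1) + CARD('n) * \<phi> T1 x))
       + integral\<^sup>L (lebesgue_on T2) (\<lambda>x. (- 1 / m2) * (G T2 x \<bullet> (x - a2) + CARD('n) * \<phi> T2 x))"
    for G and \<phi> :: "(real^'n) set \<Rightarrow> real^'n \<Rightarrow> real"
  proof -
    have T2': "T2 \<in> Th - {T1}" using T False by auto
    have fin: "finite (Th - {T1})" using finite_Th by simp
    have "(\<Sum>S\<in>Th. integral\<^sup>L (lebesgue_on S) (\<lambda>x. v S x \<bullet> G S x + vdiv (v S) x * \<phi> S x))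
      = integral\<^sup>L (lebesgue_on T1) (\<lambda>x. v T1 x \<bullet> G T1 x + vdiv (v T1) x * \<phi> T1 x)
       + (integral\<^sup>L (lebesgue_on T2) (\<lambda>x. v T2 x \<bullet> G T2 x + vdiv (v T2) x * \<phi> T2 x)
       + (\<Sum>S\<in>Th - {T1} - {T2}. integral\<^sup>L (lebesgue_on S) (\<lambda>x. v S x \<bullet> G S x + vdiv (v S) x * \<phi> S x)))"
      unfolding sum.remove[OF finite_Th T(1)] sum.remove[OF fin T2'] ..
    moreover have "(\<Sum>S\<in>Th - {T1} - {T2}. integral\<^sup>L (lebesgue_on S) (\<lambda>x. v S x \<bullet> G S x + vdiv (v S) x * \<phi> S x)) = 0"
      by (intro sum.neutral ballI) (simp add: v_def vdiv_zero)
    moreover have "v T1 x \<bullet> G T1 x + vdiv (v T1) x * \<phi> T1 x = (1 / m1) * (G T1 x \<bullet> (x - a1) + CARD('n) * \<phi> T1 x)" for x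
    proof -
      have v1: "v T1 = (\<lambda>x. (1 / m1) *\<^sub>R (x - a1))" by (simp add: v_def)
      show ?thesis unfolding v1 vdiv_dilation by (simp add: inner_commute distrib_left)
    qed
    moreover have "v T2 x \<bullet> G T2 x + vdiv (v T2) x * \<phi> T2 x = (- 1 / m2) * (G T2 x \<bullet> (x - a2) + CARD('n) * \<phi> T2 x)" for x
    proof -
      have v2: "v T2 = (\<lambda>x. (- 1 / m2) *\<^sub>R (x - a2))" using False by (simp add: v_def)
      show ?thesis unfolding v2 vdiv_dilation by (simp add: inner_commute distrib_left)
    qed
    ultimately show ?thesis by simp
  qed
  have vV: "v \<in> V_h \<Omega> Th k"
  proof (rule V_h_I)
    show "v S \<in> Poly (k + 1) UNIV" for S
      unfolding v_def
      by (split if_split, intro conjI impI, rule Pid, split if_split, intro conjI impI, rule Pid, rule Poly_zero_fun)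
    show "v S = (\<lambda>x. 0)" if "S \<notin> Th" for S using that T by (auto simp: v_def)
    show "(\<Sum>S\<in>Th. integral\<^sup>L (lebesgue_on S) (\<lambda>x. v S x \<bullet> G x + vdiv (v S) x * \<phi> x)) = 0" if C: "C1 \<phi> G" for \<phi> G
    proof -
      have "m2 * integral\<^sup>L (lebesgue_on T1) (\<lambda>x. G x \<bullet> (x - a1) + CARD('n) * \<phi> x) = m1 * integral\<^sup>L (lebesgue_on T2) (\<lambda>x. G x \<bullet> (x - a2) + CARD('n) * \<phi> x)"
        unfolding m1_def m2_def by (rule flux_match[OF cell[OF T(1)] cell[OF T(2)] a1(1) a2(1) _ C]) (use a1 a2 in simp)
      then show ?thesis unfolding pair[of "\<lambda>_. G" "\<lambda>_. \<phi>"] integral_mult_right_zero using m by (simp add: field_simps)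
    qed
  qed
  have meas: "integral\<^sup>L (lebesgue_on A) (\<lambda>x. c) = c * measure lebesgue A" if "compact A" for A :: "(real^'n) set" and c :: real
    using compact_sets_lebesgue[OF that] by (simp add: measure_restrict_space)
  have "0 = integral\<^sup>L (lebesgue_on T1) (\<lambda>x. (1 / m1) * (CARD('n) * c1)) + integral\<^sup>L (lebesgue_on T2) (\<lambda>x. (- 1 / m2) * (CARD('n) * c2))"
    using z[OF vV] pair[of "\<lambda>_ _. 0" p] unfolding ip_pdiv[OF vV p] c by simp
  also have "\<dots> = CARD('n) * c1 - CARD('n) * c2"
    unfolding meas[OF T1.compact_cell] meas[OF T2.compact_cell] using m by (simp add: m1_def m2_def)
  finally show ?thesis using c by simp
qed simp

lemma low_dim_affine_negligible: "aff_dim S < int DIM('a) \<Longrightarrow> negligible (affine hull (S :: 'a::euclidean_space set))"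
proof -
  assume "aff_dim S < int DIM('a)"
  then have "interior (affine hull S) = {}" using aff_dim_nonempty_interior[of "affine hull S"] by auto
  then show ?thesis using negligible_convex_interior[OF affine_imp_convex[OF affine_affine_hull]] by blast
qed

lemma inter_facet:
  assumes "S \<in> Th" "S' \<in> Th" "S \<noteq> S'" "aff_dim (S \<inter> S') \<ge> int CARD('n) - 1" "S \<inter> S' \<noteq> {}"
  shows "S \<inter> S' \<in> facets_of S"
proof -
  interpret S: cell S by (rule cell[OF assms(1)])
  interpret S': cell S' by (rule cell[OF assms(2)])
  have d: "aff_dim S = int CARD('n)" using aff_dim_simplex[OF S.simplex] .
  have ne: "S \<inter> S' \<noteq> S"
  proof
    assume e: "S \<inter> S' = S"
    then have "interior S \<inter> interior S' \<noteq> {}" using S.interior_nonempty interior_mono[of S S'] by blast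
    then show False using disjoint_interiors assms by blast
  qed
  have f: "(S \<inter> S') face_of S" by (rule face_inter[OF assms(1,2)])
  have "aff_dim (S \<inter> S') < aff_dim S" by (rule face_of_aff_dim_lt[OF S.convex_cell f ne])
  then show ?thesis using f assms d by (simp add: facets_of_def facet_of_def)
qed

lemma interior_point_unique:
  assumes "S \<in> Th" "S' \<in> Th" "y \<in> interior S" "y \<in> S'"
  shows "S = S'"
proof -
  interpret S': cell S' by (rule cell[OF assms(2)])
  have "y \<in> closure (interior S')"
    using convex_closure_interior[OF S'.convex_cell S'.interior_nonempty] assms(4) closure_subset by blast
  then have "interior S \<inter> interior S' \<noteq> {}"
    using assms(3) open_Int_closure_eq_empty[OF open_interior, of S "interior S'"] by blast
  then show ?thesis using disjoint_interiors assms by blast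
qed

text \<open>Otherwise the domain is covered by two closed unions of cells on which \<open>c\<close> differs, and by connectedness
  they meet at some point of the domain. Near it, join interior points of one cell of each kind by a
  segment. For a generic endpoint the segment misses all intersections of cells of codimension two or
  more, so it passes from one union to the other through a common facet.\<close>
lemma facet_connected:
  fixes c :: "(real^'n) set \<Rightarrow> 'c"
  assumes nb: "\<And>T1 T2 F. T1 \<in> Th \<Longrightarrow> T2 \<in> Th \<Longrightarrow> F \<in> facets_of T1 \<Longrightarrow> F \<in> facets_of T2 \<Longrightarrow> c T1 = c T2"
    and T: "T0 \<in> Th" "T1 \<in> Th"
  shows "c T0 = c T1"
proof (rule ccontr)
  assume ne: "c T0 \<noteq> c T1"
  define A where "A = \<Union>{S \<in> Th. c S = c T0}"
  define B where "B = \<Union>{S \<in> Th. c S \<noteq> c T0}"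
  have cl: "closed A" "closed B" unfolding A_def B_def
    using finite_Th compact_cell by (auto intro!: closed_Union compact_imp_closed)
  have cov: "\<Omega> \<subseteq> A \<union> B" using domain_subset by (auto simp: A_def B_def)
  have meet: "\<Omega> \<inter> S \<noteq> {}" if "S \<in> Th" for S
    using interior_cell_subset[OF that] cell.interior_nonempty[OF cell[OF that]] interior_subset[of S] by blast
  have "A \<inter> \<Omega> \<noteq> {}" "B \<inter> \<Omega> \<noteq> {}" 
  proof -
    have "T0 \<subseteq> A" "T1 \<subseteq> B" using T ne by (auto simp: A_def B_def)
    then show "A \<inter> \<Omega> \<noteq> {}" "B \<inter> \<Omega> \<noteq> {}" using meet[OF T(1)] meet[OF T(2)] by blast+
  qed
  moreover have "connected \<Omega>" using domain by (simp add: polytopal_domain_def)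
  ultimately have "A \<inter> B \<inter> \<Omega> \<noteq> {}" using connected_closedD[of \<Omega> A B] cl cov by blast
  then obtain x S1 S2 where x: "x \<in> \<Omega>" "x \<in> S1" "x \<in> S2" "S1 \<in> Th" "S2 \<in> Th" "c S1 = c T0" "c S2 \<noteq> c T0"
    by (auto simp: A_def B_def)
  obtain r where r: "r > 0" "ball x r \<subseteq> \<Omega>" using open_domain x(1) open_contains_ball by blast
  have near: "ball x r \<inter> interior S \<noteq> {}" if "S \<in> Th" "x \<in> S" for S
  proof -
    interpret S: cell S by (rule cell[OF that(1)])
    have "x \<in> closure (interior S)"
      using convex_closure_interior[OF S.convex_cell S.interior_nonempty] that(2) closure_subset by blast
    then show ?thesis using open_Int_closure_eq_empty[OF open_ball, of x r "interior S"] r(1) centre_in_ball[of x r] by blast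
  qed
  obtain y1 where y1: "y1 \<in> ball x r" "y1 \<in> interior S1" using near[OF x(4,2)] by blast
  \<comment> \<open>The endpoint \<open>y2\<close> must avoid the affine spans of \<open>y1\<close> with the small intersections; these form a null set.\<close>
  define P where "P = {p \<in> Th \<times> Th. aff_dim (fst p \<inter> snd p) \<le> int CARD('n) - 2}"
  define bad where "bad = \<Union>((\<lambda>p. affine hull (insert y1 (fst p \<inter> snd p))) ` P)"
  have "finite P" unfolding P_def using finite_Th by simp
  then have fin: "finite ((\<lambda>p. affine hull (insert y1 (fst p \<inter> snd p))) ` P)" by (rule finite_imageI)
  have hull: "negligible (affine hull (insert y1 K))" if "aff_dim K \<le> int CARD('n) - 2" for K
  proof (rule low_dim_affine_negligible)
    have "aff_dim (insert y1 K) \<le> aff_dim K + 1" by (simp add: aff_dim_insert)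
    then show "aff_dim (insert y1 K) < int DIM(real^'n)" using that by simp
  qed
  have neg: "negligible bad" unfolding bad_def
  proof (rule negligible_Union[OF fin])
    fix t assume "t \<in> (\<lambda>p. affine hull (insert y1 (fst p \<inter> snd p))) ` P"
    then obtain p where p: "p \<in> P" "t = affine hull (insert y1 (fst p \<inter> snd p))" by blast
    have "aff_dim (fst p \<inter> snd p) \<le> int CARD('n) - 2" using p(1) unfolding P_def by blast
    then show "negligible t" unfolding p(2) by (rule hull)
  qed
  have "\<not> negligible (ball x r \<inter> interior S2)"
    by (rule open_not_negligible[OF open_Int[OF open_ball open_interior] near[OF x(5,3)]])
  then have "\<not> ball x r \<inter> interior S2 \<subseteq> bad" using negligible_subset[OF neg] by blast
  then obtain y2 where y2: "y2 \<in> ball x r" "y2 \<in> interior S2" "y2 \<notin> bad" by blast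
  let ?L = "closed_segment y1 y2"
  have "?L \<subseteq> ball x r" using y1(1) y2(1) by (simp add: closed_segment_subset)
  then have "?L \<subseteq> A \<union> B" using r(2) cov by blast
  moreover have "y1 \<in> A" using y1(2) x(4,6) interior_subset[of S1] unfolding A_def by blast
  then have "A \<inter> ?L \<noteq> {}" using ends_in_segment(1)[of y1 y2] by blast
  moreover have "y2 \<in> B" using y2(2) x(5,7) interior_subset[of S2] unfolding B_def by blast
  then have "B \<inter> ?L \<noteq> {}" using ends_in_segment(2)[of y2 y1] by blast
  ultimately have "A \<inter> B \<inter> ?L \<noteq> {}" using connected_closedD[OF connected_segment(1), of A B] cl by blast
  then obtain z S S' where z: "z \<in> ?L" "z \<in> S" "z \<in> S'" "S \<in> Th" "S' \<in> Th" "c S = c T0" "c S' \<noteq> c T0"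
    by (auto simp: A_def B_def)
  have SS: "S \<noteq> S'" using z by auto
  show False
  proof (cases "aff_dim (S \<inter> S') \<le> int CARD('n) - 2")
    case True
    have zy: "z \<noteq> y1"
    proof
      assume "z = y1"
      then have "y1 \<in> S" "y1 \<in> S'" using z(2,3) by simp_all
      then have "S1 = S" "S1 = S'"
        using interior_point_unique[OF x(4) z(4) y1(2)] interior_point_unique[OF x(4) z(5) y1(2)] by blast+
      then show False using SS by simp
    qed
    obtain u where u: "0 \<le> u" "u \<le> 1" "z = (1 - u) *\<^sub>R y1 + u *\<^sub>R y2" using z(1) by (auto simp: closed_segment_def)
    then have u0: "u \<noteq> 0" using zy by auto
    have "(1 / u) *\<^sub>R z = (1 / u - 1) *\<^sub>R y1 + y2"
      using u0 unfolding u(3) by (simp add: scaleR_add_right diff_divide_distrib)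
    then have "y2 = (1 - 1 / u) *\<^sub>R y1 + (1 / u) *\<^sub>R z" by (simp add: algebra_simps)
    moreover have "(1 - 1 / u) *\<^sub>R y1 + (1 / u) *\<^sub>R z \<in> affine hull (insert y1 (S \<inter> S'))"
      using z(2,3) by (intro mem_affine[OF affine_affine_hull]) (auto intro: hull_inc)
    moreover have "(S, S') \<in> P" using True z(4,5) by (simp add: P_def)
    then have "affine hull (insert y1 (S \<inter> S')) \<subseteq> bad" unfolding bad_def by force
    ultimately have "y2 \<in> bad" by (metis subsetD)
    then show False using y2(3) by simp
  next
    case False
    then have d: "aff_dim (S \<inter> S') \<ge> int CARD('n) - 1" by simp
    have "S \<inter> S' \<in> facets_of S" by (rule inter_facet[OF z(4,5) SS d]) (use z(2,3) in blast)
    moreover have "S' \<inter> S \<in> facets_of S'"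
      by (rule inter_facet[OF z(5,4) SS[symmetric]]) (use d z(2,3) in \<open>simp_all add: Int_commute, blast\<close>)
    ultimately have "c S = c S'" using nb[OF z(4,5), of "S \<inter> S'"] Int_commute[of S S'] by simp
    then show False using z(6,7) by simp
  qed
qed

lemma Th_nonempty: "Th \<noteq> {}"
  using domain domain_subset by (auto simp: polytopal_domain_def)

text \<open>The pressure is one constant on all cells, and its mean vanishes.\<close>
lemma pressure_zero:
  assumes p: "p \<in> Q_h \<Omega> Th k" and z: "\<And>v. v \<in> V_h \<Omega> Th k \<Longrightarrow> ip \<Omega> Th (pdiv v) p = 0"
  shows "p = 0"
proof -
  obtain T0 where T0: "T0 \<in> Th" using Th_nonempty by blast
  obtain c where c: "p T0 = (\<lambda>x. c)" using pressure_cellwise_constant[OF p z T0] by blast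
  have pc: "p T = (\<lambda>x. c)" if "T \<in> Th" for T
    using facet_connected[of p, OF pressure_neighbours[OF p z] T0 that] c by simp
  have "0 = (\<integral>x. pw Th p x \<partial>lebesgue_on \<Omega>)" using p by (simp add: Q_h_def)
  also have "\<dots> = (\<integral>x. (\<Sum>T\<in>Th. indicator (interior T) x * c) \<partial>lebesgue_on \<Omega>)"
    unfolding pw_def by (simp add: pc)
  also have "\<dots> = (\<Sum>T\<in>Th. integral\<^sup>L (lebesgue_on T) (\<lambda>x. c))"
    by (rule integral_pieces(2)) (intro integrable_compact compact_cell continuous_intros)
  also have "\<dots> = (\<Sum>T\<in>Th. c * measure lebesgue T)"
    by (rule sum.cong[OF refl]) (use compact_sets_lebesgue[OF compact_cell] in \<open>simp add: measure_restrict_space\<close>)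
  also have "\<dots> = c * (\<Sum>T\<in>Th. measure lebesgue T)" by (simp add: sum_distrib_left)
  finally have "c = 0 \<or> (\<Sum>T\<in>Th. measure lebesgue T) = 0" by simp
  moreover have "(\<Sum>T\<in>Th. measure lebesgue T) > 0"
    using Th_nonempty finite_Th cell.measure_pos[OF cell] by (intro sum_pos) auto
  ultimately have "c = 0" by simp
  then have "p T = (\<lambda>x. 0)" for T using pc p by (cases "T \<in> Th") (auto simp: Q_h_def broken_def)
  then show ?thesis by (simp add: fun_eq_iff)
qed

end

section \<open>Global spaces and forms\<close>

lemma lincomb_apply: "(a *\<^sub>R x + b *\<^sub>R y) T = (\<lambda>z. a *\<^sub>R x T z + b *\<^sub>R y T z)"
  by (simp add: fun_eq_iff)

lemma subspace_broken:
  assumes "\<And>T. T \<in> Th \<Longrightarrow> subspace (S T)"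
  shows "subspace (broken Th S)"
proof (rule subspaceI)
  show "0 \<in> broken Th S" using subspace_0[OF assms] by (simp add: broken_def zero_fun_def)
  show "x + y \<in> broken Th S" if "x \<in> broken Th S" "y \<in> broken Th S" for x y
    using that subspace_add[OF assms] by (auto simp: broken_def fun_eq_iff)
  show "c *\<^sub>R x \<in> broken Th S" if "x \<in> broken Th S" for c x
    using that subspace_scale[OF assms] by (auto simp: broken_def fun_eq_iff)
qed

lemma fin_dim_broken:
  fixes S :: "(real^'n) set \<Rightarrow> (real^'n \<Rightarrow> 'b::real_vector) set"
  assumes fin: "finite Th" and S: "\<And>T. T \<in> Th \<Longrightarrow> fin_dim (S T)"
  shows "fin_dim (broken Th S)"
proof -
  define e where "e T f = (\<lambda>R. if R = T then f else (\<lambda>x. 0))" for T :: "(real^'n) set" and f :: "real^'n \<Rightarrow> 'b"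
  have lin: "linear (e T)" for T by (rule linearI) (auto simp: e_def fun_eq_iff)
  show ?thesis
  proof (rule fin_dim_sums[OF fin])
    show "fin_dim (e T ` S T)" if "T \<in> Th" for T by (rule fin_dim_linear_image[OF lin S[OF that]])
    fix w assume w: "w \<in> broken Th S"
    have "w R = (\<Sum>T\<in>Th. e T (w T)) R" for R
    proof -
      have "(\<Sum>T\<in>Th. e T (w T)) R x = (\<Sum>T\<in>Th. if R = T then w T x else 0)" for x
        unfolding sum_fun_apply by (rule sum.cong) (auto simp: e_def)
      then show ?thesis using w fin by (auto simp: fun_eq_iff broken_def)
    qed
    then have "w = (\<Sum>T\<in>Th. e T (w T))" by (rule ext)
    moreover have "\<forall>T\<in>Th. e T (w T) \<in> e T ` S T" using w by (simp add: broken_def)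
    ultimately show "\<exists>u. (\<forall>T\<in>Th. u T \<in> e T ` S T) \<and> w = (\<Sum>T\<in>Th. u T)"
      by (intro exI[of _ "\<lambda>T. e T (w T)"] conjI)
  qed
qed

lemma lin_on_const_mult: "lin_on W g \<Longrightarrow> lin_on W (\<lambda>x. c * g x)"
  by (auto simp: lin_on_def algebra_simps)

lemma lin_on_plus: "lin_on W f \<Longrightarrow> lin_on W g \<Longrightarrow> lin_on W (\<lambda>x. f x + g x)"
  by (auto simp: lin_on_def algebra_simps)

lemma lin_on_setsum: "(\<And>i. i \<in> I \<Longrightarrow> lin_on W (f i)) \<Longrightarrow> lin_on W (\<lambda>x. \<Sum>i\<in>I. f i x)"
  by (auto simp: lin_on_def sum.distrib sum_distrib_left)

lemma lin_on_neg: "lin_on W g \<Longrightarrow> lin_on W (\<lambda>x. - g x)"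
  by (auto simp: lin_on_def)

lemma linear_mat_inner: "linear (\<lambda>M :: real^'n^'n. n \<bullet> (M *v m))"
  by (rule linearI) (simp_all add: matrix_vector_mult_add_rdistrib inner_add_right flip: scaleR_matrix_vector_assoc)

locale hybrid = mesh \<Omega> Th nF
  for \<Omega> :: "(real^'n) set" and Th :: "(real^'n) set set" and nF :: "(real^'n) set \<Rightarrow> real^'n" +
  fixes j :: "(real^'n) set \<Rightarrow> real^'n \<Rightarrow> real^'n" and k :: nat and \<nu> :: real
  assumes j: "\<And>T l. T \<in> Th \<Longrightarrow> l \<in> verts T \<Longrightarrow> j T l \<in> verts T - {l}"
    and \<nu>: "0 < \<nu>"
begin

lemma stress: assumes T: "T \<in> Th" shows "stress_cell T nF j"
proof -
  have "opp T l \<in> facets_of T" if "l \<in> verts T" for l using cell.facets_of_eq[OF cell[OF T]] that by blast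
  then show ?thesis
    using cell[OF T] facet_normal_cases[OF T] j[OF T] by (auto simp: stress_cell_def stress_cell_axioms_def)
qed

abbreviation "S \<equiv> Sigma_h Th nF j k"
abbreviation "V \<equiv> V_h \<Omega> Th k"
abbreviation "L \<equiv> Lambda_ht Th nF k"
abbreviation "Q \<equiv> Q_h \<Omega> Th k"

abbreviation "Stn \<equiv> Sigma_tn Th nF j k"
abbreviation "FI \<equiv> interior_facets Th"
abbreviation "Tplus \<equiv> plus_cell Th nF"
abbreviation "Tminus \<equiv> minus_cell Th nF"
abbreviation "jump \<equiv> tn_jump Th nF"
abbreviation "facet_ip F \<equiv> l2i (facet_measure (nF F) F)"
abbreviation "solvesH \<equiv> solves_H \<Omega> Th nF j k \<nu>"
abbreviation "solvesD \<equiv> solves_D \<Omega> Th nF j k \<nu>"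

lemma L_broken: "L = broken (FI) (Rt nF k)"
  by (auto simp: Lambda_ht_def broken_def)

lemma closed_facet: "T \<in> Th \<Longrightarrow> F \<in> facets_of T \<Longrightarrow> closed F"
  using flat.compact[OF flat_facet] compact_imp_closed by blast

lemma S_Poly: assumes "\<tau> \<in> S" "T \<in> Th" shows "\<tau> T \<in> Poly (k + 1) UNIV"
proof -
  have "\<tau> T \<in> Sigma_plus nF j k T" using assms by (simp add: Sigma_h_def broken_def)
  then have "\<tau> T \<in> Poly (k + 1) traceless_matrices" using stress_cell.Sigma_plus_Poly[OF stress[OF assms(2)]] by blast
  then show ?thesis by (rule Poly_mono[OF subspace_UNIV order_refl subset_UNIV])
qed

lemma cont_S: "\<tau> \<in> S \<Longrightarrow> T \<in> Th \<Longrightarrow> continuous_on A (\<tau> T)"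
  by (rule Poly_continuous[OF subspace_UNIV S_Poly])

lemma cont_V: "v \<in> V \<Longrightarrow> T \<in> Th \<Longrightarrow> continuous_on A (v T)"
  by (rule Poly_continuous[OF subspace_UNIV V_h_Poly])

lemma cont_Q: "q \<in> Q \<Longrightarrow> T \<in> Th \<Longrightarrow> continuous_on A (q T)"
  by (rule Poly_continuous[OF subspace_UNIV Q_h_Poly])

lemma cont_pdiv: "v \<in> V \<Longrightarrow> T \<in> Th \<Longrightarrow> continuous_on A (pdiv v T)"
  unfolding pdiv_def by (rule Poly_continuous[OF subspace_UNIV Poly_vdiv[OF V_h_Poly]])

lemma cont_mdiv: "\<tau> \<in> S \<Longrightarrow> T \<in> Th \<Longrightarrow> continuous_on A (mdiv (\<tau> T))"
  by (rule Poly_continuous[OF subspace_UNIV Poly_mdiv[OF S_Poly]])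

lemma L_facet_fun: 
  assumes \<mu>: "\<mu> \<in> L" and T: "T \<in> Th" "F \<in> facets_of T" shows "facet_fun F (\<mu> F)"
proof (cases "F \<in> FI")
  case True
  then have "\<mu> F \<in> Rt nF k F" using \<mu> by (simp add: Lambda_ht_def)
  then show ?thesis by (rule facet_fun_Rt[OF closed_facet[OF T]])
next
  case False
  then have "\<mu> F = (\<lambda>x. 0)" using \<mu> by (simp add: Lambda_ht_def)
  then show ?thesis by (simp add: facet_fun_continuous)
qed

lemma subspace_S: "subspace S" and fin_dim_S: "fin_dim S"
proof -
  show "subspace S" unfolding Sigma_h_def
    by (rule subspace_broken) (rule stress_cell.subspace_Sigma_plus[OF stress])
  show "fin_dim S" unfolding Sigma_h_def
    by (rule fin_dim_broken[OF finite_Th]) (rule fin_dim_subset[OF fin_dim_Poly stress_cell.Sigma_plus_Poly[OF stress]])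
qed

lemma subspace_L: "subspace L" and fin_dim_L: "fin_dim L"
  unfolding L_broken by (intro subspace_broken subspace_Rt fin_dim_broken finite_interior_facets fin_dim_Rt)+

lemma H0_div_lincomb:
  assumes v: "v \<in> H0_div \<Omega>" and w: "w \<in> H0_div \<Omega>"
  shows "(\<lambda>x. a *\<^sub>R v x + b *\<^sub>R w x) \<in> H0_div \<Omega>"
proof -
  obtain g where g: "v \<in> L2 \<Omega>" "g \<in> L2 \<Omega>" "weak_div \<Omega> v g" "zero_normal_trace \<Omega> v g" using v by (auto simp: H0_div_def)
  obtain h where h: "w \<in> L2 \<Omega>" "h \<in> L2 \<Omega>" "weak_div \<Omega> w h" "zero_normal_trace \<Omega> w h" using w by (auto simp: H0_div_def)
  let ?M = "lebesgue_on \<Omega>"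
  have lin: "l2i ?M (\<lambda>x. a *\<^sub>R v x + b *\<^sub>R w x) (grad \<phi>) = a * l2i ?M v (grad \<phi>) + b * l2i ?M w (grad \<phi>)"
    "l2i ?M (\<lambda>x. a *\<^sub>R g x + b *\<^sub>R h x) \<phi> = a * l2i ?M g \<phi> + b * l2i ?M h \<phi>" if "smooth \<phi>" for \<phi>
  proof -
    have "grad \<phi> \<in> L2 \<Omega>" "\<phi> \<in> L2 \<Omega>"
      using grad_in_L2[OF C1_smooth[OF that]] continuous_in_L2[OF C1_continuous[OF C1_smooth[OF that]] bounded_domain domain_lebesgue] by auto
    note L2\<phi> = this
    show "l2i ?M (\<lambda>x. a *\<^sub>R v x + b *\<^sub>R w x) (grad \<phi>) = a * l2i ?M v (grad \<phi>) + b * l2i ?M w (grad \<phi>)"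
      by (intro l2i_lincomb integrable_L2_inner g h L2\<phi>)
    show "l2i ?M (\<lambda>x. a *\<^sub>R g x + b *\<^sub>R h x) \<phi> = a * l2i ?M g \<phi> + b * l2i ?M h \<phi>"
      by (intro l2i_lincomb integrable_L2_inner g h L2\<phi>)
  qed
  have wd: "weak_div \<Omega> (\<lambda>x. a *\<^sub>R v x + b *\<^sub>R w x) (\<lambda>x. a *\<^sub>R g x + b *\<^sub>R h x)"
    using g(3) h(3) lin unfolding weak_div_def by simp
  have zt: "zero_normal_trace \<Omega> (\<lambda>x. a *\<^sub>R v x + b *\<^sub>R w x) (\<lambda>x. a *\<^sub>R g x + b *\<^sub>R h x)"
    unfolding zero_normal_trace_def
  proof (intro allI impI)
    fix \<phi> :: "real^'n \<Rightarrow> real" assume s: "smooth \<phi>"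
    have "l2i ?M v (grad \<phi>) + l2i ?M g \<phi> = 0" "l2i ?M w (grad \<phi>) + l2i ?M h \<phi> = 0"
      using g(4) h(4) s unfolding zero_normal_trace_def by blast+
    then have "a * (l2i ?M v (grad \<phi>) + l2i ?M g \<phi>) + b * (l2i ?M w (grad \<phi>) + l2i ?M h \<phi>) = 0" by simp
    then show "l2i ?M (\<lambda>x. a *\<^sub>R v x + b *\<^sub>R w x) (grad \<phi>) + l2i ?M (\<lambda>x. a *\<^sub>R g x + b *\<^sub>R h x) \<phi> = 0"
      unfolding lin[OF s] by (simp add: algebra_simps)
  qed
  show ?thesis unfolding H0_div_def using L2_lincomb[OF g(1) h(1)] L2_lincomb[OF g(2) h(2)] wd zt by blast
qed

lemma pw_lincomb': "pw Th (a *\<^sub>R v + b *\<^sub>R w) = (\<lambda>x. a *\<^sub>R pw Th v x + b *\<^sub>R pw Th w x)"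
  using pw_lincomb[of a v b w] by (simp add: fun_eq_iff plus_fun_def scaleR_fun_def)

lemma pw_zero: "pw Th 0 = (\<lambda>x. 0)"
  by (simp add: pw_def fun_eq_iff)

lemma subspace_lincombI:
  assumes "0 \<in> W" "\<And>a b x y. x \<in> W \<Longrightarrow> y \<in> W \<Longrightarrow> a *\<^sub>R x + b *\<^sub>R y \<in> W"
  shows "subspace W"
proof (rule subspaceI[OF assms(1)])
  show "x + y \<in> W" if "x \<in> W" "y \<in> W" for x y using assms(2)[OF that, of 1 1] by simp
  show "c *\<^sub>R x \<in> W" if "x \<in> W" for c x using assms(2)[OF that that, of c 0] by simp
qed

lemma subspace_V: "subspace V"
proof -
  have B: "subspace (broken Th (\<lambda>T. Poly (k + 1) (UNIV :: (real^'n) set)))"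
    by (intro subspace_broken subspace_Poly subspace_UNIV)
  show ?thesis
  proof (rule subspace_lincombI)
    show "0 \<in> V" by (rule V_h_I) (auto simp: zero_fun_def vdiv_zero intro!: Poly_zero_fun)
    show "a *\<^sub>R x + b *\<^sub>R y \<in> V" if "x \<in> V" "y \<in> V" for a b x y
      using that subspace_add[OF B subspace_scale[OF B] subspace_scale[OF B]] H0_div_lincomb
      unfolding V_h_def pw_lincomb' mem_Collect_eq by blast
  qed
qed

lemma fin_dim_V: "fin_dim V"
proof -
  have "fin_dim (broken Th (\<lambda>T. Poly (k + 1) (UNIV :: (real^'n) set)))"
    by (intro fin_dim_broken finite_Th fin_dim_Poly)
  then show ?thesis by (rule fin_dim_subset) (auto simp: V_h_def)
qed

lemma pw_Q_integrable: 
  assumes "q \<in> broken Th (\<lambda>T. Poly k (UNIV :: real set))" shows "integrable (lebesgue_on \<Omega>) (pw Th q)"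
proof -
  have "q T \<in> Poly k UNIV" if "T \<in> Th" for T using assms that by (simp add: broken_def)
  then have "integrable (lebesgue_on \<Omega>) (\<lambda>x. \<Sum>T\<in>Th. indicator (interior T) x * q T x)"
    by (intro integral_pieces integrable_compact compact_cell Poly_continuous[OF subspace_UNIV])
  then show ?thesis by (simp add: pw_def[abs_def])
qed

lemma subspace_Q: "subspace Q"
proof -
  have B: "subspace (broken Th (\<lambda>T. Poly k (UNIV :: real set)))"
    by (intro subspace_broken subspace_Poly subspace_UNIV)
  show ?thesis
  proof (rule subspace_lincombI)
    show "0 \<in> Q" using subspace_0[OF B] by (simp add: Q_h_def pw_zero)
    show "a *\<^sub>R x + b *\<^sub>R y \<in> Q" if "x \<in> Q" "y \<in> Q" for a b x y
    proof -
      have xy: "x \<in> broken Th (\<lambda>T. Poly k UNIV)" "y \<in> broken Th (\<lambda>T. Poly k UNIV)" using that by (auto simp: Q_h_def)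
      have "a *\<^sub>R x + b *\<^sub>R y \<in> broken Th (\<lambda>T. Poly k UNIV)"
        by (intro subspace_add[OF B] subspace_scale[OF B] xy)
      moreover have "(\<integral>z. pw Th (a *\<^sub>R x + b *\<^sub>R y) z \<partial>lebesgue_on \<Omega>) = 0"
        unfolding pw_lincomb' using pw_Q_integrable[OF xy(1)] pw_Q_integrable[OF xy(2)] that by (simp add: Q_h_def)
      ultimately show ?thesis by (simp add: Q_h_def)
    qed
  qed
qed

lemma fin_dim_Q: "fin_dim Q"
proof -
  have "fin_dim (broken Th (\<lambda>T. Poly k (UNIV :: real set)))"
    by (intro fin_dim_broken finite_Th fin_dim_Poly)
  then show ?thesis by (rule fin_dim_subset) (auto simp: Q_h_def)
qed

lemma ip_commute: "ip \<Omega> Th v w = ip \<Omega> Th w v"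
  by (simp add: ip_def l2i_commute)

lemma ip_nonneg: "0 \<le> ip \<Omega> Th v v"
  by (simp add: ip_def l2i_nonneg)

lemma lin_ip:
  fixes W :: "((real^'n) set \<Rightarrow> real^'n \<Rightarrow> 'b::euclidean_space) set"
  assumes W: "\<And>w T. w \<in> W \<Longrightarrow> T \<in> Th \<Longrightarrow> continuous_on T (w T)" and v: "\<And>T. T \<in> Th \<Longrightarrow> continuous_on T (v T)"
  shows "lin_on W (\<lambda>w. ip \<Omega> Th w v)" "lin_on W (ip \<Omega> Th v)"
proof -
  have c: "continuous_on T ((a *\<^sub>R x + b *\<^sub>R y) T)" if "x \<in> W" "y \<in> W" "T \<in> Th" for x y a b T
    unfolding lincomb_apply using W that by (intro continuous_intros) auto
  show "lin_on W (\<lambda>w. ip \<Omega> Th w v)"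
  proof (rule lin_onI)
    fix x y a b assume xy: "x \<in> W" "y \<in> W"
    have "ip \<Omega> Th (a *\<^sub>R x + b *\<^sub>R y) v = (\<Sum>T\<in>Th. l2i (lebesgue_on T) ((a *\<^sub>R x + b *\<^sub>R y) T) (v T))"
      by (rule ip_eq[OF c[OF xy] v])
    also have "\<dots> = (\<Sum>T\<in>Th. a * l2i (lebesgue_on T) (x T) (v T) + b * l2i (lebesgue_on T) (y T) (v T))"
      unfolding lincomb_apply by (intro sum.cong refl l2i_lincomb_compact compact_cell W xy v)
    also have "\<dots> = a * ip \<Omega> Th x v + b * ip \<Omega> Th y v"
      by (simp add: ip_eq[OF W[OF xy(1)] v] ip_eq[OF W[OF xy(2)] v] sum.distrib sum_distrib_left)
    finally show "ip \<Omega> Th (a *\<^sub>R x + b *\<^sub>R y) v = a * ip \<Omega> Th x v + b * ip \<Omega> Th y v" .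
  qed
  then show "lin_on W (ip \<Omega> Th v)" unfolding ip_commute[of v] .
qed

lemma lin_ip_S: "\<sigma> \<in> S \<Longrightarrow> lin_on S (\<lambda>\<tau>. ip \<Omega> Th \<tau> \<sigma>)" "\<sigma> \<in> S \<Longrightarrow> lin_on S (ip \<Omega> Th \<sigma>)"
  by (rule lin_ip; rule cont_S; assumption)+

lemma lin_ip_V: "v \<in> V \<Longrightarrow> lin_on V (\<lambda>w. ip \<Omega> Th w v)"
  by (rule lin_ip; rule cont_V; assumption)

lemma lin_ip_Q: "q \<in> Q \<Longrightarrow> lin_on Q (\<lambda>p. ip \<Omega> Th p q)"
  by (rule lin_ip; rule cont_Q; assumption)

lemma lin_ip_pdiv: "v \<in> V \<Longrightarrow> lin_on Q (ip \<Omega> Th (pdiv v))"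
  by (rule lin_ip(2)) (auto intro: cont_Q cont_pdiv)

lemma ip_zero_imp_zero:
  fixes w :: "(real^'n) set \<Rightarrow> real^'n \<Rightarrow> 'b::euclidean_space"
  assumes w: "\<And>T. T \<in> Th \<Longrightarrow> w T \<in> Poly m UNIV" "\<And>T. T \<notin> Th \<Longrightarrow> w T = (\<lambda>x. 0)" and z: "ip \<Omega> Th w w = 0"
  shows "w = 0"
proof -
  have c: "continuous_on T (w T)" if "T \<in> Th" for T by (rule Poly_continuous[OF subspace_UNIV w(1)[OF that]])
  have "(\<Sum>T\<in>Th. l2i (lebesgue_on T) (w T) (w T)) = 0" using z ip_eq[OF c c] by simp
  then have "l2i (lebesgue_on T) (w T) (w T) = 0" if "T \<in> Th" for T
    using that finite_Th by (simp add: sum_nonneg_eq_0_iff l2i_nonneg)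
  then have "w T = (\<lambda>x. 0)" for T
    using cell.Poly_zero_if_l2_zero[OF cell w(1)] w(2) by (cases "T \<in> Th") auto
  then show ?thesis by (simp add: fun_eq_iff)
qed

text \<open>The trace from inside \<open>T\<close>: projection along the fixed normal, evaluation with the outward one.\<close>
definition facet_trace :: "(real^'n) set \<Rightarrow> (real^'n) set \<Rightarrow> real^'n^'n \<Rightarrow> real^'n" where
  "facet_trace T F M = tproj (nF F) (M *v out_normal T F)"

lemma linear_facet_trace: "linear (facet_trace T F)"
  unfolding facet_trace_def using linear_compose[OF linear_mat_vec linear_tproj] by (simp add: o_def)

text \<open>The part of the weak strain functional that involves the velocity. Its negative is the
  stress part of the form in the mixed method.\<close>
definition cellform :: "((real^'n) set \<Rightarrow> real^'n \<Rightarrow> real^'n) \<Rightarrow> ((real^'n) set \<Rightarrow> real^'n \<Rightarrow> real^'n^'n) \<Rightarrow> real" where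
  "cellform v \<tau> = (\<Sum>T\<in>Th. - l2i (lebesgue_on T) (v T) (mdiv (\<tau> T)) + nn_bdry nF T (\<tau> T) (v T))"

text \<open>The part of the weak strain functional that involves the multiplier, summed cell by cell.\<close>
definition skelform :: "((real^'n) set \<Rightarrow> real^'n \<Rightarrow> real^'n) \<Rightarrow> ((real^'n) set \<Rightarrow> real^'n \<Rightarrow> real^'n^'n) \<Rightarrow> real" where
  "skelform \<mu> \<tau> = (\<Sum>T\<in>Th. \<Sum>F\<in>facets_of T. facet_ip F (\<mu> F) (\<lambda>x. facet_trace T F (\<tau> T x)))"

lemma b_h_eq: "b_h \<Omega> Th nF \<tau> q v = - cellform v \<tau> - ip \<Omega> Th (pdiv v) q"
  by (simp add: b_h_def cellform_def l2i_commute[of _ "v _"] sum_subtractf sum_negf)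

lemma cont_facet_trace: "\<tau> \<in> S \<Longrightarrow> T \<in> Th \<Longrightarrow> continuous_on A (\<lambda>x. facet_trace T F (\<tau> T x))"
  by (rule Poly_continuous[OF subspace_UNIV Poly_map[OF linear_facet_trace UNIV_I S_Poly]])

lemma cellform_lin:
  assumes "v \<in> V" shows "lin_on S (cellform v)"
  unfolding cellform_def
proof (intro lin_on_setsum lin_on_plus lin_on_neg)
  fix T assume T: "T \<in> Th"
  show "lin_on S (\<lambda>\<tau>. l2i (lebesgue_on T) (v T) (mdiv (\<tau> T)))"
  proof (rule lin_onI)
    fix x y a b assume xy: "x \<in> S" "y \<in> S"
    have "mdiv ((a *\<^sub>R x + b *\<^sub>R y) T) = (\<lambda>z. a *\<^sub>R mdiv (x T) z + b *\<^sub>R mdiv (y T) z)"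
      unfolding lincomb_apply by (rule ext) (rule mdiv_lincomb[OF S_Poly[OF xy(1) T] S_Poly[OF xy(2) T]])
    then show "l2i (lebesgue_on T) (v T) (mdiv ((a *\<^sub>R x + b *\<^sub>R y) T)) = a * l2i (lebesgue_on T) (v T) (mdiv (x T)) + b * l2i (lebesgue_on T) (v T) (mdiv (y T))"
      by (simp only:) (intro l2i_lincomb_compact compact_cell T cont_mdiv xy cont_V assms)
  qed
  show "lin_on S (\<lambda>\<tau>. nn_bdry nF T (\<tau> T) (v T))"
    unfolding nn_bdry_def
  proof (intro lin_on_setsum lin_onI)
    fix F x y a b assume F: "F \<in> facets_of T" and xy: "x \<in> S" "y \<in> S"
    let ?n = "out_normal T F"
    have lin: "linear (\<lambda>M. ?n \<bullet> (M *v ?n))" by (rule linear_mat_inner)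
    have c: "facet_fun F (\<lambda>z. ?n \<bullet> (x T z *v ?n))" if "x \<in> S" for x
      by (rule facet_fun_continuous[OF Poly_continuous[OF subspace_UNIV Poly_map[OF lin UNIV_I S_Poly[OF that T]]]])
    have cv: "facet_fun F (\<lambda>z. v T z \<bullet> ?n)"
      by (intro facet_fun_continuous continuous_intros cont_V assms T)
    have e: "(\<lambda>z. ?n \<bullet> ((a *\<^sub>R x + b *\<^sub>R y) T z *v ?n)) = (\<lambda>z. a *\<^sub>R (?n \<bullet> (x T z *v ?n)) + b *\<^sub>R (?n \<bullet> (y T z *v ?n)))"
      unfolding lincomb_apply using linear_add[OF lin] linear_scale[OF lin] by simp
    show "facet_ip F (\<lambda>z. ?n \<bullet> ((a *\<^sub>R x + b *\<^sub>R y) T z *v ?n)) (\<lambda>z. v T z \<bullet> ?n)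
       = a * facet_ip F (\<lambda>z. ?n \<bullet> (x T z *v ?n)) (\<lambda>z. v T z \<bullet> ?n)
       + b * facet_ip F (\<lambda>z. ?n \<bullet> (y T z *v ?n)) (\<lambda>z. v T z \<bullet> ?n)"
      unfolding e by (rule flat.facet_l2i_lincomb(1)[OF flat_facet[OF T F] c[OF xy(1)] c[OF xy(2)] cv])
  qed
qed

lemma cellform_lin_v:
  assumes "\<tau> \<in> S" shows "lin_on V (\<lambda>v. cellform v \<tau>)"
  unfolding cellform_def
proof (intro lin_on_setsum lin_on_plus lin_on_neg)
  fix T assume T: "T \<in> Th"
  show "lin_on V (\<lambda>v. l2i (lebesgue_on T) (v T) (mdiv (\<tau> T)))"
  proof (rule lin_onI)
    fix x y a b assume xy: "x \<in> V" "y \<in> V"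
    show "l2i (lebesgue_on T) ((a *\<^sub>R x + b *\<^sub>R y) T) (mdiv (\<tau> T)) = a * l2i (lebesgue_on T) (x T) (mdiv (\<tau> T)) + b * l2i (lebesgue_on T) (y T) (mdiv (\<tau> T))"
      unfolding lincomb_apply by (intro l2i_lincomb_compact compact_cell T cont_mdiv xy cont_V assms)
  qed
  show "lin_on V (\<lambda>v. nn_bdry nF T (\<tau> T) (v T))"
    unfolding nn_bdry_def
  proof (intro lin_on_setsum lin_onI)
    fix F x y a b assume F: "F \<in> facets_of T" and xy: "x \<in> V" "y \<in> V"
    let ?n = "out_normal T F"
    have c: "facet_fun F (\<lambda>z. ?n \<bullet> (\<tau> T z *v ?n))"
      by (rule facet_fun_continuous[OF Poly_continuous[OF subspace_UNIV Poly_map[OF linear_mat_inner UNIV_I S_Poly[OF assms T]]]])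
    have cv: "facet_fun F (\<lambda>z. v T z \<bullet> ?n)" if "v \<in> V" for v
      by (intro facet_fun_continuous continuous_intros cont_V that T)
    have e: "(\<lambda>z. (a *\<^sub>R x + b *\<^sub>R y) T z \<bullet> ?n) = (\<lambda>z. a *\<^sub>R (x T z \<bullet> ?n) + b *\<^sub>R (y T z \<bullet> ?n))"
      unfolding lincomb_apply by (simp add: inner_add_left)
    show "facet_ip F (\<lambda>z. ?n \<bullet> (\<tau> T z *v ?n)) (\<lambda>z. (a *\<^sub>R x + b *\<^sub>R y) T z \<bullet> ?n)
       = a * facet_ip F (\<lambda>z. ?n \<bullet> (\<tau> T z *v ?n)) (\<lambda>z. x T z \<bullet> ?n)
       + b * facet_ip F (\<lambda>z. ?n \<bullet> (\<tau> T z *v ?n)) (\<lambda>z. y T z \<bullet> ?n)"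
      unfolding e by (rule flat.facet_l2i_lincomb(2)[OF flat_facet[OF T F] cv[OF xy(1)] cv[OF xy(2)] c])
  qed
qed

lemma skelform_lin:
  assumes "\<mu> \<in> L" shows "lin_on S (skelform \<mu>)"
  unfolding skelform_def
proof (intro lin_on_setsum lin_onI)
  fix T F x y a b assume T: "T \<in> Th" and F: "F \<in> facets_of T" and xy: "x \<in> S" "y \<in> S"
  have e: "(\<lambda>z. facet_trace T F ((a *\<^sub>R x + b *\<^sub>R y) T z)) = (\<lambda>z. a *\<^sub>R facet_trace T F (x T z) + b *\<^sub>R facet_trace T F (y T z))"
    unfolding lincomb_apply by (simp add: linear_add[OF linear_facet_trace] linear_scale[OF linear_facet_trace])
  show "facet_ip F (\<mu> F) (\<lambda>z. facet_trace T F ((a *\<^sub>R x + b *\<^sub>R y) T z))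
     = a * facet_ip F (\<mu> F) (\<lambda>z. facet_trace T F (x T z)) + b * facet_ip F (\<mu> F) (\<lambda>z. facet_trace T F (y T z))"
    unfolding e by (intro flat.facet_l2i_lincomb(2)[OF flat_facet[OF T F]] facet_fun_continuous cont_facet_trace xy T L_facet_fun[OF assms T F])
qed

lemma skelform_lin_mu:
  assumes "\<tau> \<in> S" shows "lin_on L (\<lambda>\<mu>. skelform \<mu> \<tau>)"
  unfolding skelform_def
proof (intro lin_on_setsum lin_onI)
  fix T F x y a b assume T: "T \<in> Th" and F: "F \<in> facets_of T" and xy: "x \<in> L" "y \<in> L"
  show "facet_ip F ((a *\<^sub>R x + b *\<^sub>R y) F) (\<lambda>z. facet_trace T F (\<tau> T z))
     = a * facet_ip F (x F) (\<lambda>z. facet_trace T F (\<tau> T z)) + b * facet_ip F (y F) (\<lambda>z. facet_trace T F (\<tau> T z))"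
    unfolding lincomb_apply
    by (intro flat.facet_l2i_lincomb(1)[OF flat_facet[OF T F]] facet_fun_continuous cont_facet_trace assms T L_facet_fun[OF xy(1) T F] L_facet_fun[OF xy(2) T F])
qed

lemma facet_trace_plus: "F \<in> FI \<Longrightarrow> facet_trace (Tplus F) F M = tn_part (nF F) M"
  using plus_cell(3)[OF interior_facet_sub] by (simp add: facet_trace_def tn_part_def)

lemma facet_trace_minus: "F \<in> FI \<Longrightarrow> facet_trace (Tminus F) F M = - tn_part (nF F) M"
proof -
  assume F: "F \<in> FI"
  have "M *v (- nF F) = - (M *v nF F)" using matrix_vector_mult_scaleR[of M "-1" "nF F"] by simp
  then show ?thesis by (simp add: facet_trace_def tn_part_def minus_cell(3)[OF F] linear_neg[OF linear_tproj])
qed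

lemma tn_jump_eq: "jump \<tau> F x = tn_part (nF F) (\<tau> (Tplus F) x) - tn_part (nF F) (\<tau> (Tminus F) x)"
  by (simp add: tn_jump_def tn_part_def)

lemma cont_jump:
  assumes \<tau>: "\<tau> \<in> S" and F: "F \<in> FI" shows "continuous_on A (jump \<tau> F)"
proof -
  have c: "continuous_on A (\<lambda>x. tn_part (nF F) (\<tau> T x))" if "T \<in> Th" for T
    by (rule Poly_continuous[OF subspace_UNIV Poly_map[OF linear_tn UNIV_I S_Poly[OF \<tau> that]]])
  show ?thesis unfolding tn_jump_eq[abs_def]
    by (intro continuous_on_diff c plus_cell(1) interior_facet_sub minus_cell(1) F)
qed

text \<open>The outward normals of the two cells of a facet are opposite, so the two traces combine to a jump.\<close>
lemma skelform_jump:
  assumes \<mu>: "\<mu> \<in> L" and \<tau>: "\<tau> \<in> S"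
  shows "skelform \<mu> \<tau> = (\<Sum>F\<in>FI. facet_ip F (\<mu> F) (jump \<tau> F))"
proof -
  have "skelform \<mu> \<tau> = (\<Sum>F\<in>FI.
     facet_ip F (\<mu> F) (\<lambda>x. facet_trace (Tplus F) F (\<tau> (Tplus F) x))
     + facet_ip F (\<mu> F) (\<lambda>x. facet_trace (Tminus F) F (\<tau> (Tminus F) x)))"
    unfolding skelform_def
    by (rule sum_over_facets) (use \<mu> in \<open>simp add: Lambda_ht_def l2i_def\<close>)
  also have "\<dots> = (\<Sum>F\<in>FI. facet_ip F (\<mu> F) (jump \<tau> F))"
  proof (rule sum.cong[OF refl])
    fix F assume F: "F \<in> FI"
    note P = plus_cell(1,2)[OF interior_facet_sub[OF F]] and M = minus_cell(1,2)[OF F]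
    have e: "jump \<tau> F = (\<lambda>x. 1 *\<^sub>R facet_trace (Tplus F) F (\<tau> (Tplus F) x) + 1 *\<^sub>R facet_trace (Tminus F) F (\<tau> (Tminus F) x))"
      by (rule ext) (simp add: tn_jump_eq facet_trace_plus[OF F] facet_trace_minus[OF F])
    have "facet_ip F (\<mu> F) (jump \<tau> F) = 1 * facet_ip F (\<mu> F) (\<lambda>x. facet_trace (Tplus F) F (\<tau> (Tplus F) x))
     + 1 * facet_ip F (\<mu> F) (\<lambda>x. facet_trace (Tminus F) F (\<tau> (Tminus F) x))"
      unfolding e by (intro flat.facet_l2i_lincomb(2)[OF flat_facet[OF P]] facet_fun_continuous cont_facet_trace \<tau> P M L_facet_fun[OF \<mu> P])
    then show "facet_ip F (\<mu> F) (\<lambda>x. facet_trace (Tplus F) F (\<tau> (Tplus F) x))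
     + facet_ip F (\<mu> F) (\<lambda>x. facet_trace (Tminus F) F (\<tau> (Tminus F) x)) = facet_ip F (\<mu> F) (jump \<tau> F)" by simp
  qed
  finally show ?thesis .
qed

lemma facet_zero:
  assumes F: "F \<in> FI" and f: "facet_fun F f" and z: "facet_ip F f f = 0" and x: "x \<in> F"
  shows "f x = 0"
proof -
  note P = plus_cell(1,2)[OF interior_facet_sub[OF F]]
  show ?thesis by (rule flat.facet_l2i_zero[OF flat_facet[OF P] f z x prism_interior[OF P] convex_facet[OF P]])
qed

lemma jump_in_Rt:
  assumes \<tau>: "\<tau> \<in> S" and F: "F \<in> FI"
  shows "frestrict F (jump \<tau> F) \<in> Rt nF k F"
proof -
  have t: "frestrict F (\<lambda>x. tn_part (nF F) (\<tau> T x)) \<in> Rt nF k F" if T: "T \<in> Th" "F \<in> facets_of T" for T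
  proof -
    obtain l where l: "l \<in> verts T" "F = opp T l" using facetE[OF T] by blast
    have "\<tau> T \<in> Sigma_plus nF j k T" using \<tau> T by (simp add: Sigma_h_def broken_def)
    then show ?thesis using stress_cell.trace_in_Rt[OF stress[OF T(1)] _ l(1)] l(2) by simp
  qed
  have "frestrict F (jump \<tau> F) = frestrict F (\<lambda>x. tn_part (nF F) (\<tau> (Tplus F) x)) - frestrict F (\<lambda>x. tn_part (nF F) (\<tau> (Tminus F) x))"
    by (auto simp: frestrict_def fun_eq_iff tn_jump_eq)
  then show ?thesis
    using subspace_diff[OF subspace_Rt t[OF plus_cell(1,2)[OF interior_facet_sub[OF F]]] t[OF minus_cell(1,2)[OF F]]] by simp
qed

text \<open>The jump of a stress lies itself in the facet space and may be used as multiplier.\<close>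
lemma Sigma_tn_iff: assumes \<tau>: "\<tau> \<in> S" shows "\<tau> \<in> Stn \<longleftrightarrow> (\<forall>\<mu>\<in>L. skelform \<mu> \<tau> = 0)"
proof
  assume t: "\<tau> \<in> Stn"
  show "\<forall>\<mu>\<in>L. skelform \<mu> \<tau> = 0"
  proof
    fix \<mu> assume \<mu>: "\<mu> \<in> L"
    have "facet_ip F (\<mu> F) (jump \<tau> F) = 0" if F: "F \<in> FI" for F
    proof -
      note P = plus_cell(1,2)[OF interior_facet_sub[OF F]]
      have "facet_ip F (\<mu> F) (jump \<tau> F) = facet_ip F (\<mu> F) (\<lambda>x. 0)"
        by (rule flat.facet_l2i_cong[OF flat_facet[OF P] L_facet_fun[OF \<mu> P] L_facet_fun[OF \<mu> P] facet_fun_continuous[OF cont_jump[OF \<tau> F]] facet_fun_continuous[OF continuous_on_const]])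
          (use t F in \<open>auto simp: Sigma_tn_def\<close>)
      then show ?thesis by (simp add: l2i_def)
    qed
    then show "skelform \<mu> \<tau> = 0" by (simp add: skelform_jump[OF \<mu> \<tau>])
  qed
next
  assume z: "\<forall>\<mu>\<in>L. skelform \<mu> \<tau> = 0"
  have "jump \<tau> F x = 0" if F: "F \<in> FI" and x: "x \<in> F" for F x
  proof -
    note P = plus_cell(1,2)[OF interior_facet_sub[OF F]]
    let ?r = "frestrict F (jump \<tau> F)"
    define \<mu> where "\<mu> = (\<lambda>G. if G = F then ?r else (\<lambda>x. 0))"
    have Z: "(\<lambda>x. 0) \<in> Rt nF k G" for G using subspace_0[OF subspace_Rt] by (simp add: zero_fun_def)
    have \<mu>: "\<mu> \<in> L" using jump_in_Rt[OF \<tau> F] F Z by (auto simp: \<mu>_def Lambda_ht_def)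
    have fr: "facet_fun F ?r" by (rule facet_fun_Rt[OF closed_facet[OF P] jump_in_Rt[OF \<tau> F]])
    have "0 = (\<Sum>G\<in>FI. facet_ip G (\<mu> G) (jump \<tau> G))"
      using z \<mu> skelform_jump[OF \<mu> \<tau>] by simp
    also have "\<dots> = (\<Sum>G\<in>{F}. facet_ip G (\<mu> G) (jump \<tau> G))"
      by (rule sum.mono_neutral_right) (use F finite_interior_facets in \<open>auto simp: \<mu>_def l2i_def\<close>)
    also have "\<dots> = facet_ip F ?r (jump \<tau> F)" by (simp add: \<mu>_def)
    also have "\<dots> = facet_ip F ?r ?r"
      by (rule flat.facet_l2i_cong[OF flat_facet[OF P] fr fr facet_fun_continuous[OF cont_jump[OF \<tau> F]] fr])
        (auto simp: frestrict_def)
    finally have "?r x = 0" using facet_zero[OF F fr _ x] by simp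
    then show ?thesis using x by (simp add: frestrict_def)
  qed
  then show "\<tau> \<in> Stn" using \<tau> by (simp add: Sigma_tn_def)
qed

text \<open>On one facet the multiplier is the trace of a stress that is supported in one cell and has no trace on
  the other facets. Against this stress, the skeleton form is the squared norm of the multiplier there.\<close>
lemma skelform_injective:
  assumes l: "l \<in> L" and z: "\<And>\<tau>. \<tau> \<in> S \<Longrightarrow> skelform l \<tau> = 0"
  shows "l = 0"
proof -
  have "l F x = 0" for F x
  proof (cases "F \<in> FI \<and> x \<in> F")
    case False
    show ?thesis
    proof (cases "F \<in> FI")
      case True
      then have "l F \<in> Rt nF k F" "x \<notin> F" using l False by (auto simp: Lambda_ht_def)
      then show ?thesis by (rule Rt_outside)
    qed (use l in \<open>simp add: Lambda_ht_def\<close>)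
  next
    case True
    then have F: "F \<in> FI" and x: "x \<in> F" by auto
    note P = plus_cell(1,2)[OF interior_facet_sub[OF F]] and M = minus_cell(1,2)[OF F]
    let ?T = "Tplus F"
    interpret T: stress_cell ?T nF j by (rule stress[OF P(1)])
    obtain a where a: "a \<in> verts ?T" "F = opp ?T a" using facetE[OF P] by blast
    have lF: "l F \<in> Rt nF k F" using l F by (simp add: Lambda_ht_def)
    obtain t where t: "t \<in> Sigma_plus nF j k ?T" "\<forall>x\<in>F. tn_part (nF F) (t x) = l F x"
      "\<forall>m\<in>verts ?T - {a}. \<forall>x\<in>opp ?T m. tn_part (nF (opp ?T m)) (t x) = 0"
      using T.trace_onto_Rt[of "l F" k a] lF a by auto
    define \<tau> where "\<tau> = (\<lambda>R. if R = ?T then t else (\<lambda>x. 0))"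
    have \<tau>: "\<tau> \<in> S"
    proof -
      have "(\<lambda>x. 0) \<in> Sigma_plus nF j k R" if "R \<in> Th" for R
        using subspace_0[OF stress_cell.subspace_Sigma_plus[OF stress[OF that]]] by (simp add: zero_fun_def)
      then show ?thesis using t(1) P(1) by (auto simp: \<tau>_def Sigma_h_def broken_def)
    qed
    have other: "tn_part (nF G) (\<tau> R y) = 0" if R: "R \<in> Th" "G \<in> facets_of R" "y \<in> G" "G \<noteq> F \<or> R \<noteq> ?T" for G R y
    proof (cases "R = ?T")
      case True
      have "G \<in> facets_of ?T" using R(2) True by simp
      then obtain m where m: "m \<in> verts ?T" "G = opp ?T m" using facetE[OF P(1), of G] by blast
      then have "m \<noteq> a" using R(4) True a(2) by auto
      then show ?thesis using t(3) m R(3) True by (simp add: \<tau>_def)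
    qed (simp add: \<tau>_def linear_0[OF linear_tn])
    have j0: "jump \<tau> G y = 0" if G: "G \<in> FI" "G \<noteq> F" "y \<in> G" for G y
      unfolding tn_jump_eq
      using other[OF plus_cell(1,2)[OF interior_facet_sub[OF G(1)]] G(3)] other[OF minus_cell(1,2)[OF G(1)] G(3)] G(2) by simp
    have jF: "jump \<tau> F y = l F y" if "y \<in> F" for y
      unfolding tn_jump_eq using t(2) that other[OF M that] cells_of_interior_facet(2)[OF F] by (simp add: \<tau>_def)
    have "0 = skelform l \<tau>" using z[OF \<tau>] by simp
    also have "\<dots> = (\<Sum>G\<in>FI. if G = F then facet_ip F (l F) (l F) else 0)"
      unfolding skelform_jump[OF l \<tau>]
    proof (rule sum.cong[OF refl])
      fix G assume G: "G \<in> FI"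
      note PG = plus_cell(1,2)[OF interior_facet_sub[OF G]]
      have fl: "facet_fun G (l G)" by (rule L_facet_fun[OF l PG])
      show "facet_ip G (l G) (jump \<tau> G) = (if G = F then facet_ip F (l F) (l F) else 0)"
      proof (cases "G = F")
        case True
        have "facet_ip G (l G) (jump \<tau> G) = facet_ip G (l G) (l G)"
          by (rule flat.facet_l2i_cong[OF flat_facet[OF PG] fl fl facet_fun_continuous[OF cont_jump[OF \<tau> G]] fl]) (use jF True in auto)
        then show ?thesis using True by simp
      next
        case False
        have "facet_ip G (l G) (jump \<tau> G) = facet_ip G (l G) (\<lambda>x. 0)"
          by (rule flat.facet_l2i_cong[OF flat_facet[OF PG] fl fl facet_fun_continuous[OF cont_jump[OF \<tau> G]] facet_fun_continuous[OF continuous_on_const]])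
            (use j0[OF G False] in auto)
        then show ?thesis using False by (simp add: l2i_def)
      qed
    qed
    also have "\<dots> = facet_ip F (l F) (l F)" using F finite_interior_facets by simp
    finally show ?thesis using facet_zero[OF F L_facet_fun[OF l P] _ x] by simp
  qed
  then show ?thesis by (simp add: fun_eq_iff)
qed

definition eps :: "((real^'n) set \<Rightarrow> real^'n \<Rightarrow> real^'n) \<Rightarrow> ((real^'n) set \<Rightarrow> real^'n \<Rightarrow> real^'n) \<Rightarrow> (real^'n) set \<Rightarrow> real^'n \<Rightarrow> real^'n^'n" where
  "eps v \<mu> = dev_eps_w \<Omega> Th nF j k v \<mu>"

lemma bilin_ip_S: "bilin_on S (ip \<Omega> Th)"
  unfolding bilin_on_def using lin_ip_S by blast

lemma ip_S_definite: "\<sigma> \<in> S \<Longrightarrow> ip \<Omega> Th \<sigma> \<sigma> = 0 \<Longrightarrow> \<sigma> = 0"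
  by (rule ip_zero_imp_zero[OF S_Poly]) (auto simp: Sigma_h_def broken_def)

lemma ip_V_definite: "v \<in> V \<Longrightarrow> ip \<Omega> Th v v = 0 \<Longrightarrow> v = 0"
  by (rule ip_zero_imp_zero[OF V_h_Poly]) (auto simp: V_h_def broken_def)

lemma ip_S_represents: "lin_on S g \<Longrightarrow> \<exists>!e. e \<in> S \<and> (\<forall>\<tau>\<in>S. ip \<Omega> Th e \<tau> = g \<tau>)"
  by (rule symmetric_form_represents[OF subspace_S fin_dim_S bilin_ip_S ip_commute]) (blast intro: ip_S_definite)+

lemma eps_ex1: "v \<in> V \<Longrightarrow> \<mu> \<in> L \<Longrightarrow> \<exists>!e. e \<in> S \<and> (\<forall>\<tau>\<in>S. ip \<Omega> Th e \<tau> = cellform v \<tau> + skelform \<mu> \<tau>)"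
  by (intro ip_S_represents lin_on_plus cellform_lin skelform_lin)

lemma eps_THE: "eps v \<mu> = (THE e. e \<in> S \<and> (\<forall>\<tau>\<in>S. ip \<Omega> Th e \<tau> = cellform v \<tau> + skelform \<mu> \<tau>))"
  unfolding eps_def dev_eps_w_def cellform_def skelform_def facet_trace_def sum.distrib[symmetric] ..

lemma eps:
  assumes "v \<in> V" "\<mu> \<in> L"
  shows "eps v \<mu> \<in> S" "\<tau> \<in> S \<Longrightarrow> ip \<Omega> Th (eps v \<mu>) \<tau> = cellform v \<tau> + skelform \<mu> \<tau>"
  using theI'[OF eps_ex1[OF assms]] unfolding eps_THE[symmetric] by blast+

lemma eps_unique:
  assumes "v \<in> V" "\<mu> \<in> L" "e \<in> S" "\<And>\<tau>. \<tau> \<in> S \<Longrightarrow> ip \<Omega> Th e \<tau> = cellform v \<tau> + skelform \<mu> \<tau>"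
  shows "eps v \<mu> = e"
  unfolding eps_THE by (rule the1_equality[OF eps_ex1[OF assms(1,2)]]) (use assms in blast)

lemma zero_in: "0 \<in> V" "0 \<in> L" "0 \<in> Q" "0 \<in> S"
  using subspace_0 subspace_V subspace_L subspace_Q subspace_S by blast+

lemma cellform_zero: "\<tau> \<in> S \<Longrightarrow> cellform 0 \<tau> = 0" "v \<in> V \<Longrightarrow> cellform v 0 = 0"
  using lin_on_zero[OF cellform_lin_v zero_in(1)] lin_on_zero[OF cellform_lin zero_in(4)] by blast+

lemma skelform_zero: "\<tau> \<in> S \<Longrightarrow> skelform 0 \<tau> = 0" "\<mu> \<in> L \<Longrightarrow> skelform \<mu> 0 = 0"
  using lin_on_zero[OF skelform_lin_mu zero_in(2)] lin_on_zero[OF skelform_lin zero_in(4)] by blast+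

section \<open>The hybrid system\<close>

text \<open>The trial space of the hybrid method, and below its bilinear form as one symmetric form.\<close>
abbreviation "W \<equiv> V \<times> (L \<times> Q)"

lemma subspace_W: "subspace W" and fin_dim_W: "fin_dim W"
  by (intro subspace_Times fin_dim_Times subspace_V subspace_L subspace_Q fin_dim_V fin_dim_L fin_dim_Q)+

definition saddle :: "((real^'n) set \<Rightarrow> real^'n \<Rightarrow> real^'n) \<times> ((real^'n) set \<Rightarrow> real^'n \<Rightarrow> real^'n) \<times> ((real^'n) set \<Rightarrow> real^'n \<Rightarrow> real) \<Rightarrow> _ \<Rightarrow> real" where
  "saddle = (\<lambda>(u, l, p) (v, m, q). \<nu> * ip \<Omega> Th (eps u l) (eps v m) + ip \<Omega> Th u v + ip \<Omega> Th (pdiv v) p + ip \<Omega> Th (pdiv u) q)"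

lemma lin_on_comp_fst: "lin_on U g \<Longrightarrow> lin_on (U \<times> U') (\<lambda>w. g (fst w))"
  by (auto simp: lin_on_def)

lemma lin_on_comp_snd_fst: "lin_on U g \<Longrightarrow> lin_on (U' \<times> (U \<times> U'')) (\<lambda>w. g (fst (snd w)))"
  by (auto simp: lin_on_def)

lemma lin_on_comp_snd_snd: "lin_on U g \<Longrightarrow> lin_on (U' \<times> (U'' \<times> U)) (\<lambda>w. g (snd (snd w)))"
  by (auto simp: lin_on_def)

text \<open>The strain itself depends linearly on its arguments because its defining functional does.\<close>
lemma lin_eps: assumes "e \<in> S" shows "lin_on W (\<lambda>w. ip \<Omega> Th (eps (fst w) (fst (snd w))) e)"
proof -
  have "lin_on W (\<lambda>w. cellform (fst w) e + skelform (fst (snd w)) e)"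
    by (intro lin_on_plus lin_on_comp_fst cellform_lin_v lin_on_comp_snd_fst skelform_lin_mu assms)
  moreover have "a *\<^sub>R x + b *\<^sub>R y \<in> W" if "x \<in> W" "y \<in> W" for a b x y
    using subspace_W that by (intro subspace_add subspace_scale)
  ultimately show ?thesis using eps(2)[OF _ _ assms] unfolding lin_on_def by (auto simp: mem_Times_iff)
qed

lemma pdiv_lincomb:
  assumes "v \<in> V" "w \<in> V" "T \<in> Th" shows "pdiv (a *\<^sub>R v + b *\<^sub>R w) T = (a *\<^sub>R pdiv v + b *\<^sub>R pdiv w) T"
  unfolding pdiv_def lincomb_apply
  using vdiv_lincomb[OF V_h_Poly[OF assms(1,3)] V_h_Poly[OF assms(2,3)]] by (simp add: fun_eq_iff)

lemma lin_pdiv: assumes "q \<in> Q" shows "lin_on V (\<lambda>v. ip \<Omega> Th (pdiv v) q)"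
proof (rule lin_onI)
  fix x y a b assume xy: "x \<in> V" "y \<in> V"
  have "ip \<Omega> Th (pdiv (a *\<^sub>R x + b *\<^sub>R y)) q = ip \<Omega> Th (a *\<^sub>R pdiv x + b *\<^sub>R pdiv y) q"
  proof -
    have "pw Th (pdiv (a *\<^sub>R x + b *\<^sub>R y)) = pw Th (a *\<^sub>R pdiv x + b *\<^sub>R pdiv y)"
      unfolding pw_def using pdiv_lincomb[OF xy] by (intro ext sum.cong) auto
    then show ?thesis by (simp add: ip_def)
  qed
  also have "\<dots> = a * ip \<Omega> Th (pdiv x) q + b * ip \<Omega> Th (pdiv y) q"
    by (rule lin_onD[OF lin_ip(1)[of "pdiv ` V" q]]) (use cont_pdiv cont_Q[OF assms] xy in auto)
  finally show "ip \<Omega> Th (pdiv (a *\<^sub>R x + b *\<^sub>R y)) q = a * ip \<Omega> Th (pdiv x) q + b * ip \<Omega> Th (pdiv y) q" .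
qed

lemma saddle_apply: "saddle w y = \<nu> * ip \<Omega> Th (eps (fst w) (fst (snd w))) (eps (fst y) (fst (snd y))) + ip \<Omega> Th (fst w) (fst y)
   + ip \<Omega> Th (pdiv (fst y)) (snd (snd w)) + ip \<Omega> Th (pdiv (fst w)) (snd (snd y))"
  by (simp add: saddle_def split_beta)

lemma saddle_sym: "saddle w y = saddle y w"
  by (simp add: saddle_apply ip_commute)

lemma W_D: "w \<in> W \<Longrightarrow> fst w \<in> V" "w \<in> W \<Longrightarrow> fst (snd w) \<in> L" "w \<in> W \<Longrightarrow> snd (snd w) \<in> Q"
  by (auto simp: mem_Times_iff)

lemma bilin_saddle: "bilin_on W saddle"
proof -
  have l: "lin_on W (\<lambda>w. saddle w y)" if y: "y \<in> W" for y
  proof -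
    note yD = W_D[OF y]
    show ?thesis unfolding saddle_apply
      by (intro lin_on_plus lin_on_const_mult lin_eps eps(1)[OF yD(1,2)] lin_on_comp_fst[OF lin_ip_V[OF yD(1)]]
        lin_on_comp_snd_snd[OF lin_ip_pdiv[OF yD(1)]] lin_on_comp_fst[OF lin_pdiv[OF yD(3)]])
  qed
  have "lin_on W (saddle y)" if "y \<in> W" for y
  proof -
    have e: "saddle y = (\<lambda>w. saddle w y)" by (rule ext) (rule saddle_sym)
    show ?thesis using l[OF that] unfolding e .
  qed
  then show ?thesis using l unfolding bilin_on_def by blast
qed

lemma pdiv_zero: "q \<in> Q \<Longrightarrow> ip \<Omega> Th (pdiv 0) q = 0"
  by (rule lin_on_zero[OF lin_pdiv zero_in(1)])

lemma ip_zero: "ip \<Omega> Th 0 v = 0" "ip \<Omega> Th v 0 = 0"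
  by (simp_all add: ip_def pw_zero l2i_def)

lemma eps_zero: "eps 0 0 = 0"
  by (rule eps_unique) (simp_all add: zero_in ip_zero cellform_zero skelform_zero)

text \<open>Testing with the solution gives zero velocity and zero strain; the skeleton form then vanishes, which
  kills the multiplier, and the remaining equation says that the pressure is orthogonal to all
  divergences.\<close>
lemma saddle_nondegenerate:
  assumes w: "w \<in> W" and z: "\<And>y. y \<in> W \<Longrightarrow> saddle w y = 0"
  shows "w = 0"
proof -
  obtain u l p where w_eq: "w = (u, l, p)" by (cases w)
  then have in_sp: "u \<in> V" "l \<in> L" "p \<in> Q" using w by auto
  have div0: "ip \<Omega> Th (pdiv u) q = 0" if "q \<in> Q" for q
  proof -
    have "saddle w (0, 0, q) = ip \<Omega> Th (pdiv u) q"
      by (simp add: saddle_apply w_eq eps_zero ip_zero pdiv_zero in_sp)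
    then show ?thesis using z[of "(0, 0, q)"] zero_in that by simp
  qed
  have "\<nu> * ip \<Omega> Th (eps u l) (eps u l) + ip \<Omega> Th u u = 0"
    using z[OF w] div0[OF in_sp(3)] by (simp add: saddle_apply w_eq)
  moreover have "0 \<le> \<nu> * ip \<Omega> Th (eps u l) (eps u l)" "0 \<le> ip \<Omega> Th u u"
    using \<nu> ip_nonneg[of "eps u l"] ip_nonneg[of u] by simp_all
  ultimately have "\<nu> * ip \<Omega> Th (eps u l) (eps u l) = 0" "ip \<Omega> Th u u = 0" by linarith+
  then have e0: "eps u l = 0" and u0: "u = 0"
    using \<nu> ip_S_definite[OF eps(1)[OF in_sp(1,2)]] ip_V_definite[OF in_sp(1)] by auto
  have "skelform l \<tau> = 0" if "\<tau> \<in> S" for \<tau>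
    using eps(2)[OF in_sp(1,2) that] e0 u0 cellform_zero(1)[OF that] by (simp add: ip_zero)
  then have l0: "l = 0" by (rule skelform_injective[OF in_sp(2)])
  have "ip \<Omega> Th (pdiv v) p = 0" if v: "v \<in> V" for v
  proof -
    have "saddle w (v, 0, 0) = ip \<Omega> Th (pdiv v) p"
      by (simp only: saddle_apply w_eq fst_conv snd_conv e0 ip_zero) (simp add: u0 ip_zero)
    then show ?thesis using z[of "(v, 0, 0)"] zero_in v by simp
  qed
  then have "p = 0" by (rule pressure_zero[OF in_sp(3)])
  then show ?thesis using u0 l0 by (simp add: w_eq zero_prod_def)
qed

definition load :: "(real^'n \<Rightarrow> real^'n) \<Rightarrow> ((real^'n) set \<Rightarrow> real^'n \<Rightarrow> real^'n) \<Rightarrow> real" where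
  "load f v = l2i (lebesgue_on \<Omega>) f (pw Th v)"

lemma pw_V_L2: "v \<in> V \<Longrightarrow> pw Th v \<in> L2 \<Omega>"
  by (rule pw_L2) (rule cont_V)

lemma lin_load: assumes f: "f \<in> L2 \<Omega>" shows "lin_on V (load f)"
proof (rule lin_onI)
  fix x y a b assume xy: "x \<in> V" "y \<in> V"
  show "load f (a *\<^sub>R x + b *\<^sub>R y) = a * load f x + b * load f y"
    unfolding load_def pw_lincomb' l2i_commute[of _ f]
    by (intro l2i_lincomb integrable_L2_inner pw_V_L2 xy f)
qed

lemma solves_H_iff:
  assumes f: "f \<in> L2 \<Omega>"
  shows "solvesH f u l p \<longleftrightarrow> (u, l, p) \<in> W \<and> (\<forall>y\<in>W. saddle (u, l, p) y = load f (fst y))"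
proof -
  have load0: "load f 0 = 0" by (rule lin_on_zero[OF lin_load[OF f] zero_in(1)])
  have "(\<forall>v\<in>V. \<forall>\<mu>\<in>L. \<forall>q\<in>Q. \<nu> * ip \<Omega> Th (eps u l) (eps v \<mu>) + ip \<Omega> Th u v + ip \<Omega> Th (pdiv v) p = load f v \<and> ip \<Omega> Th (pdiv u) q = 0)
     \<longleftrightarrow> (\<forall>y\<in>W. saddle (u, l, p) y = load f (fst y))" (is "?H \<longleftrightarrow> ?saddle") if in_sp: "u \<in> V" "l \<in> L" "p \<in> Q"
  proof
    assume ?H
    then show ?saddle by (auto simp: saddle_apply)
  next
    assume R: ?saddle
    show ?H
    proof (intro ballI)
      fix v \<mu> q assume v: "v \<in> V" "\<mu> \<in> L" "q \<in> Q"
      have "saddle (u, l, p) (v, \<mu>, 0) = load f v" "saddle (u, l, p) (0, 0, q) = load f 0" using R v zero_in by auto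
      then show "\<nu> * ip \<Omega> Th (eps u l) (eps v \<mu>) + ip \<Omega> Th u v + ip \<Omega> Th (pdiv v) p = load f v \<and> ip \<Omega> Th (pdiv u) q = 0"
        by (simp add: saddle_apply ip_zero eps_zero pdiv_zero in_sp load0)
    qed
  qed
  then show ?thesis unfolding solves_H_def eps_def[symmetric] load_def[symmetric] by auto
qed

lemma H_unique_solution:
  assumes f: "f \<in> L2 \<Omega>" shows "\<exists>!(u, l, p). solvesH f u l p"
proof -
  have ex: "\<exists>!w. w \<in> W \<and> (\<forall>y\<in>W. saddle w y = load f (fst y))"
    by (rule symmetric_form_represents[OF subspace_W fin_dim_W bilin_saddle saddle_sym saddle_nondegenerate])
      (auto intro: lin_on_comp_fst[OF lin_load[OF f]])
  have e: "(case w of (u, l, p) \<Rightarrow> solvesH f u l p) \<longleftrightarrow> w \<in> W \<and> (\<forall>y\<in>W. saddle w y = load f (fst y))" for w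
    by (cases w) (simp only: prod.case solves_H_iff[OF f])
  show ?thesis using ex unfolding e[symmetric] .
qed

text \<open>Polarization of the sum of the squared norms in the stability estimate.\<close>
definition solution_size :: "((real^'n) set \<Rightarrow> real^'n \<Rightarrow> real^'n) \<times> ((real^'n) set \<Rightarrow> real^'n \<Rightarrow> real^'n) \<times> ((real^'n) set \<Rightarrow> real^'n \<Rightarrow> real) \<Rightarrow> _ \<Rightarrow> real" where
  "solution_size w y = ip \<Omega> Th (fst w) (fst y)
     + (\<Sum>F\<in>facets Th. facet_ip F (fst (snd w) F) (fst (snd y) F)) + ip \<Omega> Th (snd (snd w)) (snd (snd y))"

lemma bilin_solution_size: "bilin_on W solution_size"
proof -
  have l: "lin_on W (\<lambda>w. solution_size w y)" if y: "y \<in> W" for y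
  proof -
    note yD = W_D[OF y]
    have lL: "lin_on L (\<lambda>\<mu>. facet_ip F (\<mu> F) (fst (snd y) F))" if F: "F \<in> facets Th" for F
    proof (rule lin_onI)
      fix x z a b assume xz: "x \<in> L" "z \<in> L"
      note P = plus_cell(1,2)[OF F]
      show "facet_ip F ((a *\<^sub>R x + b *\<^sub>R z) F) (fst (snd y) F) = a * facet_ip F (x F) (fst (snd y) F) + b * facet_ip F (z F) (fst (snd y) F)"
        unfolding lincomb_apply
        by (rule flat.facet_l2i_lincomb(1)[OF flat_facet[OF P] L_facet_fun[OF xz(1) P] L_facet_fun[OF xz(2) P] L_facet_fun[OF yD(2) P]])
    qed
    have "lin_on W (\<lambda>w. facet_ip F (fst (snd w) F) (fst (snd y) F))" if "F \<in> facets Th" for F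
      using lin_on_comp_snd_fst[OF lL[OF that]] .
    then show ?thesis unfolding solution_size_def
      by (intro lin_on_plus lin_on_setsum lin_on_comp_fst[OF lin_ip_V[OF yD(1)]]
         lin_on_comp_snd_snd[OF lin_ip_Q[OF yD(3)]])
  qed
  have "lin_on W (solution_size y)" if "y \<in> W" for y
  proof -
    have e: "solution_size y = (\<lambda>w. solution_size w y)"
      by (rule ext) (simp add: solution_size_def ip_commute l2i_commute)
    show ?thesis using l[OF that] unfolding e .
  qed
  then show ?thesis using l unfolding bilin_on_def by blast
qed

lemma H_stable:
  "\<exists>C. \<forall>f\<in>L2 \<Omega>. \<forall>u l p. solvesH f u l p \<longrightarrow>
        l2norm (lebesgue_on \<Omega>) (pw Th u) + skel_norm Th nF l + l2norm (lebesgue_on \<Omega>) (pw Th p)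
          \<le> C * l2norm (lebesgue_on \<Omega>) f"
proof -
  let ?M = "lebesgue_on \<Omega>"
  have n0: "0 \<le> l2norm ?M g" for g :: "real^'n \<Rightarrow> real^'n" by (simp add: l2norm_def l2i_nonneg)
  have "\<exists>C\<ge>0. \<forall>w\<in>W. \<forall>t\<ge>0. (\<forall>y\<in>W. \<bar>saddle w y\<bar> \<le> t * l2norm ?M (pw Th (fst y))) \<longrightarrow> solution_size w w \<le> C * t\<^sup>2"
    by (rule symmetric_form_stability[OF subspace_W fin_dim_W bilin_saddle saddle_sym saddle_nondegenerate bilin_solution_size n0])
  then obtain C where C: "C \<ge> 0" "\<forall>w\<in>W. \<forall>t\<ge>0. (\<forall>y\<in>W. \<bar>saddle w y\<bar> \<le> t * l2norm ?M (pw Th (fst y))) \<longrightarrow> solution_size w w \<le> C * t\<^sup>2"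
    by blast
  show ?thesis
  proof (intro exI ballI allI impI)
    fix f u l p assume f: "f \<in> L2 \<Omega>" and s: "solvesH f u l p"
    let ?w = "(u, l, p)"
    have w: "?w \<in> W" and eq: "\<And>y. y \<in> W \<Longrightarrow> saddle ?w y = load f (fst y)" using s solves_H_iff[OF f] by blast+
    have "\<bar>saddle ?w y\<bar> \<le> l2norm ?M f * l2norm ?M (pw Th (fst y))" if "y \<in> W" for y
      unfolding eq[OF that] load_def by (rule l2_Cauchy_Schwarz[OF f pw_V_L2[OF W_D(1)[OF that]]])
    then have b: "solution_size ?w ?w \<le> C * (l2norm ?M f)\<^sup>2"
      using C(2)[THEN bspec, OF w, THEN spec, THEN mp, OF n0] by blast
    have parts: "0 \<le> ip \<Omega> Th u u" "0 \<le> (\<Sum>F\<in>facets Th. facet_ip F (l F) (l F))" "0 \<le> ip \<Omega> Th p p"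
      by (auto intro!: ip_nonneg sum_nonneg l2i_nonneg)
    have root: "sqrt r \<le> sqrt C * l2norm ?M f" if "r \<le> C * (l2norm ?M f)\<^sup>2" for r
      using real_sqrt_le_mono[OF that] n0[of f] by (simp add: real_sqrt_mult)
    have "l2norm ?M (pw Th u) \<le> sqrt C * l2norm ?M f" "skel_norm Th nF l \<le> sqrt C * l2norm ?M f" "l2norm ?M (pw Th p) \<le> sqrt C * l2norm ?M f"
      unfolding skel_norm_def l2norm_def[of _ "pw Th u"] l2norm_def[of _ "pw Th p"]
      using b parts by (auto intro!: root simp: solution_size_def ip_def)
    then show "l2norm ?M (pw Th u) + skel_norm Th nF l + l2norm ?M (pw Th p) \<le> (3 * sqrt C) * l2norm ?M f" by simp
  qed
qed

lemma well_posed: "well_posed_H \<Omega> Th nF j k \<nu>"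
  unfolding well_posed_H_def using H_unique_solution H_stable by blast

section \<open>Equivalence of the two methods\<close>

lemma ip_scale: "\<sigma> \<in> S \<Longrightarrow> \<tau> \<in> S \<Longrightarrow> ip \<Omega> Th (c *\<^sub>R \<sigma>) \<tau> = c * ip \<Omega> Th \<sigma> \<tau>"
  by (rule lin_on_scale[OF lin_ip_S(1)])

lemma Sigma_tn_sub: "Stn \<subseteq> S"
  by (auto simp: Sigma_tn_def)

lemma scaled_eq: "(\<lambda>T x. c *\<^sub>R dev_eps_w \<Omega> Th nF j k u l T x) = c *\<^sub>R eps u l"
  by (simp add: fun_eq_iff eps_def)

text \<open>Varying only the multiplier shows that the stress has no tangential-normal jumps. The equations of (D)
  are the definition of the strain, where the skeleton term drops out for continuous test stresses, and
  the velocity equation of (H).\<close>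
lemma H_imp_D:
  assumes H: "solvesH f u l p"
  shows "solvesD f (\<nu> *\<^sub>R eps u l) u p"
proof -
  have in_sp: "u \<in> V" "l \<in> L" "p \<in> Q" using H by (auto simp: solves_H_def)
  have eq1: "\<nu> * ip \<Omega> Th (eps u l) (eps v \<mu>) + ip \<Omega> Th u v + ip \<Omega> Th (pdiv v) p = load f v" if "v \<in> V" "\<mu> \<in> L" for v \<mu>
    using H that zero_in(3) unfolding solves_H_def eps_def load_def by blast
  have eq2: "ip \<Omega> Th (pdiv u) q = 0" if "q \<in> Q" for q
    using H that zero_in unfolding solves_H_def by blast
  note e = eps(1)[OF in_sp(1,2)]
  have eS: "\<nu> *\<^sub>R eps u l \<in> S" by (rule subspace_scale[OF subspace_S e])
  have load0: "load f 0 = 0" by (simp add: load_def pw_zero l2i_def)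
  have "skelform \<mu> (\<nu> *\<^sub>R eps u l) = 0" if \<mu>: "\<mu> \<in> L" for \<mu>
  proof -
    have "\<nu> * ip \<Omega> Th (eps u l) (eps 0 \<mu>) = 0"
      using eq1[OF zero_in(1) \<mu>] by (simp add: ip_zero pdiv_zero in_sp load0)
    then have "\<nu> * skelform \<mu> (eps u l) = 0"
      using eps(2)[OF zero_in(1) \<mu> e] by (simp add: ip_commute[of "eps u l"] cellform_zero e)
    then show ?thesis using lin_on_scale[OF skelform_lin[OF \<mu>] e] by simp
  qed
  then have tn_part: "\<nu> *\<^sub>R eps u l \<in> Stn" using Sigma_tn_iff[OF eS] by blast
  have D1: "inverse \<nu> * ip \<Omega> Th (\<nu> *\<^sub>R eps u l) \<tau> + b_h \<Omega> Th nF \<tau> q u = 0" if \<tau>: "\<tau> \<in> Stn" and q: "q \<in> Q" for \<tau> q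
  proof -
    have \<tau>S: "\<tau> \<in> S" using \<tau> Sigma_tn_sub by blast
    have "skelform l \<tau> = 0" using \<tau> Sigma_tn_iff[OF \<tau>S] in_sp(2) by blast
    then show ?thesis
      using \<nu> eps(2)[OF in_sp(1,2) \<tau>S] eq2[OF q] by (simp add: ip_scale[OF e \<tau>S] b_h_eq)
  qed
  have D2: "b_h \<Omega> Th nF (\<nu> *\<^sub>R eps u l) p v - ip \<Omega> Th u v = - load f v" if v: "v \<in> V" for v
  proof -
    have c1: "cellform v (\<nu> *\<^sub>R eps u l) = \<nu> * cellform v (eps u l)" by (rule lin_on_scale[OF cellform_lin[OF v] e])
    have c2: "cellform v (eps u l) = ip \<Omega> Th (eps u l) (eps v 0)"
      using eps(2)[OF v zero_in(2) e] by (simp add: ip_commute[of "eps u l"] skelform_zero e)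
    show ?thesis using eq1[OF v zero_in(2)] unfolding b_h_eq c1 c2 by simp
  qed
  show ?thesis unfolding solves_D_def load_def[symmetric] using in_sp tn_part D1 D2 by blast
qed

text \<open>The first equation of (D) says that a functional on the broken stress space vanishes on the kernel of
  all skeleton forms. By \<open>functional_in_span\<close> it is a skeleton form itself, and its multiplier is the
  desired one.\<close>
lemma D_imp_H:
  assumes f: "f \<in> L2 \<Omega>" and D: "solvesD f \<sigma> u p"
  shows "\<exists>l. solvesH f u l p \<and> \<sigma> = \<nu> *\<^sub>R eps u l"
proof -
  have tn_part: "\<sigma> \<in> Stn" and in_sp: "u \<in> V" "p \<in> Q" using D by (auto simp: solves_D_def)
  have \<sigma>S: "\<sigma> \<in> S" using tn_part Sigma_tn_sub by blast
  have D1: "inverse \<nu> * ip \<Omega> Th \<sigma> \<tau> + b_h \<Omega> Th nF \<tau> q u = 0" if "\<tau> \<in> Stn" "q \<in> Q" for \<tau> q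
    using D that zero_in unfolding solves_D_def by blast
  have D2: "b_h \<Omega> Th nF \<sigma> p v - ip \<Omega> Th u v = - load f v" if "v \<in> V" for v
    using D that tn_part zero_in unfolding solves_D_def load_def by blast
  have div0: "ip \<Omega> Th (pdiv u) q = 0" if "q \<in> Q" for q
  proof -
    have "(0 :: (real^'n) set \<Rightarrow> real^'n \<Rightarrow> real^'n^'n) \<in> Stn"
      using Sigma_tn_iff[OF zero_in(4)] skelform_zero(2) by blast
    from D1[OF this that] show ?thesis by (simp add: ip_zero b_h_eq cellform_zero in_sp)
  qed
  define G where "G \<tau> = inverse \<nu> * ip \<Omega> Th \<sigma> \<tau> + - cellform u \<tau>" for \<tau>
  have lipS: "lin_on S (ip \<Omega> Th \<sigma>)" using bilin_ip_S \<sigma>S by (auto simp: bilin_on_def)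
  have lG: "lin_on S G" unfolding G_def
    by (intro lin_on_plus lin_on_const_mult lin_on_neg lipS cellform_lin in_sp)
  obtain B where B: "finite B" "independent B" "L = span B" by (rule fin_dim_basis[OF subspace_L fin_dim_L])
  have BL: "\<mu> \<in> L" if "\<mu> \<in> B" for \<mu> unfolding B(3) using that by (rule span_base)
  have "\<exists>c. \<forall>\<tau>\<in>S. G \<tau> = (\<Sum>\<mu>\<in>B. c \<mu> * skelform \<mu> \<tau>)"
  proof (rule functional_in_span[OF B(1) subspace_S skelform_lin[OF BL] lG])
    fix \<tau> assume \<tau>: "\<tau> \<in> S" and z: "\<And>\<mu>. \<mu> \<in> B \<Longrightarrow> skelform \<mu> \<tau> = 0"
    have "skelform \<mu> \<tau> = 0" if "\<mu> \<in> L" for \<mu>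
      by (rule lin_on_zero_span[OF B(1) B(3) skelform_lin_mu[OF \<tau>] z that])
    then have "\<tau> \<in> Stn" using Sigma_tn_iff[OF \<tau>] by blast
    from D1[OF this zero_in(3)] show "G \<tau> = 0" by (simp add: G_def b_h_eq ip_zero)
  qed
  then obtain c where c: "\<And>\<tau>. \<tau> \<in> S \<Longrightarrow> G \<tau> = (\<Sum>\<mu>\<in>B. c \<mu> * skelform \<mu> \<tau>)" by blast
  define l where "l = (\<Sum>\<mu>\<in>B. c \<mu> *\<^sub>R \<mu>)"
  have l: "l \<in> L" unfolding l_def by (intro subspace_sum subspace_scale subspace_L BL)
  have Gl: "G \<tau> = skelform l \<tau>" if "\<tau> \<in> S" for \<tau>
    unfolding c[OF that] l_def by (rule lin_on_basis_sum[OF skelform_lin_mu[OF that] subspace_L BL, symmetric])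
  have e: "eps u l = inverse \<nu> *\<^sub>R \<sigma>"
  proof (rule eps_unique[OF in_sp(1) l])
    show "inverse \<nu> *\<^sub>R \<sigma> \<in> S" by (rule subspace_scale[OF subspace_S \<sigma>S])
    show "ip \<Omega> Th (inverse \<nu> *\<^sub>R \<sigma>) \<tau> = cellform u \<tau> + skelform l \<tau>" if "\<tau> \<in> S" for \<tau>
      unfolding ip_scale[OF \<sigma>S that] using Gl[OF that] by (simp add: G_def)
  qed
  then have \<sigma>: "\<sigma> = \<nu> *\<^sub>R eps u l" using \<nu> by simp
  have "\<nu> * ip \<Omega> Th (eps u l) (eps v \<mu>) + ip \<Omega> Th u v + ip \<Omega> Th (pdiv v) p = load f v" if v: "v \<in> V" and \<mu>: "\<mu> \<in> L" for v \<mu>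
  proof -
    have "skelform \<mu> \<sigma> = 0" using tn_part Sigma_tn_iff[OF \<sigma>S] \<mu> by blast
    have "\<nu> * ip \<Omega> Th (eps u l) (eps v \<mu>) = ip \<Omega> Th \<sigma> (eps v \<mu>)"
      using ip_scale[OF eps(1)[OF in_sp(1) l] eps(1)[OF v \<mu>], of \<nu>] by (simp flip: \<sigma>)
    also have "\<dots> = cellform v \<sigma>"
      using eps(2)[OF v \<mu> \<sigma>S] \<open>skelform \<mu> \<sigma> = 0\<close> by (simp add: ip_commute[of \<sigma>])
    finally show ?thesis using D2[OF v] by (simp add: b_h_eq)
  qed
  then have "solvesH f u l p"
    unfolding solves_H_def eps_def[symmetric] load_def[symmetric] using in_sp l div0 by blast
  then show ?thesis using \<sigma> by blast
qed

end

theorem theorem6p1: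
  fixes \<Omega> :: "(real^'n) set"
    and Th :: "(real^'n) set set"
    and nF :: "(real^'n) set \<Rightarrow> real^'n"
    and j :: "(real^'n) set \<Rightarrow> real^'n \<Rightarrow> real^'n"
    and k :: nat
    and \<nu> :: real
  assumes dim: "CARD('n) \<ge> 2"
    and domain: "polytopal_domain \<Omega>"
    and mesh: "simplicial_mesh \<Omega> Th"
    and normals: "facet_normals Th nF"
    and fixed_vertex: "\<And>T l. T \<in> Th \<Longrightarrow> l \<in> verts T \<Longrightarrow> j T l \<in> verts T - {l}"
    and nu: "0 < \<nu>" "\<nu> \<le> 1"
  shows "well_posed_H \<Omega> Th nF j k \<nu> \<and>
    (\<forall>f\<in>L2 \<Omega>.
       (\<forall>u l p. solves_H \<Omega> Th nF j k \<nu> f u l p \<longrightarrow>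
          solves_D \<Omega> Th nF j k \<nu> f (\<lambda>T x. \<nu> *\<^sub>R dev_eps_w \<Omega> Th nF j k u l T x) u p) \<and>
       (\<forall>\<sigma> u p. solves_D \<Omega> Th nF j k \<nu> f \<sigma> u p \<longrightarrow>
          (\<exists>!l. solves_H \<Omega> Th nF j k \<nu> f u l p \<and>
                \<sigma> = (\<lambda>T x. \<nu> *\<^sub>R dev_eps_w \<Omega> Th nF j k u l T x))))"
proof -
  interpret hybrid \<Omega> Th nF j k \<nu>
    by unfold_locales (use domain mesh normals fixed_vertex nu in auto)
  show ?thesis
    unfolding scaled_eq
  proof (intro conjI ballI allI impI)
    show "well_posed_H \<Omega> Th nF j k \<nu>" by (rule well_posed)
  next
    fix f u l p assume "f \<in> L2 \<Omega>" "solves_H \<Omega> Th nF j k \<nu> f u l p"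
    then show "solves_D \<Omega> Th nF j k \<nu> f (\<nu> *\<^sub>R eps u l) u p" by (intro H_imp_D)
  next
    fix f \<sigma> u p assume f: "f \<in> L2 \<Omega>" and D: "solves_D \<Omega> Th nF j k \<nu> f \<sigma> u p"
    obtain l where l: "solves_H \<Omega> Th nF j k \<nu> f u l p" "\<sigma> = \<nu> *\<^sub>R eps u l" using D_imp_H[OF f D] by blast
    show "\<exists>!l. solves_H \<Omega> Th nF j k \<nu> f u l p \<and> \<sigma> = \<nu> *\<^sub>R eps u l"
    proof (rule ex1I[of _ l])
      show "solves_H \<Omega> Th nF j k \<nu> f u l p \<and> \<sigma> = \<nu> *\<^sub>R eps u l" using l by blast
      fix l' assume "solves_H \<Omega> Th nF j k \<nu> f u l' p \<and> \<sigma> = \<nu> *\<^sub>R eps u l'"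
      then show "l' = l" using H_unique_solution[OF f] l(1) by auto
    qed
  qed
qed

end
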